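(* Let $T$ be a label invariant operator on a tree $\mathcal T=\mathcal T(M,j)$, where $M$ is a substitution matrix satisfying (M0), (M1), (M2). Then the spectrum of $T$ consists of finitely many intervals and is purely absolutely continuous.
   Context: Let $\mathcal A$ be a finite nonempty set (labels) and $M:\mathcal A\times\mathcal A\to\mathbb N_0$ (the substitution matrix). For $j\in\mathcal A$, $\mathcal T(M,j)=(\mathcal V,\mathcal E)$ is the rooted tree with labeling $a:\mathcal V\to\mathcal A$ whose root $o$ has label $j$ and in which each vertex of label $k$ in the $n$-th sphere (distance $n$ from $o$) has exactly $M_{k,l}$ neighbors of label $l$ in the $(n+1)$-th sphere, for every $l\in\mathcal A$. Standing assumptions: (M0) if $\mathcal A$ has only one element, then $M>1$; (M1) $M_{k,k}\ge 1$ for all $k\in\mathcal A$; (M2) there is $n\in\mathbb N$ such that all entries of $M^n$ are positive. Let $\nu:\mathcal V\to(0,\infty)$ be label invariant ($\nu(x)=\nu(y)$ whenever $a(x)=a(y)$) and $\ell^2(\mathcal V,\nu)=\{\varphi:\mathcal V\to\mathbb C\mid\sum_x|\varphi(x)|^2\nu(x)<\infty\}$. A label invariant operator is an operator $T$ on $\ell^2(\mathcal V,\nu)$ of the form $(T\varphi)(x)=\sum_{y\sim x}t(x,y)\varphi(y)+w(x)\varphi(x)$ with $t:\mathcal V\times\mathcal V\to\mathbb C$, $w:\mathcal V\to\mathbb R$ such that: (T0) $t(x,y)\ne0$ if and only if $x\sim y$; (T1) $t(x,y)\nu(x)=\overline{t(y,x)}\nu(y)$ for all $x,y$; (T2) there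 are a matrix $(m_{k,l})_{k,l\in\mathcal A}$ and a vector $(m_k)_{k\in\mathcal A}$ with $m_{a(x),a(y)}=|t(x,y)|^2M_{a(x),a(y)}$ for all $x\sim y$ and $m_{a(x)}=w(x)$ for all $x$. Such $T$ is bounded and self-adjoint. *)

theory Defs
  imports "HOL-Analysis.Analysis" "HOL-Computational_Algebra.Polynomial"
begin

section \<open>Trees generated by a substitution matrix\<close>

text \<open>
  Graphs are given by an adjacency relation; the vertex set is the whole type.
\<close>

definition has_cycle :: "('v \<Rightarrow> 'v \<Rightarrow> bool) \<Rightarrow> bool" where
  "has_cycle adj \<longleftrightarrow>
     (\<exists>p. length p \<ge> 3 \<and> distinct p \<and> successively adj p \<and> adj (last p) (hd p))"

definition tree :: "('v \<Rightarrow> 'v \<Rightarrow> bool) \<Rightarrow> bool" where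
  "tree adj \<longleftrightarrow>
     symp adj \<and> irreflp adj \<and> (\<forall>x y. adj\<^sup>*\<^sup>* x y) \<and> \<not> has_cycle adj"

definition graph_dist :: "('v \<Rightarrow> 'v \<Rightarrow> bool) \<Rightarrow> 'v \<Rightarrow> 'v \<Rightarrow> nat" where
  "graph_dist adj x y = (LEAST n. (adj ^^ n) x y)"

text \<open>
  The rooted labelled tree \<open>\<T>(M,j)\<close> is determined up to isomorphism, so it is described by a
  predicate on adjacency relation, root and labelling. Finiteness is stated separately because
  \<open>card\<close> is \<open>0\<close> on infinite sets.
\<close>

definition substitution_tree ::
  "nat ^ 'a ^ 'a \<Rightarrow> 'a::finite \<Rightarrow> ('v \<Rightarrow> 'v \<Rightarrow> bool) \<Rightarrow> 'v \<Rightarrow> ('v \<Rightarrow> 'a) \<Rightarrow> bool" where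
  "substitution_tree M j adj r a \<longleftrightarrow>
     tree adj \<and> a r = j \<and>
     (\<forall>x l. let C = {y. adj x y \<and> a y = l \<and> graph_dist adj r y = graph_dist adj r x + 1}
            in finite C \<and> card C = M $ a x $ l)"

definition matrix_power :: "nat ^ 'a ^ 'a \<Rightarrow> nat \<Rightarrow> nat ^ 'a ^ ('a::finite)" where
  "matrix_power M n = (((**) M) ^^ n) (mat 1)"


section \<open>Weighted sequence spaces\<close>

text \<open>The space \<open>\<ell>\<^sup>2(V,\<nu>)\<close> is a set of functions on the vertex type.\<close>

definition l2 :: "('v \<Rightarrow> real) \<Rightarrow> ('v \<Rightarrow> complex) set" where
  "l2 \<nu> = {\<phi>. (\<lambda>x. (cmod (\<phi> x))\<^sup>2 * \<nu> x) summable_on UNIV}"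

definition l2_inner :: "('v \<Rightarrow> real) \<Rightarrow> ('v \<Rightarrow> complex) \<Rightarrow> ('v \<Rightarrow> complex) \<Rightarrow> complex" where
  "l2_inner \<nu> \<phi> \<psi> = (\<Sum>\<^sub>\<infinity>x. cnj (\<phi> x) * \<psi> x * complex_of_real (\<nu> x))"

definition l2_norm :: "('v \<Rightarrow> real) \<Rightarrow> ('v \<Rightarrow> complex) \<Rightarrow> real" where
  "l2_norm \<nu> \<phi> = sqrt (\<Sum>\<^sub>\<infinity>x. (cmod (\<phi> x))\<^sup>2 * \<nu> x)"


section \<open>Spectrum and absolute continuity\<close>

text \<open>
  Operators on \<open>\<ell>\<^sup>2(V,\<nu>)\<close> are functions on \<open>V \<Rightarrow> \<complex>\<close> of which only the values on \<open>l2 \<nu>\<close> matter.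
  The definitions below are meant for bounded operators (self-adjoint ones from
  \<open>spectral_measure\<close> onwards).
\<close>

definition resolvent_set ::
  "('v \<Rightarrow> real) \<Rightarrow> (('v \<Rightarrow> complex) \<Rightarrow> ('v \<Rightarrow> complex)) \<Rightarrow> complex set" where
  "resolvent_set \<nu> T = {z.
     bij_betw (\<lambda>\<phi> x. T \<phi> x - z * \<phi> x) (l2 \<nu>) (l2 \<nu>) \<and>
     (\<exists>C. \<forall>\<phi>\<in>l2 \<nu>. l2_norm \<nu> \<phi> \<le> C * l2_norm \<nu> (\<lambda>x. T \<phi> x - z * \<phi> x))}"

definition spectrum ::
  "('v \<Rightarrow> real) \<Rightarrow> (('v \<Rightarrow> complex) \<Rightarrow> ('v \<Rightarrow> complex)) \<Rightarrow> complex set" where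
  "spectrum \<nu> T = - resolvent_set \<nu> T"

definition poly_op ::
  "complex poly \<Rightarrow> (('v \<Rightarrow> complex) \<Rightarrow> ('v \<Rightarrow> complex)) \<Rightarrow> ('v \<Rightarrow> complex) \<Rightarrow> ('v \<Rightarrow> complex)" where
  "poly_op p T \<phi> = (\<lambda>x. \<Sum>i\<le>degree p. coeff p i * (T ^^ i) \<phi> x)"

text \<open>
  The spectral measure of a bounded self-adjoint \<open>T\<close> at the vector \<open>\<phi>\<close> is the finite Borel measure
  \<open>\<mu>\<close> carried by the spectrum with \<open>\<langle>\<phi>, f(T) \<phi>\<rangle> = \<integral> f d\<mu>\<close> for all continuous \<open>f\<close> on the spectrum.
  Here \<open>f(T)\<close> is the norm limit of \<open>p\<^sub>n(T)\<close> for polynomials \<open>p\<^sub>n\<close> converging to \<open>f\<close> uniformly on the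
  (compact) spectrum, so that it suffices to ask for the identity for polynomials. By the spectral
  theorem there is exactly one such measure.
\<close>

definition spectral_measure ::
  "('v \<Rightarrow> real) \<Rightarrow> (('v \<Rightarrow> complex) \<Rightarrow> ('v \<Rightarrow> complex)) \<Rightarrow> ('v \<Rightarrow> complex) \<Rightarrow> real measure \<Rightarrow> bool" where
  "spectral_measure \<nu> T \<phi> \<mu> \<longleftrightarrow>
     finite_measure \<mu> \<and> sets \<mu> = sets borel \<and>
     (AE s in \<mu>. complex_of_real s \<in> spectrum \<nu> T) \<and>
     (\<forall>p. l2_inner \<nu> \<phi> (poly_op p T \<phi>) = (\<integral>s. poly p (complex_of_real s) \<partial>\<mu>))"

definition ac_subspace ::
  "('v \<Rightarrow> real) \<Rightarrow> (('v \<Rightarrow> complex) \<Rightarrow> ('v \<Rightarrow> complex)) \<Rightarrow> ('v \<Rightarrow> complex) set" where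
  "ac_subspace \<nu> T =
     {\<phi> \<in> l2 \<nu>. \<exists>\<mu>. spectral_measure \<nu> T \<phi> \<mu> \<and> absolutely_continuous lborel \<mu>}"

definition purely_ac_spectrum ::
  "('v \<Rightarrow> real) \<Rightarrow> (('v \<Rightarrow> complex) \<Rightarrow> ('v \<Rightarrow> complex)) \<Rightarrow> bool" where
  "purely_ac_spectrum \<nu> T \<longleftrightarrow> ac_subspace \<nu> T = l2 \<nu>"

text \<open>
  As the spectrum of a bounded self-adjoint operator is a compact subset of the real line, the
  intervals can be taken compact. They are required to be nondegenerate: single points do not count
  as intervals.
\<close>

definition finite_union_of_intervals :: "complex set \<Rightarrow> bool" where
  "finite_union_of_intervals S \<longleftrightarrow>
     (\<exists>F :: real set set. finite F \<and> (\<forall>I\<in>F. \<exists>\<alpha> \<beta>. \<alpha> < \<beta> \<and> I = {\<alpha>..\<beta>}) \<and>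
        S = complex_of_real ` \<Union>F)"


section \<open>Label invariant operators\<close>

definition label_invariant_measure :: "('v \<Rightarrow> 'a) \<Rightarrow> ('v \<Rightarrow> real) \<Rightarrow> bool" where
  "label_invariant_measure a \<nu> \<longleftrightarrow>
     (\<forall>x. \<nu> x > 0) \<and> (\<forall>x y. a x = a y \<longrightarrow> \<nu> x = \<nu> y)"

definition label_invariant_operator ::
  "nat ^ 'a ^ 'a \<Rightarrow> ('v \<Rightarrow> 'v \<Rightarrow> bool) \<Rightarrow> ('v \<Rightarrow> 'a::finite) \<Rightarrow> ('v \<Rightarrow> real) \<Rightarrow>
   (('v \<Rightarrow> complex) \<Rightarrow> ('v \<Rightarrow> complex)) \<Rightarrow> bool" where
  "label_invariant_operator M adj a \<nu> T \<longleftrightarrow>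
     (\<exists>(t :: 'v \<Rightarrow> 'v \<Rightarrow> complex) (w :: 'v \<Rightarrow> real).
        (\<forall>\<phi>\<in>l2 \<nu>. \<forall>x. T \<phi> x = (\<Sum>y\<in>{y. adj x y}. t x y * \<phi> y) + complex_of_real (w x) * \<phi> x) \<and>
        (\<forall>x y. t x y \<noteq> 0 \<longleftrightarrow> adj x y) \<and>
        (\<forall>x y. t x y * complex_of_real (\<nu> x) = cnj (t y x) * complex_of_real (\<nu> y)) \<and>
        (\<exists>(m :: 'a \<Rightarrow> 'a \<Rightarrow> real) (m' :: 'a \<Rightarrow> real).
           (\<forall>x y. adj x y \<longrightarrow> m (a x) (a y) = (cmod (t x y))\<^sup>2 * real (M $ a x $ a y)) \<and>
           (\<forall>x. m' (a x) = w x)))"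

end

theory Submission
  imports Defs "HOL-Complex_Analysis.Conformal_Mappings"
begin

text \<open>
  After multiplication by \<open>sqrt \<nu>\<close> the operator lives on the unweighted space and its hopping terms
  \<open>s x y\<close> form a Hermitian matrix. For a child \<open>y\<close> of \<open>x\<close> the number \<open>|s x y|\<^sup>2\<close> depends on the two labels
  only. Hence the cone of descendants of a vertex has a diagonal Green function \<open>\<Gamma>\<close> at its root that
  depends on the label \<open>k\<close> of that root only, and for \<open>Im z > 0\<close>
  \<open>-1 / \<Gamma> z k = z - w k + (\<Sum>l. A k l * \<Gamma> z l)\<close>,
  where \<open>A k l\<close> is \<open>|s x y|\<^sup>2\<close> summed over the children \<open>y\<close> of label \<open>l\<close>. The proof starts from this
  recursion: it is a contraction for the hyperbolic metric of the upper half-plane, which gives a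
  solution \<open>\<Gamma>\<close> that is holomorphic in \<open>z\<close>, and the resolvent of the whole operator is then written
  down explicitly. All its matrix elements are polynomials in the \<open>\<Gamma> z k\<close> (\<open>green\<close>, \<open>green_in_ell2\<close>).

  Why the spectrum is absolutely continuous: taking imaginary parts in the recursion and keeping only
  the term \<open>A k k > 0\<close> on the right yields \<open>|\<Gamma> z k|\<^sup>2 * A k k \<le> 1\<close> (\<open>cmod_Gamma_le\<close>). So
  \<open>\<langle>\<phi>, (T - z)\<^sup>-\<^sup>1 \<phi>\<rangle>\<close> stays bounded near the real line when \<open>\<phi>\<close> has finite support, and
  the spectral measure of \<open>\<phi>\<close> has the bounded density \<open>Im \<langle>\<phi>, (T - E - i0)\<^sup>-\<^sup>1 \<phi>\<rangle> / \<pi>\<close>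
  (\<open>dens_moment\<close>). An arbitrary \<open>\<phi>\<close> is an \<open>\<ell>\<^sup>2\<close>-limit of finitely supported vectors, whose densities
  converge in \<open>L\<^sup>1\<close> (\<open>spectral_density_exists\<close>).

  Why there are finitely many intervals: each \<open>\<Gamma> z k\<close> is an algebraic function of \<open>z\<close> over the real
  numbers (\<open>Gamma_algebraic\<close>). No elimination theory is used for this. More than enough products of \<open>z\<close>,
  \<open>\<Gamma> z k\<close> and the defining polynomials of the recursion are linearly dependent for dimension reasons.
  Evaluated at the solutions of a perturbed recursion, on which the defining polynomials equal distinct
  powers of a small \<open>\<epsilon>\<close>, the lowest order in \<open>\<epsilon>\<close> of the dependence is a nontrivial relation between
  \<open>z\<close> and \<open>\<Gamma> z k\<close>. An algebraic function has continuous boundary values \<open>g E k\<close> off a finite set \<open>D\<close> of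
  energies, and off \<open>D\<close> the property of being real is open and closed, because a real simple root of a real
  polynomial stays real (\<open>algebraic_boundary_values\<close>). If \<open>g E k\<close> is real at one label, the recursion
  makes it real at all labels reachable from it (\<open>boundary_value_real_propagates\<close>), hence by irreducibility
  at all labels. Thus on every interval between consecutive points of \<open>D\<close> either the root has
  \<open>Im g > 0\<close>, and the interval belongs to the spectrum, or all spectral densities vanish there, and the
  interval is a gap (\<open>bounded_below_in_gap\<close>). A point of \<open>D\<close> between two gaps is
  in the resolvent set too, since densities do not see single points. So the spectrum is the closure of
  finitely many open intervals (\<open>closure_eq_finite_union_Icc\<close>).
\<close>

section \<open>Algebraic dependence by counting monomials\<close>

lemma homogeneous_system_nontrivial_solution:
  fixes C :: "'i \<Rightarrow> 'j \<Rightarrow> 'c::field"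
  assumes "finite J" "finite I" "card J < card I"
  shows "\<exists>x. (\<exists>i\<in>I. x i \<noteq> 0) \<and> (\<forall>j\<in>J. (\<Sum>i\<in>I. x i * C i j) = 0)"
  using assms
proof (induction J arbitrary: I C rule: finite_induct)
  case empty
  then obtain i where "i \<in> I" by fastforce
  then show ?case by (intro exI[of _ "\<lambda>_. 1"]) auto
next
  case (insert j J)
  show ?case
  proof (cases "\<forall>i\<in>I. C i j = 0")
    case True
    have "card J < card I" using insert by auto
    then obtain x where x: "\<exists>i\<in>I. x i \<noteq> 0" "\<forall>j\<in>J. (\<Sum>i\<in>I. x i * C i j) = 0"
      using insert.IH[of I C] insert.prems by auto
    have "(\<Sum>i\<in>I. x i * C i j) = 0" using True by (intro sum.neutral) auto
    then show ?thesis using x by (intro exI[of _ x]) auto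
  next
    case False
    then obtain k where k: "k \<in> I" "C k j \<noteq> 0" by auto
    define I' where "I' = I - {k}"
    have I': "finite I'" "card J < card I'" "k \<notin> I'" "I = insert k I'"
      using insert.prems insert.hyps k by (auto simp: I'_def)
    obtain x where x: "\<exists>i\<in>I'. x i \<noteq> 0"
      "\<forall>j'\<in>J. (\<Sum>i\<in>I'. x i * (C i j' - C i j / C k j * C k j')) = 0"
      using insert.IH[OF I'(1,2), of "\<lambda>i j'. C i j' - C i j / C k j * C k j'"] by auto
    define y where "y = x(k := - (\<Sum>i\<in>I'. x i * C i j / C k j))"
    have yI': "(\<Sum>i\<in>I'. y i * D i) = (\<Sum>i\<in>I'. x i * D i)" for D
      by (rule sum.cong) (use I'(3) in \<open>auto simp: y_def\<close>)
    have tot: "(\<Sum>i\<in>I. y i * D i) = - (\<Sum>i\<in>I'. x i * C i j / C k j) * D k + (\<Sum>i\<in>I'. x i * D i)" for D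
    proof -
      have "(\<Sum>i\<in>I. y i * D i) = y k * D k + (\<Sum>i\<in>I'. y i * D i)" using I' by simp
      then show ?thesis unfolding yI' by (simp add: y_def)
    qed
    have "(\<Sum>i\<in>I. y i * C i j') = 0" if "j' \<in> insert j J" for j'
    proof (cases "j' = j")
      case True
      have "(\<Sum>i\<in>I'. x i * C i j / C k j) * C k j = (\<Sum>i\<in>I'. x i * C i j)"
        using k by (simp add: sum_distrib_right)
      then show ?thesis unfolding tot True by simp
    next
      case False
      then have "(\<Sum>i\<in>I'. x i * (C i j' - C i j / C k j * C k j')) = 0" using x that by auto
      then show ?thesis unfolding tot
        by (simp add: algebra_simps sum_subtractf sum_distrib_left)
    qed
    moreover have "\<exists>i\<in>I. y i \<noteq> 0" using x(1) I' by (auto simp: y_def)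
    ultimately show ?thesis by (intro exI[of _ y]) auto
  qed
qed

lemma digit_expansion_unique:
  fixes B :: nat
  assumes "\<And>i. i < n \<Longrightarrow> d i < B" "\<And>i. i < n \<Longrightarrow> d' i < B"
    and "(\<Sum>i<n. d i * B ^ i) = (\<Sum>i<n. d' i * B ^ i)" "i < n"
  shows "d i = d' i"
  using assms
proof (induction n arbitrary: d d' i)
  case (Suc n)
  have split: "(\<Sum>i<Suc n. e i * B ^ i) = e 0 + B * (\<Sum>i<n. e (Suc i) * B ^ i)" for e
    by (simp add: sum.lessThan_Suc_shift sum_distrib_left algebra_simps del: sum.lessThan_Suc)
  have lt: "d 0 < B" "d' 0 < B" using Suc.prems by auto
  have eq: "d 0 + B * (\<Sum>i<n. d (Suc i) * B ^ i) = d' 0 + B * (\<Sum>i<n. d' (Suc i) * B ^ i)"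
    using Suc.prems(3) unfolding split .
  have 0: "d 0 = d' 0" using arg_cong[OF eq, of "\<lambda>m. m mod B"] lt by simp
  have "B > 0" using lt by simp
  then have "(\<Sum>i<n. d (Suc i) * B ^ i) = (\<Sum>i<n. d' (Suc i) * B ^ i)" using eq 0 by simp
  then have "d (Suc i) = d' (Suc i)" if "i < n" for i
    using Suc.IH[of "\<lambda>i. d (Suc i)" "\<lambda>i. d' (Suc i)" i] Suc.prems(1,2) that by simp
  then show ?case using 0 Suc.prems(4) by (cases i) auto
qed simp

definition monomial_fun :: "nat \<times> ('a::finite \<Rightarrow> nat) \<Rightarrow> complex \<Rightarrow> ('a \<Rightarrow> complex) \<Rightarrow> complex" where
  "monomial_fun m z g = z ^ fst m * (\<Prod>k\<in>UNIV. g k ^ snd m k)"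

definition exponents :: "nat \<Rightarrow> (nat \<times> ('a::finite \<Rightarrow> nat)) set" where
  "exponents N = {..N} \<times> {\<alpha>. \<forall>k. \<alpha> k \<le> N}"

text \<open>
  Polynomials in \<open>z\<close> and in the coordinates of \<open>x\<close> with real coefficients, represented by their values.
  The bound \<open>N\<close> applies to the degree in each variable separately, which makes the set of
  monomials a product and its cardinality a power.
\<close>

definition poly_fun :: "nat \<Rightarrow> (complex \<Rightarrow> ('a::finite \<Rightarrow> complex) \<Rightarrow> complex) \<Rightarrow> bool" where
  "poly_fun N f \<longleftrightarrow> (\<exists>c :: _ \<Rightarrow> real. \<forall>z g. f z g = (\<Sum>m\<in>exponents N. of_real (c m) * monomial_fun m z g))"

lemma bounded_functions_eq_PiE: "{\<alpha> :: 'a::finite \<Rightarrow> nat. \<forall>k. \<alpha> k \<le> N} = PiE UNIV (\<lambda>_. {..N})"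
  by (auto simp: PiE_def extensional_def)

lemma finite_bounded_functions [simp]: "finite {\<alpha> :: 'a::finite \<Rightarrow> nat. \<forall>k. \<alpha> k \<le> N}"
  unfolding bounded_functions_eq_PiE by (intro finite_PiE) auto

lemma card_bounded_functions: "card {\<alpha> :: 'a::finite \<Rightarrow> nat. \<forall>k. \<alpha> k \<le> N} = Suc N ^ CARD('a)"
  unfolding bounded_functions_eq_PiE by (subst card_PiE) auto

lemma finite_exponents [simp]: "finite (exponents N)"
  by (simp add: exponents_def)

lemma card_exponents: "card (exponents N :: (nat \<times> ('a::finite \<Rightarrow> nat)) set) = Suc N ^ Suc CARD('a)"
  by (simp add: exponents_def card_cartesian_product card_bounded_functions)

text \<open>
  Allows monomials to be repeated: terms with the same exponents are collected.
\<close>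

lemma poly_fun_sum_monomials:
  fixes \<pi> :: "'b \<Rightarrow> nat \<times> ('a::finite \<Rightarrow> nat)" and w :: "'b \<Rightarrow> real"
  assumes "finite S" "\<pi> ` S \<subseteq> exponents N"
    and "\<And>z g. f z g = (\<Sum>p\<in>S. of_real (w p) * monomial_fun (\<pi> p) z g)"
  shows "poly_fun N f"
  unfolding poly_fun_def
proof (intro exI allI)
  fix z g
  have "f z g = (\<Sum>m\<in>exponents N. \<Sum>p\<in>{p\<in>S. \<pi> p = m}. of_real (w p) * monomial_fun (\<pi> p) z g)"
    unfolding assms(3) by (rule sum.group[OF assms(1) finite_exponents assms(2), symmetric])
  also have "\<dots> = (\<Sum>m\<in>exponents N. of_real (\<Sum>p\<in>{p\<in>S. \<pi> p = m}. w p) * monomial_fun m z g)"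
    by (auto simp: sum_distrib_right intro!: sum.cong)
  finally show "f z g = (\<Sum>m\<in>exponents N. of_real ((\<lambda>m. \<Sum>p\<in>{p\<in>S. \<pi> p = m}. w p) m) * monomial_fun m z g)" .
qed

lemma poly_fun_mult:
  fixes f g :: "complex \<Rightarrow> ('a::finite \<Rightarrow> complex) \<Rightarrow> complex"
  assumes "poly_fun N f" "poly_fun N' g"
  shows "poly_fun (N + N') (\<lambda>z x. f z x * g z x)"
proof -
  obtain c c' :: "_ \<Rightarrow> real" where
    c: "\<And>z x. f z x = (\<Sum>m\<in>exponents N. of_real (c m) * monomial_fun m z x)" and
    c': "\<And>z x. g z x = (\<Sum>m\<in>exponents N'. of_real (c' m) * monomial_fun m z x)"
    using assms unfolding poly_fun_def by blast
  define \<pi> :: "(nat \<times> ('a \<Rightarrow> nat)) \<times> (nat \<times> ('a \<Rightarrow> nat)) \<Rightarrow> _"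
    where "\<pi> p = (fst (fst p) + fst (snd p), \<lambda>k. snd (fst p) k + snd (snd p) k)" for p
  show ?thesis
  proof (rule poly_fun_sum_monomials[where S = "exponents N \<times> exponents N'" and \<pi> = \<pi>
        and w = "\<lambda>p. c (fst p) * c' (snd p)"])
    show "\<pi> ` (exponents N \<times> exponents N') \<subseteq> exponents (N + N')"
      by (auto simp: \<pi>_def exponents_def add_mono)
    fix z :: complex and x :: "'a \<Rightarrow> complex"
    have "monomial_fun (\<pi> p) z x = monomial_fun (fst p) z x * monomial_fun (snd p) z x" for p
      by (simp add: monomial_fun_def \<pi>_def power_add prod.distrib)
    then show "f z x * g z x = (\<Sum>p\<in>exponents N \<times> exponents N'. of_real (c (fst p) * c' (snd p)) * monomial_fun (\<pi> p) z x)"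
      unfolding c c' sum_product sum.cartesian_product
      by (intro sum.cong) (auto simp: mult_ac)
  qed simp
qed

lemma poly_fun_const: "poly_fun N (\<lambda>z x. of_real r)"
  by (rule poly_fun_sum_monomials[where S = "{()}" and \<pi> = "\<lambda>_. (0, \<lambda>_. 0)" and w = "\<lambda>_. r"])
     (auto simp: exponents_def monomial_fun_def)

lemma poly_fun_z: "N \<ge> 1 \<Longrightarrow> poly_fun N (\<lambda>z x. z)"
  by (rule poly_fun_sum_monomials[where S = "{()}" and \<pi> = "\<lambda>_. (1, \<lambda>_. 0)" and w = "\<lambda>_. 1"])
     (auto simp: exponents_def monomial_fun_def)

lemma poly_fun_var:
  fixes k :: "'a::finite"
  assumes "N \<ge> 1"
  shows "poly_fun N (\<lambda>z x. x k)"
proof (rule poly_fun_sum_monomials[where S = "{()}" and \<pi> = "\<lambda>_. (0, \<lambda>l. if l = k then 1 else 0)" and w = "\<lambda>_. 1"])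
  fix z :: complex and x :: "'a \<Rightarrow> complex"
  have "(\<Prod>l\<in>UNIV. x l ^ (if l = k then 1 else 0)) = (\<Prod>l\<in>UNIV. if l = k then x l else 1)"
    by (intro prod.cong) auto
  then show "x k = (\<Sum>p\<in>{()}. of_real 1 * monomial_fun (0, \<lambda>l. if l = k then 1 else 0) z x)"
    by (simp add: monomial_fun_def)
qed (use assms in \<open>auto simp: exponents_def\<close>)

lemma poly_fun_add:
  assumes "poly_fun N f" "poly_fun N g"
  shows "poly_fun N (\<lambda>z x. f z x + g z x)"
proof -
  obtain c c' :: "_ \<Rightarrow> real" where
    "\<And>z x. f z x = (\<Sum>m\<in>exponents N. of_real (c m) * monomial_fun m z x)"
    "\<And>z x. g z x = (\<Sum>m\<in>exponents N. of_real (c' m) * monomial_fun m z x)"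
    using assms unfolding poly_fun_def by blast
  then show ?thesis unfolding poly_fun_def
    by (intro exI[of _ "\<lambda>m. c m + c' m"]) (simp add: algebra_simps sum.distrib)
qed

lemma poly_fun_sum:
  assumes "finite S" "\<And>i. i \<in> S \<Longrightarrow> poly_fun N (f i)"
  shows "poly_fun N (\<lambda>z x. \<Sum>i\<in>S. f i z x)"
  using assms
proof (induction S rule: finite_induct)
  case empty then show ?case using poly_fun_const[of N 0] by simp
next
  case (insert i S) then show ?case by (simp add: poly_fun_add)
qed

lemma poly_fun_prod:
  assumes "finite S" "\<And>i. i \<in> S \<Longrightarrow> poly_fun N (f i)"
  shows "poly_fun (card S * N) (\<lambda>z x. \<Prod>i\<in>S. f i z x)"
  using assms
proof (induction S rule: finite_induct)
  case empty then show ?case using poly_fun_const[of 0 1] by simp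
next
  case (insert i S) then show ?case using poly_fun_mult[of N "f i" "card S * N"] by simp
qed

lemma poly_fun_mono:
  assumes "poly_fun N f" "N \<le> N'"
  shows "poly_fun N' f"
  using poly_fun_mult[OF assms(1) poly_fun_const[of "N' - N" 1]] assms(2) by simp

lemma poly_fun_power:
  assumes "poly_fun N f" "n \<le> s"
  shows "poly_fun (s * N) (\<lambda>z x. f z x ^ n)"
proof -
  have "poly_fun (n * N) (\<lambda>z x. f z x ^ n)"
    using poly_fun_prod[of "{..<n}" N "\<lambda>_. f"] assms by simp
  then show ?thesis by (rule poly_fun_mono) (use assms in simp)
qed

text \<open>
  There are \<open>n + 1\<close> variables but \<open>n + 2\<close> polynomials \<open>z\<close>, \<open>x j\<close>, \<open>F k\<close>. The number of products with
  exponents up to \<open>s\<close> grows like \<open>s\<close> to the power \<open>n + 2\<close>, the number of monomials occurring in them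
  only like \<open>s\<close> to the power \<open>n + 1\<close>.
\<close>

lemma algebraic_dependence:
  fixes F :: "'a::finite \<Rightarrow> complex \<Rightarrow> ('a \<Rightarrow> complex) \<Rightarrow> complex" and j :: 'a
  assumes F: "\<And>k. poly_fun 2 (F k)"
  obtains s :: nat and q :: "nat \<times> nat \<times> ('a \<Rightarrow> nat) \<Rightarrow> real" where
    "\<exists>i\<in>{..s} \<times> {..s} \<times> {\<gamma>. \<forall>k. \<gamma> k \<le> s}. q i \<noteq> 0"
    "\<And>z x. (\<Sum>(a, b, \<gamma>)\<in>{..s} \<times> {..s} \<times> {\<gamma>. \<forall>k. \<gamma> k \<le> s}.
        of_real (q (a, b, \<gamma>)) * (z ^ a * x j ^ b * (\<Prod>k\<in>UNIV. F k z x ^ \<gamma> k))) = 0"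
proof -
  define n where "n = CARD('a)"
  \<comment> \<open>each product has degree at most \<open>s + s + 2 * n * s = d * s\<close> in every variable, and \<open>s\<close> is large
    enough for \<open>(d * s + 1) ^ (n + 1) < (s + 1) ^ (n + 2)\<close>\<close>
  define d where "d = 2 * n + 2"
  define s where "s = d ^ Suc n"
  define I where "I = {..s} \<times> {..s} \<times> {\<gamma> :: 'a \<Rightarrow> nat. \<forall>k. \<gamma> k \<le> s}"
  define G where "G = (\<lambda>(a, b, \<gamma> :: 'a \<Rightarrow> nat) z (x :: 'a \<Rightarrow> complex).
     z ^ a * x j ^ b * (\<Prod>k\<in>UNIV. F k z x ^ \<gamma> k))"
  have "poly_fun (d * s) (G i)" if i: "i \<in> I" for i
  proof -
    obtain a b \<gamma> where [simp]: "i = (a, b, \<gamma>)" by (cases i)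
    have le: "a \<le> s" "b \<le> s" "\<And>k. \<gamma> k \<le> s" using i by (auto simp: I_def)
    have 1: "poly_fun (s * 1) (\<lambda>z (x :: 'a \<Rightarrow> complex). z ^ a)"
      by (rule poly_fun_power[OF poly_fun_z le(1)]) simp
    have 2: "poly_fun (s * 1) (\<lambda>z (x :: 'a \<Rightarrow> complex). x j ^ b)"
      by (rule poly_fun_power[OF poly_fun_var le(2)]) simp
    have 3: "poly_fun (card (UNIV :: 'a set) * (s * 2)) (\<lambda>z x. \<Prod>k\<in>UNIV. F k z x ^ \<gamma> k)"
      by (rule poly_fun_prod[OF finite]) (rule poly_fun_power[OF F le(3)])
    have "s * 1 + s * 1 + card (UNIV :: 'a set) * (s * 2) = d * s"
      by (simp add: d_def n_def algebra_simps)
    with poly_fun_mult[OF poly_fun_mult[OF 1 2] 3] show ?thesis by (simp add: G_def)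
  qed
  then have "\<forall>i. \<exists>c :: _ \<Rightarrow> real. i \<in> I \<longrightarrow>
      (\<forall>z x. G i z x = (\<Sum>m\<in>exponents (d * s). of_real (c m) * monomial_fun m z x))"
    unfolding poly_fun_def by blast
  from choice[OF this] obtain C :: "_ \<Rightarrow> _ \<Rightarrow> real" where
    C: "\<And>i z x. i \<in> I \<Longrightarrow> G i z x = (\<Sum>m\<in>exponents (d * s). of_real (C i m) * monomial_fun m z x)"
    by blast
  have finI: "finite I" by (simp add: I_def)
  have cardI: "card I = Suc s ^ Suc (Suc n)"
    by (simp add: I_def card_cartesian_product card_bounded_functions n_def)
  have "Suc (d * s) ^ Suc n \<le> (d * Suc s) ^ Suc n"
    by (intro power_mono) (auto simp: d_def)
  also have "\<dots> = s * Suc s ^ Suc n" by (simp only: power_mult_distrib s_def)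
  also have "\<dots> < Suc s ^ Suc (Suc n)" by simp
  finally have "card (exponents (d * s) :: (nat \<times> ('a \<Rightarrow> nat)) set) < card I"
    unfolding card_exponents cardI n_def .
  from homogeneous_system_nontrivial_solution[OF finite_exponents finI this, of C]
  obtain q where q: "\<exists>i\<in>I. q i \<noteq> 0" "\<And>m. m \<in> exponents (d * s) \<Longrightarrow> (\<Sum>i\<in>I. q i * C i m) = 0"
    by blast
  have "(\<Sum>i\<in>I. of_real (q i) * G i z x) = 0" for z x
  proof -
    have "(\<Sum>i\<in>I. of_real (q i) * G i z x) =
        (\<Sum>i\<in>I. \<Sum>m\<in>exponents (d * s). of_real (q i * C i m) * monomial_fun m z x)"
      by (simp add: C sum_distrib_left mult_ac)
    also have "\<dots> = (\<Sum>m\<in>exponents (d * s). of_real (\<Sum>i\<in>I. q i * C i m) * monomial_fun m z x)"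
      by (subst sum.swap) (simp add: sum_distrib_right)
    also have "\<dots> = 0" by (simp add: q)
    finally show ?thesis .
  qed
  then show ?thesis using q(1) that[of s q] by (simp add: I_def G_def case_prod_beta)
qed

text \<open>
  Weights that turn the exponents \<open>\<gamma>\<close> into the digits of a number in base \<open>s + 1\<close>.
\<close>

lemma injective_weight:
  obtains e :: "'a::finite \<Rightarrow> nat" where "\<And>k. e k \<ge> 1"
    "inj_on (\<lambda>\<gamma>. \<Sum>k\<in>UNIV. \<gamma> k * e k) {\<gamma>. \<forall>k. \<gamma> k \<le> s}"
proof -
  obtain h where h: "bij_betw h (UNIV :: 'a set) {..<CARD('a)}"
    using ex_bij_betw_finite_nat[of "UNIV :: 'a set"] by (auto simp: atLeast0LessThan)
  define e where "e k = Suc s ^ h k" for k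
  define h' where "h' = inv_into UNIV h"
  have h': "bij_betw h' {..<CARD('a)} UNIV" unfolding h'_def using h by (rule bij_betw_inv_into)
  have hh: "h (h' i) = i" if "i < CARD('a)" for i
    unfolding h'_def using bij_betw_inv_into_right[OF h] that by simp
  have sum: "(\<Sum>k\<in>UNIV. \<gamma> k * e k) = (\<Sum>i<CARD('a). \<gamma> (h' i) * Suc s ^ i)" for \<gamma> :: "'a \<Rightarrow> nat"
    using sum.reindex_bij_betw[OF h', of "\<lambda>k. \<gamma> k * e k"] hh by (simp add: e_def)
  show ?thesis
  proof
    show "e k \<ge> 1" for k by (simp add: e_def)
    show "inj_on (\<lambda>\<gamma>. \<Sum>k\<in>UNIV. \<gamma> k * e k) {\<gamma>. \<forall>k. \<gamma> k \<le> s}"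
    proof (rule inj_onI, rule ext)
      fix \<gamma> \<gamma>' :: "'a \<Rightarrow> nat" and k
      assume a: "\<gamma> \<in> {\<gamma>. \<forall>k. \<gamma> k \<le> s}" "\<gamma>' \<in> {\<gamma>. \<forall>k. \<gamma> k \<le> s}"
        "(\<Sum>k\<in>UNIV. \<gamma> k * e k) = (\<Sum>k\<in>UNIV. \<gamma>' k * e k)"
      have "k = h' (h k)" unfolding h'_def using h by (simp add: bij_betw_def)
      moreover have "\<gamma> (h' (h k)) = \<gamma>' (h' (h k))"
        using digit_expansion_unique[of "CARD('a)" "\<lambda>i. \<gamma> (h' i)" "Suc s" "\<lambda>i. \<gamma>' (h' i)" "h k"]
          a bij_betwE[OF h] by (auto simp: sum le_imp_less_Suc)
      ultimately show "\<gamma> k = \<gamma>' k" by simp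
    qed
  qed
qed

section \<open>Boundary values of algebraic functions on the upper half-plane\<close>

abbreviation upper_half :: "complex set" where "upper_half \<equiv> {z. Im z > 0}"

abbreviation boundary_filter :: "real \<Rightarrow> complex filter" where
  "boundary_filter E \<equiv> at (complex_of_real E) within upper_half"

lemma boundary_filter_nontrivial: "boundary_filter E \<noteq> bot"
proof -
  have "of_real E islimpt upper_half"
    unfolding islimpt_approachable
  proof (intro allI impI)
    fix e :: real assume "e > 0"
    moreover have "dist (Complex E (e / 2)) (of_real E) = cmod (Complex 0 (e / 2))"
      by (simp add: dist_norm complex_diff complex_of_real_def)
    ultimately show "\<exists>x'\<in>upper_half. x' \<noteq> of_real E \<and> dist x' (of_real E) < e"
      by (intro bexI[of _ "Complex E (e / 2)"]) (auto simp: complex_norm complex_eq_iff)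
  qed
  then show ?thesis by (simp add: trivial_limit_within)
qed

lemma boundary_Lim:
  assumes "\<exists>l. (f \<longlongrightarrow> l) (boundary_filter E)"
  shows "(f \<longlongrightarrow> Lim (boundary_filter E) f) (boundary_filter E)"
proof -
  obtain l where l: "(f \<longlongrightarrow> l) (boundary_filter E)" using assms by blast
  show ?thesis unfolding tendsto_Lim[OF boundary_filter_nontrivial l] by (rule l)
qed

lemma eventually_upper_half: "\<forall>\<^sub>F z in boundary_filter E. Im z > 0"
  by (simp add: eventually_at_filter)

lemma tendsto_Im_boundary: "((\<lambda>z. Im z) \<longlongrightarrow> 0) (boundary_filter E)"
proof -
  have "((\<lambda>z. Im z) \<longlongrightarrow> Im (complex_of_real E)) (boundary_filter E)" by (intro tendsto_intros)
  then show ?thesis by simp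
qed

lemma vertical_approach:
  "filterlim (\<lambda>m. Complex E (inverse (real (Suc m)))) (boundary_filter E) sequentially"
  unfolding filterlim_at
proof
  have "(\<lambda>m. Complex E (inverse (real (Suc m)))) \<longlonglongrightarrow> Complex E 0"
    by (intro tendsto_Complex tendsto_const LIMSEQ_inverse_real_of_nat)
  then show "(\<lambda>m. Complex E (inverse (real (Suc m)))) \<longlonglongrightarrow> complex_of_real E"
    by (simp add: complex_of_real_def)
qed (simp add: complex_eq_iff)

text \<open>
  Elements of \<open>\<real>[z]\<close> and \<open>\<real>[z][X]\<close> evaluated at complex arguments.
\<close>

definition ev1 :: "real poly \<Rightarrow> complex \<Rightarrow> complex" where
  "ev1 p z = poly (map_poly of_real p) z"

definition ev :: "real poly poly \<Rightarrow> complex \<Rightarrow> complex \<Rightarrow> complex" where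
  "ev P z X = poly (map_poly (\<lambda>p. ev1 p z) P) X"

lemma ev1_0 [simp]: "ev1 0 z = 0" and ev1_pCons: "ev1 (pCons a p) z = of_real a + z * ev1 p z"
  by (simp_all add: ev1_def map_poly_pCons)

lemma ev1_add: "ev1 (p + q) z = ev1 p z + ev1 q z"
proof (induction p arbitrary: q)
  case (pCons a p)
  show ?case
  proof (cases q)
    case q: (pCons b q')
    show ?thesis unfolding q by (simp add: ev1_pCons pCons.IH algebra_simps)
  qed
qed simp

lemma ev1_smult: "ev1 (smult a p) z = of_real a * ev1 p z"
  by (induction p) (simp_all add: ev1_pCons algebra_simps)

lemma ev1_mult: "ev1 (p * q) z = ev1 p z * ev1 q z"
  by (induction p) (simp_all add: ev1_pCons ev1_add ev1_smult algebra_simps)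

lemma ev1_of_real: "ev1 p (of_real x) = of_real (poly p x)"
  by (induction p) (simp_all add: ev1_pCons)

lemma ev1_cnj: "ev1 p (cnj z) = cnj (ev1 p z)"
  by (induction p) (simp_all add: ev1_pCons)

lemma ev_0 [simp]: "ev 0 z X = 0" and ev_pCons: "ev (pCons p P) z X = ev1 p z + X * ev P z X"
  by (simp_all add: ev_def map_poly_pCons)

lemma ev_add: "ev (P + Q) z X = ev P z X + ev Q z X"
proof (induction P arbitrary: Q)
  case (pCons a P)
  show ?case
  proof (cases Q)
    case Q: (pCons b Q')
    show ?thesis unfolding Q by (simp add: ev_pCons ev1_add pCons.IH algebra_simps)
  qed
qed simp

lemma ev_smult: "ev (smult a P) z X = ev1 a z * ev P z X"
  by (induction P) (simp_all add: ev_pCons ev1_mult algebra_simps)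

lemma ev_mult: "ev (P * Q) z X = ev P z X * ev Q z X"
  by (induction P) (simp_all add: ev_pCons ev_add ev_smult algebra_simps)

lemma ev_cnj: "ev P (cnj z) (cnj X) = cnj (ev P z X)"
  by (induction P) (simp_all add: ev_pCons ev1_cnj)

lemma map_poly_ev1_pderiv: "map_poly (\<lambda>p. ev1 p z) (pderiv P) = pderiv (map_poly (\<lambda>p. ev1 p z) P)"
proof (induction P)
  case (pCons a P)
  have add: "map_poly (\<lambda>p. ev1 p z) (Q + R) = map_poly (\<lambda>p. ev1 p z) Q + map_poly (\<lambda>p. ev1 p z) R" for Q R
    by (rule poly_eqI) (simp add: coeff_map_poly ev1_add)
  show ?case by (simp add: pderiv_pCons map_poly_pCons add pCons.IH)
qed simp

lemma continuous_on_ev1 [continuous_intros]: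
  "continuous_on S f \<Longrightarrow> continuous_on S (\<lambda>x. ev1 p (f x))"
  unfolding ev1_def by (intro continuous_intros)

lemma continuous_on_ev [continuous_intros]:
  assumes "continuous_on S f" "continuous_on S g"
  shows "continuous_on S (\<lambda>x. ev P (f x) (g x))"
  by (induction P) (use assms in \<open>auto simp: ev_pCons intro!: continuous_intros\<close>)

lemma holomorphic_on_ev:
  assumes "f holomorphic_on S"
  shows "(\<lambda>z. ev P z (f z)) holomorphic_on S"
proof (induction P)
  case (pCons p P)
  have "(\<lambda>z. ev1 p z) holomorphic_on S" unfolding ev1_def by (intro holomorphic_intros)
  then show ?case unfolding ev_pCons by (intro holomorphic_intros assms pCons)
qed simp

text \<open>
  The quotient is nonzero near a simple root, so that two roots close to a simple root coincide.
\<close>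

lemma ev_difference_quotient:
  obtains K :: "complex \<times> complex \<times> complex \<Rightarrow> complex" where
    "continuous_on UNIV K"
    "\<And>z X Y. ev P z X - ev P z Y = (X - Y) * K (z, X, Y)"
    "\<And>z X. K (z, X, X) = ev (pderiv P) z X"
proof -
  have "\<exists>K. continuous_on UNIV K \<and>
    (\<forall>z X Y. ev P z X - ev P z Y = (X - Y) * K (z, X, Y)) \<and> (\<forall>z X. K (z, X, X) = ev (pderiv P) z X)"
  proof (induction P)
    case 0
    then show ?case by (intro exI[of _ "\<lambda>_. 0"]) auto
  next
    case (pCons p P)
    then obtain K where K: "continuous_on UNIV K"
      "\<And>z X Y. ev P z X - ev P z Y = (X - Y) * K (z, X, Y)" "\<And>z X. K (z, X, X) = ev (pderiv P) z X"
      by metis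
    have "ev (pCons p P) z X - ev (pCons p P) z Y = (X - Y) * (ev P z X + Y * K (z, X, Y))" for z X Y
    proof -
      have "ev (pCons p P) z X - ev (pCons p P) z Y = (X - Y) * ev P z X + Y * (ev P z X - ev P z Y)"
        by (simp add: ev_pCons algebra_simps)
      then show ?thesis unfolding K(2) by (simp add: algebra_simps)
    qed
    moreover have "ev P z X + X * K (z, X, X) = ev (pderiv (pCons p P)) z X" for z X
      by (simp add: K(3) pderiv_pCons ev_add ev_pCons)
    moreover have "continuous_on UNIV (\<lambda>(z, X, Y). ev P z X + Y * K (z, X, Y))"
      unfolding case_prod_beta
      by (intro continuous_intros continuous_on_compose2[OF K(1)]) auto
    ultimately show ?case
      by (intro exI[of _ "\<lambda>(z, X, Y). ev P z X + Y * K (z, X, Y)"]) auto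
  qed
  then show ?thesis using that by blast
qed

lemma ev1_eq_0_on_halfplane:
  assumes "\<And>z. Im z > 0 \<Longrightarrow> ev1 p z = 0"
  shows "p = 0"
proof (rule ccontr)
  assume "p \<noteq> 0"
  then have "map_poly complex_of_real p \<noteq> 0" by (auto simp: map_poly_eq_0_iff)
  then have "finite {z. ev1 p z = 0}" unfolding ev1_def by (rule poly_roots_finite)
  moreover have "(\<lambda>n. \<i> * of_nat (Suc n)) ` UNIV \<subseteq> {z. ev1 p z = 0}"
    using assms by auto
  moreover have "infinite ((\<lambda>n. \<i> * of_nat (Suc n)) ` (UNIV :: nat set))"
    by (intro range_inj_infinite inj_onI) (simp add: complex_eq_iff)
  ultimately show False using finite_subset by blast
qed

text \<open>
  The relations satisfied by \<open>f\<close> form a prime ideal, as \<open>f\<close> is holomorphic on a connected set. Let \<open>P\<close>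
  be a nonzero relation of least degree in \<open>X\<close>. Among the combinations of \<open>P\<close> and \<open>pderiv P\<close> that are not
  relations, one of least degree must have degree \<open>0\<close>: otherwise pseudo-division of \<open>P\<close> by it would
  leave no remainder and factor a multiple of \<open>P\<close>, and one factor would be a relation of smaller degree. The resulting
  \<open>\<rho>\<close> takes the role of the discriminant.
\<close>

lemma separable_relation:
  fixes f :: "complex \<Rightarrow> complex"
  assumes hol: "f holomorphic_on {z. Im z > 0}"
    and P0: "P0 \<noteq> 0" "\<And>z. Im z > 0 \<Longrightarrow> ev P0 z (f z) = 0"
  obtains P U V \<rho> where "\<And>z. Im z > 0 \<Longrightarrow> ev P z (f z) = 0" "\<rho> \<noteq> 0"
    "U * P + V * pderiv P = [:\<rho>:]"
proof -
  define I where "I = {P. \<forall>z. Im z > 0 \<longrightarrow> ev P z (f z) = 0}"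
  have prime: "Q \<in> I \<or> S \<in> I" if QS: "Q * S \<in> I" for Q S
  proof (rule ccontr)
    assume neg: "\<not> (Q \<in> I \<or> S \<in> I)"
    then obtain z0 where z0: "Im z0 > 0" "ev Q z0 (f z0) \<noteq> 0" by (auto simp: I_def)
    obtain z1 where z1: "Im z1 > 0" "ev S z1 (f z1) \<noteq> 0" using neg by (auto simp: I_def)
    define H where "H = {z. Im z > 0}"
    have H: "open H" "connected H" unfolding H_def
      by (auto intro: open_halfspace_Im_gt convex_connected convex_halfspace_Im_gt)
    have contQ: "continuous_on H (\<lambda>z. ev Q z (f z))"
      unfolding H_def by (intro holomorphic_on_imp_continuous_on holomorphic_on_ev hol)
    define N where "N = H \<inter> (\<lambda>z. ev Q z (f z)) -` (- {0})"
    have N: "open N" unfolding N_def by (intro continuous_open_preimage contQ H) auto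
    have z0N: "z0 \<in> N" using z0 by (simp add: N_def H_def)
    have "ev S z1 (f z1) = 0"
    proof (rule analytic_continuation[OF _ H, of "\<lambda>z. ev S z (f z)" N z0])
      show "(\<lambda>z. ev S z (f z)) holomorphic_on H" unfolding H_def by (intro holomorphic_on_ev hol)
      show "z0 islimpt N" using N z0N by (simp add: interior_open interior_limit_point)
      show "ev S z (f z) = 0" if "z \<in> N" for z
        using QS that unfolding I_def N_def H_def by (auto simp: ev_mult)
    qed (use z0 z1 in \<open>auto simp: N_def H_def\<close>)
    then show False using z1 by simp
  qed
  have addI: "Q + R \<in> I" if "Q \<in> I" "R \<in> I" for Q R using that by (simp add: I_def ev_add)
  have multI: "Q * R \<in> I" if "R \<in> I" for Q R using that by (simp add: I_def ev_mult)
  have "\<exists>P. P \<in> I \<and> P \<noteq> 0" using P0 by (auto simp: I_def)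
  then obtain P where P: "P \<in> I" "P \<noteq> 0" and minP: "\<And>Q. Q \<in> I \<Longrightarrow> Q \<noteq> 0 \<Longrightarrow> degree P \<le> degree Q"
    using ex_has_least_nat[of "\<lambda>P. P \<in> I \<and> P \<noteq> 0" _ degree] by blast
  have degP: "degree P > 0"
  proof (rule ccontr)
    assume "\<not> degree P > 0"
    then obtain p where p: "P = [:p:]" using degree_eq_zeroE by blast
    then have "p = 0" using P(1) by (intro ev1_eq_0_on_halfplane) (auto simp: I_def ev_pCons)
    then show False using P(2) p by simp
  qed
  have dP: "pderiv P \<noteq> 0" using degP by (auto simp: pderiv_eq_0_iff)
  have degdP: "degree (pderiv P) < degree P" using degP by (simp add: degree_pderiv)
  have dPI: "pderiv P \<notin> I" using minP[of "pderiv P"] dP degdP by auto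
  define \<W> where "\<W> = {W. W \<notin> I \<and> (\<exists>U V. W = U * P + V * pderiv P)}"
  have dPW: "pderiv P \<in> \<W>" 
  proof -
    have "pderiv P = 0 * P + 1 * pderiv P" by simp
    then show ?thesis unfolding \<W>_def using dPI by blast
  qed
  \<comment> \<open>the set is nonempty: \<open>pderiv P\<close> has smaller degree than \<open>P\<close>, so it is not a relation\<close>
  obtain W where W: "W \<in> \<W>" and minW: "\<And>Q. Q \<in> \<W> \<Longrightarrow> degree W \<le> degree Q"
    using ex_has_least_nat[of "\<lambda>W. W \<in> \<W>" _ degree] dPW by blast
  obtain U V where UV: "W = U * P + V * pderiv P" using W by (auto simp: \<W>_def)
  have WI: "W \<notin> I" using W by (simp add: \<W>_def)
  then have W0: "W \<noteq> 0" by (auto simp: I_def)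
  have "degree W = 0"
  proof (rule ccontr)
    assume degW: "degree W \<noteq> 0"
    have degWP: "degree W < degree P" using minW[OF dPW] degdP by simp
    define r where "r = pseudo_mod P W"
    obtain a q where aq: "a \<noteq> 0" "smult a P = W * q + r"
      using pseudo_mod(1)[OF W0, of P] by (auto simp: r_def)
    have deg_r: "r = 0 \<or> degree r < degree W" using pseudo_mod(2)[OF W0, of P] by (simp add: r_def)
    have "r = ([:a:] - U * q) * P + (- (V * q)) * pderiv P"
    proof -
      have "r = smult a P - W * q" using aq by simp
      then show ?thesis unfolding UV by (simp add: algebra_simps)
    qed
    then have "r \<in> I \<or> r \<in> \<W>" unfolding \<W>_def by blast
    moreover have "0 \<in> I" by (simp add: I_def)
    ultimately have "r \<in> I" using minW[of r] deg_r by auto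
    have "r = 0"
    proof (rule ccontr)
      assume "r \<noteq> 0"
      then show False using minP[OF \<open>r \<in> I\<close>] deg_r degWP by simp
    qed
    then have eq: "smult a P = W * q" using aq by simp
    have "smult a P \<in> I" using multI[OF P(1), of "[:a:]"] by simp
    then have "q \<in> I" using eq prime[of W q] WI by simp
    moreover have "q \<noteq> 0" using eq aq(1) P(2) by auto
    moreover have "degree P = degree W + degree q"
      using arg_cong[OF eq, of degree] aq(1) W0 \<open>q \<noteq> 0\<close> by (simp add: degree_mult_eq)
    ultimately show False using minP[of q] degW by simp
  qed
  then obtain \<rho> where \<rho>: "W = [:\<rho>:]" using degree_eq_zeroE by blast
  show ?thesis
    by (rule that[of P _ U V]) (use P(1) \<rho> W0 UV in \<open>auto simp: I_def\<close>)
qed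

lemma finite_separated:
  fixes S :: "'a::metric_space set"
  assumes "finite S"
  obtains d where "d > 0" "\<And>x y. x \<in> S \<Longrightarrow> y \<in> S \<Longrightarrow> x \<noteq> y \<Longrightarrow> dist x y \<ge> d"
proof -
  define D where "D = insert 1 ((\<lambda>(x, y). dist x y) ` {p \<in> S \<times> S. fst p \<noteq> snd p})"
  have D: "finite D" using assms by (simp add: D_def)
  show ?thesis
  proof
    have "Min D \<in> D" using D by (intro Min_in) (auto simp: D_def)
    then show "Min D > 0" by (auto simp: D_def)
    fix x y assume "x \<in> S" "y \<in> S" "x \<noteq> y"
    then have "dist x y \<in> D" by (force simp: D_def)
    then show "Min D \<le> dist x y" using D by simp
  qed
qed

text \<open>
  Near \<open>E\<close> the values of \<open>f\<close> must lie close to the finitely many roots of \<open>P\<close> at \<open>E\<close>, by compactness.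
  The part of the half-plane near \<open>E\<close> is connected, so the values stay close to only one of them.
\<close>

lemma boundary_value:
  fixes f :: "complex \<Rightarrow> complex" and E :: real
  assumes cont: "continuous_on {z. Im z > 0} f" and bdd: "\<And>z. Im z > 0 \<Longrightarrow> cmod (f z) \<le> C"
    and root: "\<And>z. Im z > 0 \<Longrightarrow> ev P z (f z) = 0"
    and nz: "map_poly (\<lambda>p. ev1 p (of_real E)) P \<noteq> 0"
  obtains X where "ev P (of_real E) X = 0" "(f \<longlongrightarrow> X) (at (of_real E) within {z. Im z > 0})"
proof -
  define S where "S = {X. ev P (of_real E) X = 0}"
  have finS: "finite S" unfolding S_def ev_def by (rule poly_roots_finite[OF nz])
  have near: "\<exists>\<delta>>0. \<forall>z. Im z > 0 \<longrightarrow> dist z (of_real E) < \<delta> \<longrightarrow> (\<exists>X\<in>S. dist (f z) X < r)" if r: "r > 0" for r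
  proof -
    define Kr where "Kr = cball 0 C - (\<Union>X\<in>S. ball X r)"
    have comp: "compact Kr" unfolding Kr_def by (intro compact_diff) auto
    have "\<exists>m>0. \<forall>X\<in>Kr. m \<le> cmod (ev P (of_real E) X)"
    proof (cases "Kr = {}")
      case False
      have "continuous_on Kr (\<lambda>X. cmod (ev P (of_real E) X))" by (intro continuous_intros)
      from continuous_attains_inf[OF comp False this] obtain X0 where X0: "X0 \<in> Kr"
        "\<And>X. X \<in> Kr \<Longrightarrow> cmod (ev P (of_real E) X0) \<le> cmod (ev P (of_real E) X)" by blast
      have "X0 \<notin> S" using X0(1) r by (auto simp: Kr_def)
      then have "cmod (ev P (of_real E) X0) > 0" by (simp add: S_def)
      then show ?thesis using X0(2) by blast
    qed (auto intro: exI[of _ 1])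
    then obtain m where m: "m > 0" "\<And>X. X \<in> Kr \<Longrightarrow> m \<le> cmod (ev P (of_real E) X)" by blast
    define Q where "Q = cball (complex_of_real E) 1 \<times> cball (0::complex) C"
    have "uniformly_continuous_on Q (\<lambda>x. ev P (fst x) (snd x))"
      unfolding Q_def by (intro compact_uniformly_continuous continuous_intros compact_Times compact_cball)
    then obtain \<delta> where \<delta>: "\<delta> > 0" "\<And>x y. x \<in> Q \<Longrightarrow> y \<in> Q \<Longrightarrow> dist y x < \<delta> \<Longrightarrow>
        dist (ev P (fst y) (snd y)) (ev P (fst x) (snd x)) < m"
      unfolding uniformly_continuous_on_def using m(1) by metis
    have "\<exists>X\<in>S. dist (f z) X < r" if z: "Im z > 0" "dist z (of_real E) < min \<delta> 1" for z
    proof (rule ccontr)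
      assume "\<not> (\<exists>X\<in>S. dist (f z) X < r)"
      then have K: "f z \<in> Kr" using bdd[OF z(1)] by (auto simp: Kr_def dist_commute)
      have "dist (ev P z (f z)) (ev P (of_real E) (f z)) < m"
        using \<delta>(2)[of "(of_real E, f z)" "(z, f z)"] z bdd[OF z(1)]
        by (auto simp: Q_def dist_Pair_Pair dist_commute)
      then show False using m(2)[OF K] root[OF z(1)] by (simp add: dist_norm)
    qed
    then show ?thesis using \<delta>(1) by (intro exI[of _ "min \<delta> 1"]) auto
  qed
  obtain d where d: "d > 0" "\<And>x y. x \<in> S \<Longrightarrow> y \<in> S \<Longrightarrow> x \<noteq> y \<Longrightarrow> dist x y \<ge> d"
    using finite_separated[OF finS] by metis
  obtain \<delta>0 where \<delta>0: "\<delta>0 > 0" "\<And>z. Im z > 0 \<Longrightarrow> dist z (of_real E) < \<delta>0 \<Longrightarrow> \<exists>X\<in>S. dist (f z) X < d / 2"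
    using near[of "d / 2"] d(1) by auto
  define N where "N = {z. Im z > 0} \<inter> ball (of_real E) \<delta>0"
  have "convex N" unfolding N_def by (intro convex_Int convex_halfspace_Im_gt convex_ball)
  then have connf: "connected (f ` N)"
    by (intro connected_continuous_image convex_connected continuous_on_subset[OF cont]) (auto simp: N_def)
  have z0: "Complex E (\<delta>0 / 2) \<in> N"
  proof -
    have "complex_of_real E - Complex E (\<delta>0 / 2) = Complex 0 (- \<delta>0 / 2)" by (simp add: complex_eq_iff)
    then show ?thesis using \<delta>0(1) by (simp add: N_def dist_norm complex_norm)
  qed
  then obtain X0 where X0: "X0 \<in> S" "dist (f (Complex E (\<delta>0 / 2))) X0 < d / 2"
    using \<delta>0(2)[of "Complex E (\<delta>0 / 2)"] by (auto simp: N_def dist_commute)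
  \<comment> \<open>distinct roots have distance at least \<open>d\<close>, so the balls of radius \<open>d / 2\<close> are disjoint\<close>
  have in_ball: "dist (f z) X0 < d / 2" if z: "z \<in> N" for z
  proof -
    define B where "B = (\<Union>X\<in>S - {X0}. ball X (d / 2))"
    have "ball X0 (d / 2) \<inter> B \<inter> f ` N = {}"
    proof -
      have "ball X0 (d / 2) \<inter> ball X (d / 2) = {}" if "X \<in> S - {X0}" for X
        using d(2)[of X0 X] X0(1) that by (intro disjoint_ballI) auto
      then show ?thesis by (auto simp: B_def)
    qed
    moreover have "f ` N \<subseteq> ball X0 (d / 2) \<union> B"
      using \<delta>0(2) by (fastforce simp: N_def B_def dist_commute)
    moreover have "ball X0 (d / 2) \<inter> f ` N \<noteq> {}"
      using X0(2) z0 by (auto simp: dist_commute)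
    ultimately have "B \<inter> f ` N = {}"
      using connectedD[OF connf, of "ball X0 (d / 2)" B] by (auto simp: B_def)
    then show ?thesis using \<open>f ` N \<subseteq> ball X0 (d / 2) \<union> B\<close> z by (force simp: dist_commute)
  qed
  have "(f \<longlongrightarrow> X0) (at (of_real E) within {z. Im z > 0})"
    unfolding Lim_within
  proof (intro allI impI)
    fix r :: real assume r: "r > 0"
    obtain \<delta> where \<delta>: "\<delta> > 0" "\<And>z. Im z > 0 \<Longrightarrow> dist z (of_real E) < \<delta> \<Longrightarrow> \<exists>X\<in>S. dist (f z) X < min r (d / 2)"
      using near[of "min r (d / 2)"] r d(1) by auto
    have "dist (f z) X0 < r" if z: "Im z > 0" "dist z (of_real E) < min \<delta> \<delta>0" for z
    proof -
      obtain X where X: "X \<in> S" "dist (f z) X < min r (d / 2)" using \<delta>(2) z by auto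
      have "dist (f z) X0 < d / 2" using in_ball z by (auto simp: N_def dist_commute)
      then have "dist X X0 < d" using X(2) dist_triangle2[of X X0 "f z"] by (auto simp: dist_commute)
      then have "X = X0" using d(2)[OF X(1) X0(1)] by force
      then show ?thesis using X by simp
    qed
    then show "\<exists>d>0. \<forall>x\<in>{z. 0 < Im z}. 0 < dist x (of_real E) \<and> dist x (of_real E) < d \<longrightarrow> dist (f x) X0 < r"
      using \<delta>(1) \<delta>0(1) by (intro exI[of _ "min \<delta> \<delta>0"]) auto
  qed
  then show ?thesis using that X0(1) by (simp add: S_def)
qed

text \<open>
  The exceptional set consists of the zeros of \<open>\<rho>\<close> from \<open>separable_relation\<close>. Elsewhere all roots of \<open>P\<close> are
  simple. As \<open>P\<close> is real, the conjugate of a root is a root. If the boundary value is real at a point,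
  then nearby it and its conjugate are roots close to the same simple root, so they are equal.
\<close>

lemma algebraic_boundary_values:
  fixes f :: "complex \<Rightarrow> complex"
  assumes hol: "f holomorphic_on {z. Im z > 0}"
    and bdd: "\<And>z. Im z > 0 \<Longrightarrow> cmod (f z) \<le> C"
    and P0: "P0 \<noteq> 0" "\<And>z. Im z > 0 \<Longrightarrow> ev P0 z (f z) = 0"
  obtains D :: "real set" and g :: "real \<Rightarrow> complex" where "finite D"
    "\<And>E. E \<notin> D \<Longrightarrow> (f \<longlongrightarrow> g E) (at (of_real E) within {z. Im z > 0})"
    "continuous_on (- D) g"
    "open {E. E \<notin> D \<and> g E \<in> \<real>}"
proof -
  obtain P U V \<rho> where P: "\<And>z. Im z > 0 \<Longrightarrow> ev P z (f z) = 0" and \<rho>: "\<rho> \<noteq> 0"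
    and UV: "U * P + V * pderiv P = [:\<rho>:]"
    using separable_relation[OF hol P0] by metis
  define D where "D = {E. poly \<rho> E = 0}"
  have finD: "finite D" unfolding D_def by (rule poly_roots_finite[OF \<rho>])
  have simple: "ev (pderiv P) (of_real E) X \<noteq> 0" if "E \<notin> D" "ev P (of_real E) X = 0" for E X
  proof
    assume "ev (pderiv P) (of_real E) X = 0"
    then have "ev [:\<rho>:] (of_real E) X = 0"
      unfolding UV[symmetric] using that by (simp add: ev_add ev_mult)
    then show False using that by (simp add: ev_pCons ev1_of_real D_def)
  qed
  have nz: "map_poly (\<lambda>p. ev1 p (of_real E)) P \<noteq> 0" if "E \<notin> D" for E
  proof
    assume 0: "map_poly (\<lambda>p. ev1 p (of_real E)) P = 0"
    then have "ev P (of_real E) 0 = 0" "ev (pderiv P) (of_real E) 0 = 0"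
      unfolding ev_def map_poly_ev1_pderiv by simp_all
    then show False using simple that by blast
  qed
  have "\<exists>X. ev P (of_real E) X = 0 \<and> (f \<longlongrightarrow> X) (at (of_real E) within {z. Im z > 0})" if "E \<notin> D" for E
    using boundary_value[OF holomorphic_on_imp_continuous_on[OF hol] bdd P nz[OF that]] by metis
  then obtain g where g: "\<And>E. E \<notin> D \<Longrightarrow> ev P (of_real E) (g E) = 0"
    "\<And>E. E \<notin> D \<Longrightarrow> (f \<longlongrightarrow> g E) (at (of_real E) within {z. Im z > 0})"
    by metis
  have openD: "open (- D)" using finD by (simp add: finite_imp_closed open_Compl)
  have contg: "continuous_on (- D) g"
    unfolding continuous_on_iff
  proof (intro ballI allI impI)
    fix E0 and e :: real assume E0: "E0 \<in> - D" and e: "e > 0"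
    obtain \<delta> where \<delta>: "\<delta> > 0" "\<And>z. Im z > 0 \<Longrightarrow> dist z (of_real E0) < \<delta> \<Longrightarrow> dist (f z) (g E0) < e / 2"
    proof -
      have "\<exists>d>0. \<forall>z\<in>{z. 0 < Im z}. 0 < dist z (of_real E0) \<and> dist z (of_real E0) < d \<longrightarrow> dist (f z) (g E0) < e / 2"
        using g(2)[of E0] E0 half_gt_zero[OF e] unfolding Lim_within by blast
      then obtain d where d: "d > 0" "\<And>z. 0 < Im z \<Longrightarrow> 0 < dist z (of_real E0) \<Longrightarrow> dist z (of_real E0) < d \<Longrightarrow> dist (f z) (g E0) < e / 2"
        by blast
      moreover have "0 < dist z (of_real E0)" if "Im z > 0" for z using that by auto
      ultimately show ?thesis using that by blast
    qed
    have "dist (g E) (g E0) < e" if E: "E \<in> - D" "dist E E0 < \<delta>" for E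
    proof -
      have lim: "((\<lambda>z. dist (f z) (g E0)) \<longlongrightarrow> dist (g E) (g E0)) (at (of_real E) within {z. Im z > 0})"
        using g(2)[of E] E by (intro tendsto_intros) auto
      have "\<forall>\<^sub>F z in at (of_real E) within {z. Im z > 0}. dist (f z) (g E0) \<le> e / 2"
        unfolding eventually_at
      proof (intro exI[of _ "\<delta> - dist E E0"] conjI ballI impI)
        fix z assume z: "z \<in> {z. Im z > 0}" "z \<noteq> complex_of_real E \<and> dist z (of_real E) < \<delta> - dist E E0"
        have "dist z (of_real E0) \<le> dist z (of_real E) + dist (complex_of_real E) (of_real E0)" by (rule dist_triangle)
        then have "dist z (of_real E0) < \<delta>" using z by simp
        then show "dist (f z) (g E0) \<le> e / 2" using \<delta>(2)[of z] z by simp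
      qed (use E in simp)
      then have "dist (g E) (g E0) \<le> e / 2"
        by (rule tendsto_upperbound[OF lim _ boundary_filter_nontrivial])
      then show ?thesis using e by simp
    qed
    then show "\<exists>d>0. \<forall>x'\<in>- D. dist x' E0 < d \<longrightarrow> dist (g x') (g E0) < e" using \<delta>(1) by blast
  qed
  obtain K :: "complex \<times> complex \<times> complex \<Rightarrow> complex" where K: "continuous_on UNIV K"
    "\<And>z X Y. ev P z X - ev P z Y = (X - Y) * K (z, X, Y)"
    "\<And>z X. K (z, X, X) = ev (pderiv P) z X"
    using ev_difference_quotient[of P] by metis
  have "open {E. E \<notin> D \<and> g E \<in> \<real>}"
    unfolding open_dist
  proof (intro ballI)
    fix E0 assume "E0 \<in> {E. E \<notin> D \<and> g E \<in> \<real>}"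
    then have E0: "E0 \<in> - D" "cnj (g E0) = g E0" by (auto simp: Reals_cnj_iff)
    \<comment> \<open>at a real boundary value this is the derivative of \<open>P\<close> at a simple root\<close>
    define k where "k E = K (of_real E, g E, cnj (g E))" for E
    have contk: "continuous_on (- D) k"
      unfolding k_def by (intro continuous_on_compose2[OF K(1)] continuous_intros contg) auto
    have "k E0 \<noteq> 0" using simple[of E0 "g E0"] g(1)[of E0] E0 by (simp add: k_def K(3))
    moreover have "open (- D \<inter> k -` (- {0}))" using openD contk by (intro continuous_open_preimage) auto
    ultimately obtain e where e: "e > 0" "ball E0 e \<subseteq> - D \<inter> k -` (- {0})"
      using E0(1) openE[of "- D \<inter> k -` (- {0})" E0] by blast
    have "g E \<in> \<real>" if "E \<in> ball E0 e" for E
    proof -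
      have E: "E \<notin> D" "k E \<noteq> 0" using that e by auto
      have "ev P (of_real E) (cnj (g E)) = 0"
        using ev_cnj[of P "of_real E" "g E"] g(1)[OF E(1)] by simp
      then have "(g E - cnj (g E)) * k E = 0"
        using K(2)[of "of_real E" "g E" "cnj (g E)"] g(1)[OF E(1)] by (simp add: k_def)
      then show ?thesis using E(2) by (simp add: Reals_cnj_iff)
    qed
    then show "\<exists>e>0. \<forall>y. dist y E0 < e \<longrightarrow> y \<in> {E. E \<notin> D \<and> g E \<in> \<real>}"
      using e by (intro exI[of _ e]) (auto simp: dist_commute subset_iff)
  qed
  then show ?thesis using that[OF finD g(2) contg] by blast
qed

text \<open>
  Turns a relation given by its coefficients into an element of \<open>\<real>[z][X]\<close>.
\<close>

lemma poly_relation_nonzero: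
  assumes "a \<le> s" "b \<le> s" "p a b \<noteq> 0"
  obtains P where "P \<noteq> 0" "\<And>z X. ev P z X = (\<Sum>b\<le>s. \<Sum>a\<le>s. of_real (p a b) * z ^ a * X ^ b)"
proof -
  define P where "P = (\<Sum>b\<le>s. monom (\<Sum>a\<le>s. monom (p a b) a) b)"
  have "coeff (coeff P b) a = p a b"
  proof -
    have "coeff P b = (\<Sum>a\<le>s. monom (p a b) a)"
      unfolding P_def coeff_sum using assms(2) by (simp add: if_distrib sum.delta cong: if_cong)
    then show ?thesis using assms(1) by (simp add: coeff_sum if_distrib sum.delta cong: if_cong)
  qed
  then have "P \<noteq> 0" using assms(3) by auto
  moreover have "ev P z X = (\<Sum>b\<le>s. \<Sum>a\<le>s. of_real (p a b) * z ^ a * X ^ b)" for z X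
  proof -
    have sum1: "ev1 (\<Sum>i\<in>S. q i) z = (\<Sum>i\<in>S. ev1 (q i) z)" if "finite S" for S :: "nat set" and q
      using that by (induction S rule: finite_induct) (simp_all add: ev1_add)
    have sum2: "ev (\<Sum>i\<in>S. q i) z X = (\<Sum>i\<in>S. ev (q i) z X)" if "finite S" for S :: "nat set" and q
      using that by (induction S rule: finite_induct) (simp_all add: ev_add)
    have mon1: "ev1 (monom c a) z = of_real c * z ^ a" for c a
      by (induction a) (simp_all add: monom_0 monom_Suc ev1_pCons)
    have mon2: "ev (monom q b) z X = ev1 q z * X ^ b" for q b
      by (induction b) (simp_all add: monom_0 monom_Suc ev_pCons)
    show ?thesis unfolding P_def by (simp add: sum1 sum2 mon1 mon2 sum_distrib_right)
  qed
  ultimately show ?thesis using that by blast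
qed

section \<open>The recursion for the Green functions of the cones\<close>

text \<open>
  \<open>A k l\<close> is the total squared hopping from a vertex of label \<open>k\<close> to its children of label \<open>l\<close>, and \<open>w\<close> is
  the potential. Positivity on the diagonal comes from every vertex having a child of its own label.
\<close>

locale recursion =
  fixes A :: "'a::finite \<Rightarrow> 'a \<Rightarrow> real" and w :: "'a \<Rightarrow> real"
  assumes A_nonneg: "\<And>k l. A k l \<ge> 0" and A_diag: "\<And>k. A k k > 0"
begin

definition denom :: "complex \<Rightarrow> ('a \<Rightarrow> complex) \<Rightarrow> 'a \<Rightarrow> complex" where
  "denom z g k = z - of_real (w k) + (\<Sum>l\<in>UNIV. of_real (A k l) * g l)"

text \<open>
  One level of the tree is added. The case of interest is \<open>b = 1\<close>. Other values of \<open>b\<close> serve as a perturbation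
  in the proof that the solution is algebraic.
\<close>

definition step :: "('a \<Rightarrow> real) \<Rightarrow> complex \<Rightarrow> ('a \<Rightarrow> complex) \<Rightarrow> 'a \<Rightarrow> complex" where
  "step b z g k = - of_real (b k) / denom z g k"

definition iter :: "('a \<Rightarrow> real) \<Rightarrow> complex \<Rightarrow> nat \<Rightarrow> 'a \<Rightarrow> complex" where
  "iter b z m = (step b z ^^ m) (\<lambda>_. \<i>)"

definition mass :: real where "mass = (\<Sum>k\<in>UNIV. \<Sum>l\<in>UNIV. A k l)"

lemma iter_0: "iter b z 0 k = \<i>" and iter_Suc: "iter b z (Suc m) = step b z (iter b z m)"
  by (simp_all add: iter_def)

lemma row_sum_le_mass: "(\<Sum>l\<in>UNIV. A k l) \<le> mass"
  unfolding mass_def by (rule member_le_sum) (auto intro: sum_nonneg A_nonneg)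

lemma mass_pos: "mass > 0"
proof -
  obtain k :: 'a where True by simp
  have "A k k \<le> (\<Sum>l\<in>UNIV. A k l)" by (rule member_le_sum) (auto intro: A_nonneg)
  then show ?thesis using row_sum_le_mass[of k] A_diag[of k] by linarith
qed

lemma Im_denom: "Im (denom z g k) = Im z + (\<Sum>l\<in>UNIV. A k l * Im (g l))"
  by (simp add: denom_def)

lemma Im_denom_ge: "(\<And>l. Im (g l) \<ge> 0) \<Longrightarrow> Im (denom z g k) \<ge> Im z"
  unfolding Im_denom by (simp add: sum_nonneg A_nonneg)

lemma Im_step: "Im (step b z g k) = b k * Im (denom z g k) / (cmod (denom z g k))\<^sup>2"
  by (simp add: step_def Im_divide cmod_power2)

lemma denom_nonzero:
  assumes "Im z > 0" "\<And>l. Im (g l) \<ge> 0"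
  shows "denom z g k \<noteq> 0"
  using Im_denom_ge[of g z k] assms by auto

lemma Im_step_pos:
  assumes "Im z > 0" "\<And>l. Im (g l) \<ge> 0" "b k > 0"
  shows "Im (step b z g k) > 0"
  unfolding Im_step using denom_nonzero[of z g k] Im_denom_ge[of g z k] assms by simp

lemma cmod_step_le:
  assumes "Im z > 0" "\<And>l. Im (g l) \<ge> 0" "0 < b k" "b k \<le> 1"
  shows "cmod (step b z g k) \<le> 1 / Im z"
proof -
  have "Im z \<le> cmod (denom z g k)"
    using Im_denom_ge[of g z k] assms abs_Im_le_cmod[of "denom z g k"] by force
  then have "b k / cmod (denom z g k) \<le> 1 / Im z" using assms by (intro frac_le) auto
  then show ?thesis using assms by (simp add: step_def norm_divide)
qed

text \<open>
  The quantity \<open>|g - h|\<^sup>2 / (Im g * Im h)\<close> is a function of the hyperbolic distance. It does not increase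
  under the weighted sum, by the Cauchy--Schwarz inequality.
\<close>

lemma denom_diff_le:
  assumes g: "\<And>l. Im (g l) \<ge> 0" and h: "\<And>l. Im (h l) \<ge> 0" and "\<delta> \<ge> 0"
    and "\<And>l. (cmod (g l - h l))\<^sup>2 \<le> \<delta> * Im (g l) * Im (h l)"
  shows "(cmod (denom z g k - denom z h k))\<^sup>2 \<le>
    \<delta> * (\<Sum>l\<in>UNIV. A k l * Im (g l)) * (\<Sum>l\<in>UNIV. A k l * Im (h l))"
proof -
  have le: "cmod (g l - h l) \<le> sqrt \<delta> * (sqrt (Im (g l)) * sqrt (Im (h l)))" for l
    using real_le_rsqrt[OF assms(4)[of l]] by (simp add: real_sqrt_mult)
  have "denom z g k - denom z h k = (\<Sum>l\<in>UNIV. of_real (A k l) * (g l - h l))"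
    by (simp add: denom_def sum_subtractf algebra_simps)
  also have "cmod \<dots> \<le> (\<Sum>l\<in>UNIV. A k l * cmod (g l - h l))"
    by (rule order.trans[OF norm_sum]) (simp add: norm_mult A_nonneg)
  also have "\<dots> \<le> (\<Sum>l\<in>UNIV. A k l * (sqrt \<delta> * (sqrt (Im (g l)) * sqrt (Im (h l)))))"
    by (intro sum_mono mult_left_mono le A_nonneg)
  also have "\<dots> = sqrt \<delta> * (\<Sum>l\<in>UNIV. sqrt (A k l * Im (g l)) * sqrt (A k l * Im (h l)))"
  proof -
    have "A k l * (sqrt \<delta> * (sqrt (Im (g l)) * sqrt (Im (h l)))) =
      sqrt \<delta> * (sqrt (A k l * Im (g l)) * sqrt (A k l * Im (h l)))" for l
      using A_nonneg[of k l] real_sqrt_mult_self[of "A k l"] by (simp add: real_sqrt_mult)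
    then show ?thesis unfolding sum_distrib_left by (intro sum.cong refl)
  qed
  finally have "(cmod (denom z g k - denom z h k))\<^sup>2 \<le>
      \<delta> * (\<Sum>l\<in>UNIV. sqrt (A k l * Im (g l)) * sqrt (A k l * Im (h l)))\<^sup>2"
    using power_mono[of _ _ 2] \<open>\<delta> \<ge> 0\<close> by (fastforce simp: power_mult_distrib)
  also have "\<dots> \<le> \<delta> * ((\<Sum>l\<in>UNIV. (sqrt (A k l * Im (g l)))\<^sup>2) * (\<Sum>l\<in>UNIV. (sqrt (A k l * Im (h l)))\<^sup>2))"
    by (intro mult_left_mono Cauchy_Schwarz_ineq_sum \<open>\<delta> \<ge> 0\<close>)
  finally show ?thesis using g h A_nonneg by simp
qed

text \<open>
  Taking the negative inverse preserves \<open>|g - h|\<^sup>2 / (Im g * Im h)\<close>, and adding \<open>z\<close> decreases it by a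
  factor that is uniform as long as the imaginary parts are at most \<open>B\<close>.
\<close>

lemma step_contraction:
  assumes z: "Im z \<ge> \<eta>" "\<eta> > 0" and b: "\<And>k. b k > 0"
    and g: "\<And>l. 0 < Im (g l)" "\<And>l. Im (g l) \<le> B"
    and h: "\<And>l. 0 < Im (h l)" "\<And>l. Im (h l) \<le> B"
    and "\<delta> \<ge> 0" "\<And>l. (cmod (g l - h l))\<^sup>2 \<le> \<delta> * Im (g l) * Im (h l)"
  shows "(cmod (step b z g k - step b z h k))\<^sup>2 \<le>
    (mass * B / (mass * B + \<eta>))\<^sup>2 * \<delta> * Im (step b z g k) * Im (step b z h k)"
proof -
  define q where "q = mass * B / (mass * B + \<eta>)"
  have "B > 0" using g(1)[of k] g(2)[of k] by linarith
  then have mB: "mass * B > 0" using mass_pos by simp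
  have q: "q \<ge> 0" using mB z by (simp add: q_def)
  have part: "0 \<le> (\<Sum>l\<in>UNIV. A k l * Im (f l)) \<and> (\<Sum>l\<in>UNIV. A k l * Im (f l)) \<le> q * Im (denom z f k)"
    if f: "\<And>l. 0 < Im (f l)" "\<And>l. Im (f l) \<le> B" for f
  proof -
    define \<sigma> where "\<sigma> = (\<Sum>l\<in>UNIV. A k l * Im (f l))"
    have \<sigma>0: "\<sigma> \<ge> 0" unfolding \<sigma>_def by (intro sum_nonneg mult_nonneg_nonneg A_nonneg less_imp_le f)
    have "\<sigma> \<le> (\<Sum>l\<in>UNIV. A k l * B)" unfolding \<sigma>_def by (intro sum_mono mult_left_mono f A_nonneg)
    also have "\<dots> \<le> mass * B" using row_sum_le_mass[of k] \<open>B > 0\<close> by (simp flip: sum_distrib_right)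
    finally have "\<sigma> * \<eta> \<le> mass * B * \<eta>" using z by simp
    then have "\<sigma> * (mass * B + \<eta>) \<le> mass * B * (\<eta> + \<sigma>)" by (simp add: algebra_simps)
    also have "\<dots> \<le> mass * B * (Im z + \<sigma>)" using mB z by (intro mult_left_mono) auto
    finally have "\<sigma> \<le> q * (Im z + \<sigma>)" using mB z by (simp add: q_def field_simps)
    then show ?thesis using \<sigma>0 by (simp add: Im_denom \<sigma>_def)
  qed
  define p where "p = denom z g k"
  define p' where "p' = denom z h k"
  have g0: "0 \<le> Im (g l)" and h0: "0 \<le> Im (h l)" for l
    using g(1)[of l] h(1)[of l] by auto
  have nz: "p \<noteq> 0" "p' \<noteq> 0"
    unfolding p_def p'_def using z g0 h0 by (simp_all add: denom_nonzero)
  have Imp: "Im p \<ge> 0" "Im p' \<ge> 0"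
    unfolding p_def p'_def using Im_denom_ge[of g z k] Im_denom_ge[of h z k] g h z by (force intro: less_imp_le)+
  have "(cmod (p - p'))\<^sup>2 \<le> \<delta> * (\<Sum>l\<in>UNIV. A k l * Im (g l)) * (\<Sum>l\<in>UNIV. A k l * Im (h l))"
    unfolding p_def p'_def using assms by (intro denom_diff_le) (auto intro: less_imp_le)
  also have "\<dots> \<le> \<delta> * (q * Im p) * (q * Im p')"
    using part[of g] part[of h] g h \<open>\<delta> \<ge> 0\<close> q Imp
    unfolding p_def p'_def by (intro mult_mono mult_nonneg_nonneg) auto
  finally have main: "(cmod (p - p'))\<^sup>2 \<le> q\<^sup>2 * \<delta> * Im p * Im p'"
    by (simp add: power2_eq_square mult_ac)
  have "step b z g k - step b z h k = of_real (b k) * (p - p') / (p * p')"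
    using nz by (simp add: step_def p_def[symmetric] p'_def[symmetric] field_simps)
  then have "(cmod (step b z g k - step b z h k))\<^sup>2 = (b k)\<^sup>2 * (cmod (p - p'))\<^sup>2 / ((cmod p)\<^sup>2 * (cmod p')\<^sup>2)"
    by (simp add: norm_mult norm_divide power_mult_distrib power_divide)
  also have "\<dots> \<le> (b k)\<^sup>2 * (q\<^sup>2 * \<delta> * Im p * Im p') / ((cmod p)\<^sup>2 * (cmod p')\<^sup>2)"
    by (intro divide_right_mono mult_left_mono main) auto
  also have "\<dots> = q\<^sup>2 * \<delta> * Im (step b z g k) * Im (step b z h k)"
    unfolding Im_step p_def p'_def by (simp add: power2_eq_square)
  finally show ?thesis by (simp add: q_def)
qed

text \<open>
  A range of parameters on which the iteration converges uniformly.
\<close>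

definition admissible :: "real \<Rightarrow> real \<Rightarrow> complex \<Rightarrow> ('a \<Rightarrow> real) \<Rightarrow> bool" where
  "admissible \<eta> R z b \<longleftrightarrow> Im z \<ge> \<eta> \<and> cmod z \<le> R \<and> (\<forall>k. 1/2 \<le> b k \<and> b k \<le> 1)"

lemma iter_bounds:
  assumes "Im z > 0" "\<And>k. 0 < b k" "\<And>k. b k \<le> 1"
  shows "0 < Im (iter b z m k) \<and> Im (iter b z m k) \<le> max 1 (1 / Im z)"
proof (induction m arbitrary: k)
  case 0 then show ?case by (simp add: iter_0)
next
  case (Suc m)
  have "Im (step b z (iter b z m) k) \<le> 1 / Im z"
    using cmod_step_le[of z "iter b z m" b k] Suc assms abs_Im_le_cmod[of "step b z (iter b z m) k"]
    by (smt (verit, best) less_imp_le)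
  then show ?case using Im_step_pos[of z "iter b z m" b k] Suc assms
    by (simp add: iter_Suc less_imp_le)
qed

text \<open>
  All iterates stay in the region where \<open>step_contraction\<close> applies with one factor \<open>q < 1\<close>. The constant \<open>\<delta>\<close> bounds the
  hyperbolic distance of the first step, and on this region it controls the Euclidean distance as well.
\<close>

lemma iter_geometric:
  assumes "\<eta> > 0"
  obtains K q :: real where "0 \<le> q" "q < 1"
    "\<And>z b m k. admissible \<eta> R z b \<Longrightarrow> cmod (iter b z (Suc m) k - iter b z m k) \<le> K * q ^ m"
proof -
  define B where "B = max 1 (1 / \<eta>)"
  define q where "q = mass * B / (mass * B + \<eta>)"
  define R1 where "R1 = 1 + \<bar>R\<bar> + (\<Sum>k\<in>UNIV. \<bar>w k\<bar>) + mass"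
  define \<delta> where "\<delta> = (1 / \<eta> + 1)\<^sup>2 * (2 * R1\<^sup>2 / \<eta>)"
  have B: "B \<ge> 1" "1 / \<eta> \<le> B" by (auto simp: B_def)
  have mB: "mass * B > 0" using mass_pos B by simp
  have R1: "R1 > 0" 
  proof -
    have "0 \<le> (\<Sum>k\<in>UNIV. \<bar>w k\<bar>)" by (intro sum_nonneg) auto
    then show ?thesis unfolding R1_def using mass_pos abs_ge_zero[of R] by linarith
  qed
  have q: "0 \<le> q" "q < 1" using mB assms by (auto simp: q_def)
  have \<delta>: "\<delta> \<ge> 0" using assms by (simp add: \<delta>_def)
  show ?thesis
  proof
    fix z b m k assume adm: "admissible \<eta> R z b"
    have z: "Im z \<ge> \<eta>" "Im z > 0" "cmod z \<le> R" using adm assms by (auto simp: admissible_def)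
    have b: "b k > 0" "b k \<ge> 1/2" "b k \<le> 1" for k
      using adm unfolding admissible_def by (auto intro: less_le_trans[of 0 "1/2"])
    have Im: "0 < Im (iter b z m k)" "Im (iter b z m k) \<le> B" for m k
    proof -
      have "1 / Im z \<le> 1 / \<eta>" using z assms by (intro frac_le) auto
      then show "0 < Im (iter b z m k)" "Im (iter b z m k) \<le> B"
        using iter_bounds[of z b m k] z(2) b(1,3) by (auto simp: B_def)
    qed
    have "(cmod (iter b z (Suc m) k - iter b z m k))\<^sup>2 \<le>
        (q\<^sup>2) ^ m * \<delta> * Im (iter b z (Suc m) k) * Im (iter b z m k)" for k
    proof (induction m arbitrary: k)
      case 0
      define p where "p = denom z (\<lambda>_. \<i>) k"
      have s: "iter b z (Suc 0) k = - of_real (b k) / p" by (simp add: iter_Suc step_def iter_def p_def)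
      have "cmod p \<le> cmod z + \<bar>w k\<bar> + cmod (\<Sum>l\<in>UNIV. of_real (A k l) * \<i>)"
        unfolding p_def denom_def
        by (intro order.trans[OF norm_triangle_ineq] add_mono order.trans[OF norm_triangle_ineq4]) auto
      also have "\<bar>w k\<bar> \<le> (\<Sum>k\<in>UNIV. \<bar>w k\<bar>)" by (rule member_le_sum) auto
      also have "(\<Sum>l\<in>UNIV. of_real (A k l) * \<i>) = of_real (\<Sum>l\<in>UNIV. A k l) * \<i>"
        by (simp add: sum_distrib_right)
      also have "cmod \<dots> = (\<Sum>l\<in>UNIV. A k l)" by (simp add: norm_mult sum_nonneg A_nonneg del: of_real_sum)
      also have "\<dots> \<le> mass" by (rule row_sum_le_mass)
      finally have pR: "cmod p \<le> R1" using z by (simp add: R1_def)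
      have Imp: "Im p \<ge> \<eta>" using Im_denom_ge[of "\<lambda>_. \<i>" z k] z by (simp add: p_def)
      then have p0: "p \<noteq> 0" "cmod p > 0" using assms by auto
      have "cmod (iter b z (Suc 0) k) \<le> 1 / Im z"
        unfolding iter_Suc using z b by (intro cmod_step_le) (auto simp: iter_0)
      also have "\<dots> \<le> 1 / \<eta>" using z assms by (intro frac_le) auto
      finally have "cmod (iter b z (Suc 0) k - \<i>) \<le> 1 / \<eta> + 1"
        using norm_triangle_ineq4[of "iter b z (Suc 0) k" \<i>] by simp
      then have 1: "(cmod (iter b z (Suc 0) k - \<i>))\<^sup>2 \<le> (1 / \<eta> + 1)\<^sup>2" by (intro power_mono) auto
      have "1 / R1\<^sup>2 \<le> 1 / (cmod p)\<^sup>2" using pR p0 by (intro frac_le power_mono) auto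
      then have "(1/2) * \<eta> * (1 / R1\<^sup>2) \<le> b k * Im p * (1 / (cmod p)\<^sup>2)"
        using Imp b[of k] assms by (intro mult_mono) auto
      then have "\<eta> / (2 * R1\<^sup>2) \<le> Im (iter b z (Suc 0) k)"
        by (simp add: iter_Suc Im_step iter_def p_def)
      then have "1 \<le> (2 * R1\<^sup>2 / \<eta>) * Im (iter b z (Suc 0) k)"
        using R1 assms by (simp add: field_simps)
      then have "(1 / \<eta> + 1)\<^sup>2 * 1 \<le> (1 / \<eta> + 1)\<^sup>2 * ((2 * R1\<^sup>2 / \<eta>) * Im (iter b z (Suc 0) k))"
        by (intro mult_left_mono) auto
      then show ?case using 1 by (simp add: \<delta>_def iter_0 mult.assoc)
    next
      case (Suc m)
      have "(cmod (iter b z (Suc (Suc m)) k - iter b z (Suc m) k))\<^sup>2 \<le>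
        q\<^sup>2 * ((q\<^sup>2) ^ m * \<delta>) * Im (iter b z (Suc (Suc m)) k) * Im (iter b z (Suc m) k)"
        unfolding iter_Suc[of b z "Suc m"] iter_Suc[of b z m] q_def
      proof (rule step_contraction[where \<eta> = \<eta> and B = B])
        show "0 \<le> (mass * B / (mass * B + \<eta>))\<^sup>2 ^ m * \<delta>" using \<delta> by simp
        show "(cmod (step b z (iter b z m) l - iter b z m l))\<^sup>2 \<le>
           (mass * B / (mass * B + \<eta>))\<^sup>2 ^ m * \<delta> * Im (step b z (iter b z m) l) * Im (iter b z m l)" for l
          using Suc[of l] by (simp add: iter_Suc q_def)
        show "0 < Im (step b z (iter b z m) l)" "Im (step b z (iter b z m) l) \<le> B" for l
          using Im[of "Suc m" l] by (simp_all add: iter_Suc)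
      qed (use z b Im assms in auto)
      then show ?case by (simp add: mult_ac)
    qed
    then have "(cmod (iter b z (Suc m) k - iter b z m k))\<^sup>2 \<le>
        (q\<^sup>2) ^ m * \<delta> * Im (iter b z (Suc m) k) * Im (iter b z m k)" .
    also have "\<dots> \<le> (q\<^sup>2) ^ m * \<delta> * B * B"
      using Im[of m k] Im[of "Suc m" k] \<delta> q B by (intro mult_mono mult_nonneg_nonneg) auto
    also have "\<dots> = (sqrt \<delta> * B * q ^ m)\<^sup>2"
      using \<delta> by (simp add: power_mult_distrib power2_eq_square mult_ac flip: power_mult)
    finally show "cmod (iter b z (Suc m) k - iter b z m k) \<le> sqrt \<delta> * B * q ^ m"
      by (rule power2_le_imp_le) (use q B \<delta> in auto)
  qed (use q in auto)
qed

definition Gam :: "('a \<Rightarrow> real) \<Rightarrow> complex \<Rightarrow> 'a \<Rightarrow> complex" where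
  "Gam b z k = \<i> + (\<Sum>m. iter b z (Suc m) k - iter b z m k)"

text \<open>
  Stated for families \<open>Z\<close>, \<open>b\<close> of parameters, since uniformity is needed both in \<open>z\<close> and in the
  perturbation.
\<close>

lemma iter_uniform_limit:
  assumes "\<eta> > 0" "\<And>x. x \<in> S \<Longrightarrow> admissible \<eta> R (Z x) (b x)"
  shows "uniform_limit S (\<lambda>m x. iter (b x) (Z x) m k) (\<lambda>x. Gam (b x) (Z x) k) sequentially"
proof -
  obtain K q :: real where q: "0 \<le> q" "q < 1" and K:
    "\<And>z b m k. admissible \<eta> R z b \<Longrightarrow> cmod (iter b z (Suc m) k - iter b z m k) \<le> K * q ^ m"
    by (rule iter_geometric[OF assms(1), of R]) blast
  have tel: "\<i> + (\<Sum>i<m. iter b z (Suc i) k - iter b z i k) = iter b z m k" for b z m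
    using sum_lessThan_telescope[of "\<lambda>i. iter b z i k" m] by (simp add: iter_0)
  have "uniform_limit S (\<lambda>n x. \<Sum>i<n. iter (b x) (Z x) (Suc i) k - iter (b x) (Z x) i k)
     (\<lambda>x. \<Sum>i. iter (b x) (Z x) (Suc i) k - iter (b x) (Z x) i k) sequentially"
  proof (rule Weierstrass_m_test)
    show "summable (\<lambda>n. K * q ^ n)" using q by (intro summable_mult summable_geometric) auto
  qed (use K assms(2) in blast)
  from uniform_limit_add[OF uniform_limit_const this, of "\<lambda>_. \<i>"]
  show ?thesis unfolding tel Gam_def .
qed

lemma admissible_point:
  assumes "Im z > 0" "\<And>k. 1/2 \<le> b k" "\<And>k. b k \<le> 1"
  shows "admissible (Im z) (cmod z) z b"
  using assms by (simp add: admissible_def)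

lemma iter_tendsto:
  assumes "Im z > 0" "\<And>k. 1/2 \<le> b k" "\<And>k. b k \<le> 1"
  shows "(\<lambda>m. iter b z m k) \<longlonglongrightarrow> Gam b z k"
  using tendsto_uniform_limitI[OF iter_uniform_limit[of "Im z" "{z}" "cmod z" "\<lambda>x. x" "\<lambda>_. b" k]]
    admissible_point[OF assms] assms(1) by auto

lemma Im_Gam_pos_and_fixed_point:
  assumes "Im z > 0" "\<And>k. 1/2 \<le> b k" "\<And>k. b k \<le> 1"
  shows "Im (Gam b z k) > 0" "Gam b z k = step b z (Gam b z) k"
proof -
  have b0: "b k > 0" for k using assms(2)[of k] by linarith
  have "0 \<le> Im (iter b z m k)" for m k
    using iter_bounds[of z b m k] assms(1,3) b0 by (simp add: less_imp_le)
  then have "Im (Gam b z k) \<ge> 0" for k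
    by (intro tendsto_lowerbound[OF tendsto_Im[OF iter_tendsto[OF assms]]]) auto
  then have dn: "denom z (Gam b z) k \<noteq> 0" "Im (Gam b z k) \<ge> 0" for k using denom_nonzero assms(1) by auto
  have "(\<lambda>m. denom z (iter b z m) k) \<longlonglongrightarrow> denom z (Gam b z) k" for k
    unfolding denom_def by (intro tendsto_intros iter_tendsto[OF assms])
  then have "(\<lambda>m. step b z (iter b z m) k) \<longlonglongrightarrow> step b z (Gam b z) k"
    unfolding step_def using dn by (intro tendsto_intros)
  moreover have "(\<lambda>m. step b z (iter b z m) k) \<longlonglongrightarrow> Gam b z k"
    using LIMSEQ_Suc[OF iter_tendsto[OF assms]] by (simp add: iter_Suc)
  ultimately show fp: "Gam b z k = step b z (Gam b z) k" by (rule LIMSEQ_unique[symmetric])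
  show "Im (Gam b z k) > 0" unfolding fp using assms dn b0 by (intro Im_step_pos)
qed

abbreviation \<Gamma> :: "complex \<Rightarrow> 'a \<Rightarrow> complex" where "\<Gamma> z \<equiv> Gam (\<lambda>_. 1) z"

lemma Im_Gamma_pos: "Im z > 0 \<Longrightarrow> Im (\<Gamma> z k) > 0"
  by (rule Im_Gam_pos_and_fixed_point) auto

lemma Gamma_nonzero: "Im z > 0 \<Longrightarrow> \<Gamma> z k \<noteq> 0"
  using Im_Gamma_pos[of z k] by auto

lemma Gamma_recursion:
  assumes "Im z > 0"
  shows "\<Gamma> z k * denom z (\<Gamma> z) k = -1"
proof -
  have "denom z (\<Gamma> z) k \<noteq> 0"
    using Im_Gamma_pos assms by (intro denom_nonzero) (auto intro: less_imp_le)
  moreover have "\<Gamma> z k = -1 / denom z (\<Gamma> z) k"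
    using Im_Gam_pos_and_fixed_point(2)[of z "\<lambda>_. 1" k] assms by (simp add: step_def)
  ultimately show ?thesis by (simp add: field_simps)
qed

text \<open>
  Conservation of current: \<open>Im \<Gamma>\<close> is what enters a cone, and it is either absorbed at the root (\<open>Im z\<close>)
  or passed on to the cones of the children.
\<close>

lemma Im_Gamma_conservation:
  assumes "Im z > 0"
  shows "Im (\<Gamma> z k) / (cmod (\<Gamma> z k))\<^sup>2 = Im z + (\<Sum>l\<in>UNIV. A k l * Im (\<Gamma> z l))"
proof -
  have "denom z (\<Gamma> z) k = -1 / \<Gamma> z k"
    using Gamma_recursion[OF assms, of k] Gamma_nonzero[OF assms, of k] by (simp add: field_simps)
  then have "Im (denom z (\<Gamma> z) k) = Im (\<Gamma> z k) / (cmod (\<Gamma> z k))\<^sup>2"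
    by (simp add: Im_divide cmod_power2)
  then show ?thesis by (simp add: Im_denom)
qed

text \<open>
  The decisive bound. The child of the same label carries the same \<open>Im \<Gamma>\<close>, which cancels in the
  conservation law and leaves a bound that does not depend on \<open>z\<close>.
\<close>

lemma cmod_Gamma_le:
  assumes "Im z > 0"
  shows "cmod (\<Gamma> z k) \<le> 1 / sqrt (A k k)"
proof -
  have c: "(cmod (\<Gamma> z k))\<^sup>2 > 0" using Gamma_nonzero[OF assms] by simp
  have "A k k * Im (\<Gamma> z k) \<le> (\<Sum>l\<in>UNIV. A k l * Im (\<Gamma> z l))"
    by (rule member_le_sum[of k UNIV "\<lambda>l. A k l * Im (\<Gamma> z l)"])
       (auto intro: A_nonneg Im_Gamma_pos[OF assms] mult_nonneg_nonneg less_imp_le)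
  also have "\<dots> \<le> Im (\<Gamma> z k) / (cmod (\<Gamma> z k))\<^sup>2"
    using Im_Gamma_conservation[OF assms, of k] assms by simp
  finally have "(cmod (\<Gamma> z k))\<^sup>2 * A k k \<le> 1"
    using Im_Gamma_pos[OF assms, of k] c by (simp add: field_simps)
  then have "(cmod (\<Gamma> z k))\<^sup>2 \<le> (1 / sqrt (A k k))\<^sup>2"
    using A_diag[of k] by (simp add: power_divide field_simps)
  then show ?thesis by (rule power2_le_imp_le) (use A_diag[of k] in simp)
qed

lemma iter_holomorphic:
  "(\<lambda>z. iter (\<lambda>_. 1) z m k) holomorphic_on {z. Im z > 0}"
proof (induction m arbitrary: k)
  case 0 then show ?case by (simp add: iter_0)
next
  case (Suc m)
  have "denom z (iter (\<lambda>_. 1) z m) k \<noteq> 0" if "Im z > 0" for z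
    using that iter_bounds[of z "\<lambda>_. 1" m] by (intro denom_nonzero) (auto intro: less_imp_le)
  moreover have "(\<lambda>z. denom z (iter (\<lambda>_. 1) z m) k) holomorphic_on {z. Im z > 0}"
    unfolding denom_def by (intro holomorphic_intros Suc)
  ultimately show ?case unfolding iter_Suc step_def by (intro holomorphic_intros) auto
qed

lemma Gamma_holomorphic: "(\<lambda>z. \<Gamma> z k) holomorphic_on {z. Im z > 0}"
proof (rule holomorphic_uniform_sequence[OF open_halfspace_Im_gt iter_holomorphic])
  fix z :: complex assume "z \<in> {z. Im z > 0}"
  then have z: "Im z > 0" by simp
  have near: "Im u \<ge> Im z / 2 \<and> cmod u \<le> cmod z + Im z" if "u \<in> cball z (Im z / 2)" for u
  proof -
    have d: "cmod (z - u) \<le> Im z / 2" using that by (simp add: dist_norm)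
    have "Im z - Im u \<le> cmod (z - u)" using abs_Im_le_cmod[of "z - u"] by simp
    moreover have "cmod u \<le> cmod z + cmod (z - u)" using norm_triangle_ineq4[of z "z - u"] by simp
    ultimately show ?thesis using d z by linarith
  qed
  have "uniform_limit (cball z (Im z / 2)) (\<lambda>m u. iter (\<lambda>_. 1) u m k) (\<lambda>u. \<Gamma> u k) sequentially"
    using near z by (intro iter_uniform_limit[where \<eta> = "Im z / 2" and R = "cmod z + Im z"]) (auto simp: admissible_def)
  moreover have "cball z (Im z / 2) \<subseteq> {z. Im z > 0}" using near z by fastforce
  ultimately show "\<exists>d>0. cball z d \<subseteq> {z. 0 < Im z} \<and>
      uniform_limit (cball z d) (\<lambda>m u. iter (\<lambda>_. 1) u m k) (\<lambda>u. \<Gamma> u k) sequentially"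
    using z by (intro exI[of _ "Im z / 2"]) auto
qed

lemma iter_continuous_in_parameter:
  assumes "Im z > 0" "\<And>\<epsilon> k. \<epsilon> \<in> S \<Longrightarrow> b \<epsilon> k > 0 \<and> b \<epsilon> k \<le> 1" "\<And>k. continuous_on S (\<lambda>\<epsilon>. b \<epsilon> k)"
  shows "continuous_on S (\<lambda>\<epsilon>. iter (b \<epsilon>) z m k)"
proof (induction m arbitrary: k)
  case 0 then show ?case by (simp add: iter_0)
next
  case (Suc m)
  have "denom z (iter (b \<epsilon>) z m) k \<noteq> 0" if "\<epsilon> \<in> S" for \<epsilon>
    using that iter_bounds[of z "b \<epsilon>" m] assms(1,2) by (intro denom_nonzero) (auto intro: less_imp_le)
  moreover have "continuous_on S (\<lambda>\<epsilon>. denom z (iter (b \<epsilon>) z m) k)"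
    unfolding denom_def by (intro continuous_intros Suc)
  ultimately show ?case unfolding iter_Suc step_def by (intro continuous_intros assms) auto
qed

lemma Gam_continuous_in_parameter:
  assumes "Im z > 0" "\<And>\<epsilon> k. \<epsilon> \<in> S \<Longrightarrow> b \<epsilon> k \<ge> 1/2 \<and> b \<epsilon> k \<le> 1" "\<And>k. continuous_on S (\<lambda>\<epsilon>. b \<epsilon> k)"
  shows "continuous_on S (\<lambda>\<epsilon>. Gam (b \<epsilon>) z k)"
proof (rule uniform_limit_theorem)
  show "uniform_limit S (\<lambda>m \<epsilon>. iter (b \<epsilon>) z m k) (\<lambda>\<epsilon>. Gam (b \<epsilon>) z k) sequentially"
    using assms by (intro iter_uniform_limit[where \<eta> = "Im z" and R = "cmod z"]) (auto simp: admissible_def)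
  have "b \<epsilon> k > 0" if "\<epsilon> \<in> S" for \<epsilon> k using assms(2)[OF that, of k] by linarith
  then show "\<forall>\<^sub>F m in sequentially. continuous_on S (\<lambda>\<epsilon>. iter (b \<epsilon>) z m k)"
    using assms by (intro always_eventually allI iter_continuous_in_parameter) auto
qed auto

text \<open>
  Let \<open>F k = 0\<close> be the recursion in polynomial form. A dependence between \<open>z\<close>, \<open>x j\<close> and the \<open>F k\<close> may become
  trivial when all \<open>F k\<close> are set to zero. Therefore the solution is perturbed so that \<open>F k = \<epsilon> ^ e k\<close>,
  which is the recursion with \<open>b k = 1 - \<epsilon> ^ e k\<close>. With the injective weights \<open>e\<close> different products of
  the \<open>F k\<close> give different powers of \<open>\<epsilon>\<close>; dividing by the lowest one and letting \<open>\<epsilon>\<close> tend to \<open>0\<close> keeps the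
  coefficients belonging to one exponent \<open>\<gamma>0\<close>, and these are not all zero.
\<close>

lemma Gamma_algebraic:
  obtains s :: nat and p :: "nat \<Rightarrow> nat \<Rightarrow> real" where
    "\<exists>a\<le>s. \<exists>b\<le>s. p a b \<noteq> 0"
    "\<And>z. Im z > 0 \<Longrightarrow> (\<Sum>b\<le>s. \<Sum>a\<le>s. of_real (p a b) * z ^ a * \<Gamma> z j ^ b) = 0"
proof -
  define F where "F k z g = g k * denom z g k + 1" for k z g
  have pf: "poly_fun 2 (F k)" for k
  proof -
    have "poly_fun 1 (\<lambda>z g. denom z g k)"
    proof -
      have 1: "poly_fun 1 (\<lambda>z (g :: 'a \<Rightarrow> complex). z + of_real (- w k))"
        by (rule poly_fun_add[OF poly_fun_z poly_fun_const]) simp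
      have 2: "poly_fun 1 (\<lambda>z g. \<Sum>l\<in>UNIV. of_real (A k l) * g l)"
      proof (rule poly_fun_sum)
        fix l
        have "poly_fun (0 + 1) (\<lambda>z (g :: 'a \<Rightarrow> complex). of_real (A k l) * g l)"
          by (rule poly_fun_mult[OF poly_fun_const poly_fun_var]) simp
        then show "poly_fun 1 (\<lambda>z (g :: 'a \<Rightarrow> complex). of_real (A k l) * g l)" by simp
      qed simp
      show ?thesis using poly_fun_add[OF 1 2] by (simp add: denom_def)
    qed
    from poly_fun_add[OF poly_fun_mult[OF poly_fun_var[of 1 k] this] poly_fun_const[of _ 1]]
    have "poly_fun 2 (\<lambda>z g. g k * denom z g k + 1)" by (simp add: numeral_2_eq_2)
    moreover have "F k = (\<lambda>z g. g k * denom z g k + 1)" by (intro ext) (simp add: F_def)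
    ultimately show ?thesis by simp
  qed
  obtain s :: nat and q :: "nat \<times> nat \<times> ('a \<Rightarrow> nat) \<Rightarrow> real" where
    q0: "\<exists>i\<in>{..s} \<times> {..s} \<times> {\<gamma>. \<forall>k. \<gamma> k \<le> s}. q i \<noteq> 0" and
    q: "\<And>z x. (\<Sum>(a, b, \<gamma>)\<in>{..s} \<times> {..s} \<times> {\<gamma>. \<forall>k. \<gamma> k \<le> s}.
        of_real (q (a, b, \<gamma>)) * (z ^ a * x j ^ b * (\<Prod>k\<in>UNIV. F k z x ^ \<gamma> k))) = 0"
    by (rule algebraic_dependence[of F j, OF pf]) blast
  define I where "I = {..s} \<times> {..s} \<times> {\<gamma> :: 'a \<Rightarrow> nat. \<forall>k. \<gamma> k \<le> s}"
  obtain e :: "'a \<Rightarrow> nat" where e: "\<And>k. e k \<ge> 1"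
    "inj_on (\<lambda>\<gamma>. \<Sum>k\<in>UNIV. \<gamma> k * e k) {\<gamma>. \<forall>k. \<gamma> k \<le> s}"
    by (rule injective_weight[of s]) blast
  define W where "W \<gamma> = (\<Sum>k\<in>UNIV. \<gamma> k * e k)" for \<gamma>
  have ex: "\<exists>i. i \<in> I \<and> q i \<noteq> 0" using q0 by (auto simp: I_def)
  obtain i0 where i0: "i0 \<in> I \<and> q i0 \<noteq> 0"
    and least: "\<And>i. i \<in> I \<and> q i \<noteq> 0 \<Longrightarrow> W (snd (snd i0)) \<le> W (snd (snd i))"
    using ex_has_least_nat[of "\<lambda>i. i \<in> I \<and> q i \<noteq> 0" _ "\<lambda>i. W (snd (snd i))"] ex by blast
  obtain a0 b0 \<gamma>0 where i0_eq: "i0 = (a0, b0, \<gamma>0)" by (cases i0)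
  define \<beta> where "\<beta> \<epsilon> k = 1 - \<epsilon> ^ e k" for \<epsilon> :: real and k
  have \<beta>: "\<beta> \<epsilon> k \<ge> 1/2 \<and> \<beta> \<epsilon> k \<le> 1" if "\<epsilon> \<in> {0..1/2}" for \<epsilon> k
  proof -
    have "\<epsilon> ^ e k \<le> \<epsilon> ^ 1" using that e(1)[of k] by (intro power_decreasing) auto
    then show ?thesis using that by (auto simp: \<beta>_def)
  qed
  have "(\<Sum>b\<le>s. \<Sum>a\<le>s. of_real (q (a, b, \<gamma>0)) * z ^ a * \<Gamma> z j ^ b) = 0" if z: "Im z > 0" for z
  proof -
    define x where "x \<epsilon> = Gam (\<beta> \<epsilon>) z" for \<epsilon>
    define t where "t \<epsilon> = (\<lambda>(a, b, \<gamma>). of_real (q (a, b, \<gamma>)) * (z ^ a * x \<epsilon> j ^ b * of_real (\<epsilon> ^ (W \<gamma> - W \<gamma>0))))" for \<epsilon>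
    have FE: "F k z (x \<epsilon>) = of_real (\<epsilon> ^ e k)" if "\<epsilon> \<in> {0..1/2}" for \<epsilon> k
    proof -
      have \<beta>': "1/2 \<le> \<beta> \<epsilon> k" "\<beta> \<epsilon> k \<le> 1" for k using \<beta>[OF that] by auto
      have "denom z (x \<epsilon>) k \<noteq> 0"
        using Im_Gam_pos_and_fixed_point(1)[OF z \<beta>'] z unfolding x_def
        by (intro denom_nonzero) (auto intro: less_imp_le)
      moreover have "x \<epsilon> k = - of_real (\<beta> \<epsilon> k) / denom z (x \<epsilon>) k"
        using Im_Gam_pos_and_fixed_point(2)[OF z \<beta>'] unfolding x_def step_def by simp
      ultimately have "x \<epsilon> k * denom z (x \<epsilon>) k = - of_real (\<beta> \<epsilon> k)" by (simp add: field_simps)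
      then show ?thesis by (simp add: F_def \<beta>_def)
    qed
    have pos: "(\<Sum>i\<in>I. t \<epsilon> i) = 0" if \<epsilon>: "\<epsilon> \<in> {0<..1/2}" for \<epsilon>
    proof -
      have "of_real (\<epsilon> ^ W \<gamma>0) * t \<epsilon> i =
        (\<lambda>(a, b, \<gamma>). of_real (q (a, b, \<gamma>)) * (z ^ a * x \<epsilon> j ^ b * (\<Prod>k\<in>UNIV. F k z (x \<epsilon>) ^ \<gamma> k))) i"
        if i: "i \<in> I" for i
      proof -
        obtain a b \<gamma> where ieq: "i = (a, b, \<gamma>)" by (cases i)
        show ?thesis
        proof (cases "q i = 0")
          case False
          then have "W \<gamma>0 \<le> W \<gamma>" using least[of i] i by (simp add: ieq i0_eq)
          then have "\<epsilon> ^ W \<gamma>0 * \<epsilon> ^ (W \<gamma> - W \<gamma>0) = \<epsilon> ^ W \<gamma>" by (simp flip: power_add)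
          also have "\<dots> = (\<Prod>k\<in>UNIV. (\<epsilon> ^ e k) ^ \<gamma> k)"
            by (simp add: W_def power_sum power_mult mult.commute flip: power_mult)
          finally have "of_real (\<epsilon> ^ W \<gamma>0) * of_real (\<epsilon> ^ (W \<gamma> - W \<gamma>0)) = (\<Prod>k\<in>UNIV. F k z (x \<epsilon>) ^ \<gamma> k)"
            using FE[of \<epsilon>] \<epsilon> by (simp flip: of_real_mult of_real_power of_real_prod)
          then show ?thesis unfolding t_def ieq by (simp add: mult_ac)
        qed (simp add: t_def ieq)
      qed
      then have "of_real (\<epsilon> ^ W \<gamma>0) * (\<Sum>i\<in>I. t \<epsilon> i) = 0"
        using q[of z "x \<epsilon>"] unfolding I_def[symmetric] by (simp add: sum_distrib_left)
      then show ?thesis using \<epsilon> by simp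
    qed
    have "continuous_on {0..1/2} (\<lambda>\<epsilon>. x \<epsilon> j)"
      unfolding x_def using z \<beta> by (intro Gam_continuous_in_parameter) (auto simp: \<beta>_def intro!: continuous_intros)
    then have "continuous_on {0..1/2} (\<lambda>\<epsilon>. \<Sum>i\<in>I. t \<epsilon> i)"
      unfolding t_def case_prod_beta by (intro continuous_intros)
    then have "((\<lambda>\<epsilon>. \<Sum>i\<in>I. t \<epsilon> i) \<longlongrightarrow> (\<Sum>i\<in>I. t 0 i)) (at_right 0)"
      by (rule continuous_on_Icc_at_rightD) simp
    moreover have "\<forall>\<^sub>F \<epsilon> in at_right (0::real). (\<Sum>i\<in>I. t \<epsilon> i) = 0"
      by (rule eventually_at_rightI[of 0 "1/2"]) (use pos in auto)
    ultimately have "(\<Sum>i\<in>I. t 0 i) = 0"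
      by (intro tendsto_unique[OF _ _ tendsto_eventually]) auto
    moreover have "(\<Sum>i\<in>I. t 0 i) = (\<Sum>i\<in>{..s} \<times> {..s} \<times> {\<gamma>0}. t 0 i)"
    proof (rule sum.mono_neutral_right)
      show "finite I" by (simp add: I_def)
      show sub: "{..s} \<times> {..s} \<times> {\<gamma>0} \<subseteq> I" using i0 by (auto simp: I_def i0_eq)
      show "\<forall>i\<in>I - {..s} \<times> {..s} \<times> {\<gamma>0}. t 0 i = 0"
      proof
        fix i assume i: "i \<in> I - {..s} \<times> {..s} \<times> {\<gamma>0}"
        obtain a b \<gamma> where ieq: "i = (a, b, \<gamma>)" by (cases i)
        have "\<gamma> \<noteq> \<gamma>0" using i by (auto simp: ieq I_def)
        then have "W \<gamma> \<noteq> W \<gamma>0"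
          using inj_onD[OF e(2), of \<gamma> \<gamma>0] i i0 by (auto simp: W_def ieq I_def i0_eq)
        then show "t 0 i = 0"
          using least[of i] i by (cases "q i = 0") (auto simp: t_def ieq i0_eq power_0_left)
      qed
    qed
    moreover have "\<beta> 0 k = 1" for k using e(1)[of k] by (cases "e k") (auto simp: \<beta>_def)
    then have "\<beta> 0 = (\<lambda>_. 1)" by auto
    then have "x 0 = \<Gamma> z" by (simp add: x_def)
    ultimately show ?thesis
      by (simp add: t_def sum.cartesian_product[symmetric] mult.assoc) (subst sum.swap, simp)
  qed
  moreover have "q (a0, b0, \<gamma>0) \<noteq> 0" "a0 \<le> s" "b0 \<le> s" using i0 by (auto simp: i0_eq I_def)
  ultimately show ?thesis using that[of s "\<lambda>a b. q (a, b, \<gamma>0)"] by blast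
qed

end

context recursion
begin

text \<open>
  The exceptional sets of the finitely many labels are joined.
\<close>

lemma Gamma_boundary_values:
  obtains D :: "real set" and g :: "real \<Rightarrow> 'a \<Rightarrow> complex" where "finite D"
    "\<And>E k. E \<notin> D \<Longrightarrow> ((\<lambda>z. \<Gamma> z k) \<longlongrightarrow> g E k) (boundary_filter E)"
    "\<And>k. open {E. E \<notin> D \<and> g E k \<in> \<real>}" "\<And>k. open {E. E \<notin> D \<and> g E k \<notin> \<real>}"
proof -
  define good where "good k D g \<longleftrightarrow> finite D \<and>
      (\<forall>E. E \<notin> D \<longrightarrow> ((\<lambda>z. \<Gamma> z k) \<longlongrightarrow> g E) (boundary_filter E)) \<and>
      continuous_on (- D) g \<and> open {E. E \<notin> D \<and> g E \<in> \<real>}" for k D and g :: "real \<Rightarrow> complex"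
  have ex: "\<exists>p. good k (fst p) (snd p)" for k
  proof -
    obtain s :: nat and p :: "nat \<Rightarrow> nat \<Rightarrow> real" where p: "\<exists>a\<le>s. \<exists>b\<le>s. p a b \<noteq> 0"
      "\<And>z. Im z > 0 \<Longrightarrow> (\<Sum>b\<le>s. \<Sum>a\<le>s. of_real (p a b) * z ^ a * \<Gamma> z k ^ b) = 0"
      by (rule Gamma_algebraic[of k]) (rule that)
    obtain i j where ij: "i \<le> s" "j \<le> s" "p i j \<noteq> 0" using p(1) by blast
    obtain P where P: "P \<noteq> 0" "\<And>z X. ev P z X = (\<Sum>b\<le>s. \<Sum>a\<le>s. of_real (p a b) * z ^ a * X ^ b)"
      by (rule poly_relation_nonzero[of i s j p, OF ij]) (rule that)
    have ev0: "ev P z (\<Gamma> z k) = 0" if "Im z > 0" for z unfolding P(2) using p(2)[OF that] .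
    show ?thesis
      by (rule algebraic_boundary_values[of "\<lambda>z. \<Gamma> z k" "1 / sqrt (A k k)" P, OF Gamma_holomorphic cmod_Gamma_le P(1) ev0])
         (auto simp: good_def)
  qed
  then have "\<forall>k. \<exists>p. good k (fst p) (snd p)" by blast
  from choice[OF this] obtain p where "\<And>k. good k (fst (p k)) (snd (p k))" by blast
  then obtain D' g' where "\<And>k. good k (D' k) (g' k)" by (rule that)
  then have Dg: "\<And>k. finite (D' k)"
    "\<And>k E. E \<notin> D' k \<Longrightarrow> ((\<lambda>z. \<Gamma> z k) \<longlongrightarrow> g' k E) (boundary_filter E)"
    "\<And>k. continuous_on (- D' k) (g' k)" "\<And>k. open {E. E \<notin> D' k \<and> g' k E \<in> \<real>}"
    unfolding good_def by blast+
  define D where "D = (\<Union>k. D' k)"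
  have fin: "finite D" by (simp add: D_def Dg)
  then have oD: "open (- D)" by (simp add: finite_imp_closed open_Compl)
  show ?thesis
  proof (rule that[of D "\<lambda>E k. g' k E"])
    show "finite D" by (rule fin)
    show "((\<lambda>z. \<Gamma> z k) \<longlongrightarrow> g' k E) (boundary_filter E)" if "E \<notin> D" for E k
      using that Dg(2) by (auto simp: D_def)
    fix k
    have "{E. E \<notin> D \<and> g' k E \<in> \<real>} = - D \<inter> {E. E \<notin> D' k \<and> g' k E \<in> \<real>}" by (auto simp: D_def)
    then show "open {E. E \<notin> D \<and> g' k E \<in> \<real>}" using oD Dg(4) by auto
    have "continuous_on (- D) (g' k)" by (rule continuous_on_subset[OF Dg(3)]) (auto simp: D_def)
    then have "open (- D \<inter> g' k -` (- \<real>))"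
      by (intro continuous_open_preimage oD) (simp_all add: closed_complex_Reals open_Compl)
    moreover have "- D \<inter> g' k -` (- \<real>) = {E. E \<notin> D \<and> g' k E \<notin> \<real>}" by auto
    ultimately show "open {E. E \<notin> D \<and> g' k E \<notin> \<real>}" by simp
  qed
qed

text \<open>
  At the boundary the conservation law reads \<open>Im g k = |g k|\<^sup>2 * (\<Sum>l. A k l * Im g l)\<close> with nonnegative
  terms on the right.
\<close>

lemma boundary_value_real_propagates:
  assumes g: "\<And>k. ((\<lambda>z. \<Gamma> z k) \<longlongrightarrow> g k) (boundary_filter E)"
    and k: "g k \<in> \<real>" and A: "A k l > 0"
  shows "g l \<in> \<real>"
proof -
  have nn: "Im (g m) \<ge> 0" for m
  proof (rule tendsto_lowerbound[OF tendsto_Im[OF g] _ boundary_filter_nontrivial])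
    show "\<forall>\<^sub>F z in boundary_filter E. 0 \<le> Im (\<Gamma> z m)"
      using eventually_upper_half by eventually_elim (rule less_imp_le[OF Im_Gamma_pos])
  qed
  define d where "d = of_real E - of_real (w k) + (\<Sum>l\<in>UNIV. of_real (A k l) * g l)"
  have "((\<lambda>z. \<Gamma> z k * denom z (\<Gamma> z) k) \<longlongrightarrow> g k * d) (boundary_filter E)"
    unfolding denom_def d_def by (intro tendsto_intros g)
  moreover have "\<forall>\<^sub>F z in boundary_filter E. \<Gamma> z k * denom z (\<Gamma> z) k = -1"
    using eventually_upper_half by eventually_elim (rule Gamma_recursion)
  then have "((\<lambda>z. \<Gamma> z k * denom z (\<Gamma> z) k) \<longlongrightarrow> -1) (boundary_filter E)"
    by (rule tendsto_eventually)
  ultimately have gd: "g k * d = -1" using tendsto_unique[OF boundary_filter_nontrivial] by blast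
  have "g k \<noteq> 0" using gd by auto
  then have "d = -1 / g k" using gd by (simp add: field_simps)
  then have "d \<in> \<real>" using k by auto
  then have "Im d = 0" by (simp add: complex_is_Real_iff)
  then have s0: "(\<Sum>l\<in>UNIV. A k l * Im (g l)) = 0" by (simp add: d_def)
  have "A k l * Im (g l) = 0"
    using s0 by (subst (asm) sum_nonneg_eq_0_iff) (auto simp: nn A_nonneg)
  then show ?thesis using A by (simp add: complex_is_Real_iff)
qed

end

section \<open>Parents and children in a rooted tree\<close>

text \<open>
  The predicate \<open>Q\<close> is carried along in order to know that the path avoids a given vertex.
\<close>

lemma rtranclp_imp_distinct_path:
  assumes "E\<^sup>*\<^sup>* p q" "Q q" "\<And>u v. E u v \<Longrightarrow> Q u"
  shows "\<exists>l. l \<noteq> [] \<and> hd l = p \<and> last l = q \<and> distinct l \<and> successively E l \<and> (\<forall>u\<in>set l. Q u)"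
  using assms(1)
proof (induction rule: converse_rtranclp_induct)
  case base
  then show ?case using assms(2) by (intro exI[of _ "[q]"]) auto
next
  case (step p p')
  then obtain l where l: "l \<noteq> []" "hd l = p'" "last l = q" "distinct l" "successively E l" "\<forall>u\<in>set l. Q u"
    by blast
  show ?case
  proof (cases "p \<in> set l")
    case True
    then obtain ys zs where "l = ys @ p # zs" by (auto dest: split_list)
    then show ?thesis using l by (intro exI[of _ "p # zs"]) (auto simp: successively_append_iff)
  next
    case False
    then show ?thesis using l step.hyps(1) assms(3)
      by (intro exI[of _ "p # l"]) (auto simp: successively_Cons)
  qed
qed

locale tree_graph =
  fixes adj :: "'v \<Rightarrow> 'v \<Rightarrow> bool" and r :: 'v
  assumes tree: "tree adj"
begin

abbreviation depth :: "'v \<Rightarrow> nat" where "depth \<equiv> graph_dist adj r"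

lemma adj_sym: "adj x y \<Longrightarrow> adj y x"
  using tree by (auto simp: tree_def dest: sympD)

lemma adj_irrefl: "\<not> adj x x"
  using tree by (auto simp: tree_def irreflp_def)

lemma depth_path: "(adj ^^ depth x) r x"
proof -
  have "adj\<^sup>*\<^sup>* r x" using tree by (auto simp: tree_def)
  then obtain n where "(adj ^^ n) r x" using rtranclp_imp_relpowp by metis
  then show ?thesis unfolding graph_dist_def by (rule LeastI)
qed

lemma depth_le: "(adj ^^ n) r x \<Longrightarrow> depth x \<le> n"
  unfolding graph_dist_def by (rule Least_le)

lemma depth_root [simp]: "depth r = 0"
  using depth_le[of 0 r] by simp

lemma depth_eq_0_iff: "depth x = 0 \<longleftrightarrow> x = r"
  using depth_path[of x] by (cases "depth x = 0") auto

lemma depth_adj_le: "adj x y \<Longrightarrow> depth y \<le> Suc (depth x)"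
  by (rule depth_le) (rule relpowp_Suc_I[OF depth_path])

lemma lower_neighbour:
  assumes "depth x = Suc n"
  obtains p where "adj x p" "depth p = n"
proof -
  obtain p where p: "(adj ^^ n) r p" "adj p x"
    using depth_path[of x] unfolding assms by (rule relpowp_Suc_E)
  have "depth p = n" using depth_le[OF p(1)] depth_adj_le[OF p(2)] assms by simp
  then show ?thesis using that adj_sym[OF p(2)] by blast
qed

text \<open>
  From two such neighbours one could walk to the root without meeting \<open>x\<close>, since the depth does not
  exceed that of \<open>x\<close> on the way. Joining the two walks and adding \<open>x\<close> would give a cycle.
\<close>

lemma lower_neighbour_unique:
  assumes "adj x p" "adj x q" "depth p \<le> depth x" "depth q \<le> depth x"
  shows "p = q"
proof (rule ccontr)
  assume "p \<noteq> q"
  define E where "E = (\<lambda>u v. adj u v \<and> u \<noteq> x \<and> v \<noteq> x)"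
  have xr: "x \<noteq> r" using assms(1,3) adj_irrefl[of x] depth_eq_0_iff[of p] by auto
  have down: "E\<^sup>*\<^sup>* u r" if "u \<noteq> x" "depth u \<le> depth x" for u
    using that
  proof (induction "depth u" arbitrary: u)
    case 0
    then show ?case using depth_eq_0_iff[of u] by simp
  next
    case (Suc n)
    obtain v where v: "adj u v" "depth v = n" using lower_neighbour[of u n] Suc.hyps(2) by metis
    have vx: "v \<noteq> x" using v Suc by auto
    then have "E u v" using v Suc.prems by (simp add: E_def)
    moreover have "E\<^sup>*\<^sup>* v r" using Suc.hyps(1)[of v] v vx Suc.hyps(2) Suc.prems by simp
    ultimately show ?case by (rule converse_rtranclp_into_rtranclp)
  qed
  have px: "p \<noteq> x" "q \<noteq> x" using assms adj_irrefl by auto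
  have "symp E" by (auto simp: E_def symp_def dest: adj_sym)
  then have "E\<^sup>*\<^sup>* r q" using down[of q] px assms(4) by (metis sympD symp_rtranclp)
  then have "E\<^sup>*\<^sup>* p q" using down[of p] px assms(3) by (meson rtranclp_trans)
  from rtranclp_imp_distinct_path[OF this, of "\<lambda>u. u \<noteq> x"] px
  obtain l where l: "l \<noteq> []" "hd l = p" "last l = q" "distinct l" "successively E l" "\<forall>u\<in>set l. u \<noteq> x"
    by (auto simp: E_def)
  have "length l \<ge> 2"
  proof (rule ccontr)
    assume "\<not> length l \<ge> 2"
    then have "length l = 1" using l(1) by (cases l) (auto simp: not_le)
    then show False using l \<open>p \<noteq> q\<close> by (cases l) auto
  qed
  moreover have "successively adj l" using l(5) by (rule successively_mono) (auto simp: E_def)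
  ultimately have "has_cycle adj" unfolding has_cycle_def
    using l assms(1) adj_sym[OF assms(2)]
    by (intro exI[of _ "x # l"]) (auto simp: successively_Cons)
  then show False using tree by (simp add: tree_def)
qed

definition parent :: "'v \<Rightarrow> 'v" where
  "parent x = (SOME p. adj x p \<and> depth x = Suc (depth p))"

definition children :: "'v \<Rightarrow> 'v set" where
  "children x = {y. adj x y \<and> depth y = Suc (depth x)}"

lemma parent: "x \<noteq> r \<Longrightarrow> adj x (parent x) \<and> depth x = Suc (depth (parent x))"
  unfolding parent_def
  by (rule someI_ex) (metis depth_eq_0_iff lower_neighbour not0_implies_Suc)

lemma children_iff: "y \<in> children x \<longleftrightarrow> y \<noteq> r \<and> parent y = x"
proof
  assume "y \<in> children x"
  then have y: "adj x y" "depth y = Suc (depth x)" by (auto simp: children_def)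
  then have "y \<noteq> r" by auto
  moreover have "parent y = x"
    using parent[OF \<open>y \<noteq> r\<close>] y adj_sym[OF y(1)] by (intro lower_neighbour_unique[of y]) auto
  ultimately show "y \<noteq> r \<and> parent y = x" by simp
qed (use parent in \<open>auto simp: children_def dest: adj_sym\<close>)

lemma neighbours: "{y. adj x y} = children x \<union> (if x = r then {} else {parent x})"
proof (intro equalityI subsetI)
  fix y assume "y \<in> {y. adj x y}"
  then have y: "adj x y" by simp
  show "y \<in> children x \<union> (if x = r then {} else {parent x})"
  proof (cases "depth y \<le> depth x")
    case True
    then have "x \<noteq> r" using y adj_irrefl[of r] depth_eq_0_iff[of y] by auto
    moreover have "y = parent x"
      using parent[OF \<open>x \<noteq> r\<close>] y True by (intro lower_neighbour_unique[of x]) auto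
    ultimately show ?thesis by simp
  next
    case False
    then have "depth y = Suc (depth x)" using depth_adj_le[OF y] by simp
    then show ?thesis using y by (simp add: children_def)
  qed
qed (use parent in \<open>auto simp: children_def split: if_splits\<close>)

end

section \<open>Square summable functions and Hermitian kernels of finite range\<close>

text \<open>
  The Lax--Milgram theorem for a form on a real Hilbert space: \<open>B x = y\<close> is a fixed point equation for
  \<open>x - s *\<^sub>R (B x - y)\<close>, which is a contraction for small \<open>s > 0\<close>.
\<close>

lemma coercive_surjective:
  fixes B :: "'h::{real_inner,complete_space} \<Rightarrow> 'h"
  assumes B: "bounded_linear B" and "\<delta> > 0" and coercive: "\<And>x. inner x (B x) \<ge> \<delta> * (norm x)\<^sup>2"
  shows "\<exists>x. B x = y"
proof -
  interpret B: bounded_linear B by fact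
  obtain K where K: "K > 0" "\<And>x. norm (B x) \<le> norm x * K" using B.pos_bounded by blast
  \<comment> \<open>any \<open>s > 0\<close> with \<open>s * K\<^sup>2 < 2 * \<delta>\<close> makes \<open>c2 < 1\<close>\<close>
  define s where "s = \<delta> / (\<delta>\<^sup>2 + K\<^sup>2)"
  define c2 where "c2 = 1 - 2 * s * \<delta> + s\<^sup>2 * K\<^sup>2"
  have den: "\<delta>\<^sup>2 + K\<^sup>2 > 0" using \<open>\<delta> > 0\<close> by (simp add: add_pos_nonneg)
  have s: "s > 0" using \<open>\<delta> > 0\<close> den by (simp add: s_def)
  have sK: "s * (\<delta>\<^sup>2 + K\<^sup>2) = \<delta>" using den by (simp add: s_def)
  have "c2 < 1"
  proof -
    have "s\<^sup>2 * K\<^sup>2 = s * (s * (\<delta>\<^sup>2 + K\<^sup>2) - s * \<delta>\<^sup>2)" by (simp add: power2_eq_square algebra_simps)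
    also have "\<dots> < s * \<delta>" unfolding sK using s \<open>\<delta> > 0\<close> by (intro mult_strict_left_mono) auto
    finally show ?thesis using mult_pos_pos[OF s \<open>\<delta> > 0\<close>] unfolding c2_def by linarith
  qed
  have est: "(norm (x - s *\<^sub>R B x))\<^sup>2 \<le> c2 * (norm x)\<^sup>2" for x
  proof -
    have "(norm (x - s *\<^sub>R B x))\<^sup>2 = (norm x)\<^sup>2 - 2 * s * inner x (B x) + s\<^sup>2 * (norm (B x))\<^sup>2"
      unfolding power2_norm_eq_inner by (simp add: algebra_simps inner_commute power2_eq_square)
    also have "\<dots> \<le> (norm x)\<^sup>2 - 2 * s * (\<delta> * (norm x)\<^sup>2) + s\<^sup>2 * (norm x * K)\<^sup>2"
      using coercive[of x] K(2)[of x] s by (intro add_mono diff_mono mult_left_mono power_mono) auto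
    also have "\<dots> = c2 * (norm x)\<^sup>2" by (simp add: c2_def algebra_simps power2_eq_square)
    finally show ?thesis .
  qed
  define c where "c = sqrt (max 0 c2)"
  have c: "0 \<le> c" "c < 1" using \<open>c2 < 1\<close> by (auto simp: c_def)
  define f where "f x = x - s *\<^sub>R (B x - y)" for x
  have "dist (f x) (f x') \<le> c * dist x x'" for x x'
  proof -
    have "f x - f x' = (x - x') - s *\<^sub>R B (x - x')" by (simp add: f_def B.diff algebra_simps)
    then have "(norm (f x - f x'))\<^sup>2 \<le> c2 * (norm (x - x'))\<^sup>2" using est by simp
    also have "\<dots> \<le> max 0 c2 * (norm (x - x'))\<^sup>2" by (intro mult_right_mono) auto
    also have "\<dots> = (c * norm (x - x'))\<^sup>2" by (simp add: c_def power_mult_distrib)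
    finally show ?thesis unfolding dist_norm by (rule power2_le_imp_le) (use c in auto)
  qed
  then obtain x where "f x = x" using banach_fix_type[OF c] by blast
  then have "B x = y" using s by (simp add: f_def)
  then show ?thesis by blast
qed

text \<open>
  As a type, the space of square summable functions inherits norm, limits and Banach's fixed point theorem from
  the type classes. These classes are real; multiplication by complex numbers is added as
  \<open>scaleC\<close>, and the inner product of the class is the real part of the complex one.
\<close>

typedef 'v ell2 = "{\<phi> :: 'v \<Rightarrow> complex. (\<lambda>x. (cmod (\<phi> x))\<^sup>2) summable_on UNIV}"
  morphisms coord Abs_ell2
  by (rule exI[of _ "\<lambda>_. 0"]) simp

setup_lifting type_definition_ell2

lemma summable_cmod_sq: "(\<lambda>x. (cmod (coord \<phi> x))\<^sup>2) summable_on UNIV"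
  using coord[of \<phi>] by simp

lemma ell2_eqI: "(\<And>x. coord \<phi> x = coord \<psi> x) \<Longrightarrow> \<phi> = \<psi>"
  by (metis coord_inject ext)

lemma cmod_add_sq_le: "(cmod (a + b))\<^sup>2 \<le> 2 * (cmod a)\<^sup>2 + 2 * (cmod b)\<^sup>2"
proof -
  have "(cmod (a + b))\<^sup>2 \<le> (cmod a + cmod b)\<^sup>2" by (intro power_mono norm_triangle_ineq) auto
  also have "\<dots> \<le> 2 * (cmod a)\<^sup>2 + 2 * (cmod b)\<^sup>2"
    using sum_squares_bound[of "cmod a" "cmod b"] by (simp add: power2_eq_square algebra_simps)
  finally show ?thesis .
qed

lift_definition scaleC :: "complex \<Rightarrow> 'v ell2 \<Rightarrow> 'v ell2" is "\<lambda>c \<phi> x. c * \<phi> x"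
  by (simp add: norm_mult power_mult_distrib summable_on_cmult_right)

instantiation ell2 :: (type) real_vector
begin
lift_definition zero_ell2 :: "'a ell2" is "\<lambda>_. 0" by simp
lift_definition plus_ell2 :: "'a ell2 \<Rightarrow> 'a ell2 \<Rightarrow> 'a ell2" is "\<lambda>\<phi> \<psi> x. \<phi> x + \<psi> x"
proof -
  fix \<phi> \<psi> :: "'a \<Rightarrow> complex"
  assume "(\<lambda>x. (cmod (\<phi> x))\<^sup>2) summable_on UNIV" "(\<lambda>x. (cmod (\<psi> x))\<^sup>2) summable_on UNIV"
  then have "(\<lambda>x. 2 * (cmod (\<phi> x))\<^sup>2 + 2 * (cmod (\<psi> x))\<^sup>2) summable_on UNIV"
    by (intro summable_on_add summable_on_cmult_right)
  then show "(\<lambda>x. (cmod (\<phi> x + \<psi> x))\<^sup>2) summable_on UNIV"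
    by (rule summable_on_comparison_test) (auto simp: cmod_add_sq_le)
qed
lift_definition uminus_ell2 :: "'a ell2 \<Rightarrow> 'a ell2" is "\<lambda>\<phi> x. - \<phi> x" by simp
definition minus_ell2 :: "'a ell2 \<Rightarrow> 'a ell2 \<Rightarrow> 'a ell2" where "minus_ell2 \<phi> \<psi> = \<phi> + (- \<psi>)"
definition scaleR_ell2 :: "real \<Rightarrow> 'a ell2 \<Rightarrow> 'a ell2" where "scaleR_ell2 c \<phi> = scaleC (of_real c) \<phi>"
instance
proof
  fix \<phi> \<psi> \<xi> :: "'a ell2" and b c :: real
  note eqs = plus_ell2.rep_eq zero_ell2.rep_eq uminus_ell2.rep_eq scaleC.rep_eq scaleR_ell2_def
  show "\<phi> + \<psi> + \<xi> = \<phi> + (\<psi> + \<xi>)" "\<phi> + \<psi> = \<psi> + \<phi>" by (rule ell2_eqI, simp add: eqs)+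
  show "0 + \<phi> = \<phi>" "- \<phi> + \<phi> = 0" by (rule ell2_eqI, simp add: eqs)+
  show "\<phi> - \<psi> = \<phi> + - \<psi>" by (rule minus_ell2_def)
  show "c *\<^sub>R (\<phi> + \<psi>) = c *\<^sub>R \<phi> + c *\<^sub>R \<psi>" "(b + c) *\<^sub>R \<phi> = b *\<^sub>R \<phi> + c *\<^sub>R \<phi>"
    by (rule ell2_eqI, simp add: eqs algebra_simps)+
  show "b *\<^sub>R c *\<^sub>R \<phi> = (b * c) *\<^sub>R \<phi>" "1 *\<^sub>R \<phi> = \<phi>" by (rule ell2_eqI, simp add: eqs)+
qed
end

lemma coord_simps [simp]:
  "coord 0 x = 0" "coord (\<phi> + \<psi>) x = coord \<phi> x + coord \<psi> x" "coord (- \<phi>) x = - coord \<phi> x"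
  "coord (\<phi> - \<psi>) x = coord \<phi> x - coord \<psi> x" "coord (c *\<^sub>R \<phi>) x = of_real c * coord \<phi> x"
  "coord (scaleC d \<phi>) x = d * coord \<phi> x"
  by (simp_all only: minus_ell2_def scaleR_ell2_def plus_ell2.rep_eq zero_ell2.rep_eq
      uminus_ell2.rep_eq scaleC.rep_eq) simp_all

lemma coord_sum [simp]: "coord (\<Sum>i\<in>S. f i) x = (\<Sum>i\<in>S. coord (f i) x)"
  by (induction S rule: infinite_finite_induct) auto

lemma summable_inner: "(\<lambda>x. Re (cnj (coord \<phi> x) * coord \<psi> x)) summable_on UNIV"
proof -
  have "(\<lambda>x. norm (Re (cnj (coord \<phi> x) * coord \<psi> x))) summable_on UNIV"
  proof (rule Infinite_Sum.abs_summable_on_comparison_test)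
    show "(\<lambda>x. norm ((cmod (coord \<phi> x))\<^sup>2 + (cmod (coord \<psi> x))\<^sup>2)) summable_on UNIV"
      by (simp add: summable_on_add summable_cmod_sq)
    fix x
    have "\<bar>Re (cnj (coord \<phi> x) * coord \<psi> x)\<bar> \<le> cmod (coord \<phi> x) * cmod (coord \<psi> x)"
      using abs_Re_le_cmod[of "cnj (coord \<phi> x) * coord \<psi> x"] by (simp add: norm_mult)
    also have "\<dots> \<le> (cmod (coord \<phi> x))\<^sup>2 + (cmod (coord \<psi> x))\<^sup>2"
    proof -
      have "0 \<le> cmod (coord \<phi> x) * cmod (coord \<psi> x)" by simp
      then show ?thesis using sum_squares_bound[of "cmod (coord \<phi> x)" "cmod (coord \<psi> x)"] by linarith
    qed
    finally show "norm (Re (cnj (coord \<phi> x) * coord \<psi> x)) \<le> norm ((cmod (coord \<phi> x))\<^sup>2 + (cmod (coord \<psi> x))\<^sup>2)"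
      by simp
  qed
  then show ?thesis by (rule abs_summable_summable)
qed

instantiation ell2 :: (type) real_inner
begin
definition inner_ell2 :: "'a ell2 \<Rightarrow> 'a ell2 \<Rightarrow> real" where
  "inner_ell2 \<phi> \<psi> = (\<Sum>\<^sub>\<infinity>x. Re (cnj (coord \<phi> x) * coord \<psi> x))"
definition norm_ell2 :: "'a ell2 \<Rightarrow> real" where "norm_ell2 \<phi> = sqrt (inner \<phi> \<phi>)"
definition sgn_ell2 :: "'a ell2 \<Rightarrow> 'a ell2" where "sgn_ell2 \<phi> = inverse (norm \<phi>) *\<^sub>R \<phi>"
definition dist_ell2 :: "'a ell2 \<Rightarrow> 'a ell2 \<Rightarrow> real" where "dist_ell2 \<phi> \<psi> = norm (\<phi> - \<psi>)"
definition uniformity_ell2 :: "('a ell2 \<times> 'a ell2) filter" where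
  "uniformity_ell2 = (INF e\<in>{0<..}. principal {(\<phi>, \<psi>). dist \<phi> \<psi> < e})"
definition open_ell2 :: "'a ell2 set \<Rightarrow> bool" where
  "open_ell2 U = (\<forall>\<phi>\<in>U. eventually (\<lambda>(\<phi>', \<psi>). \<phi>' = \<phi> \<longrightarrow> \<psi> \<in> U) uniformity)"
instance
proof
  fix \<phi> \<psi> \<xi> :: "'a ell2" and c :: real
  show "inner \<phi> \<psi> = inner \<psi> \<phi>" unfolding inner_ell2_def by (intro infsum_cong) (simp add: algebra_simps)
  show "inner (\<phi> + \<psi>) \<xi> = inner \<phi> \<xi> + inner \<psi> \<xi>"
    unfolding inner_ell2_def infsum_add[OF summable_inner summable_inner, symmetric]
    by (intro infsum_cong) (simp add: algebra_simps)
  show "inner (c *\<^sub>R \<phi>) \<psi> = c * inner \<phi> \<psi>"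
    unfolding inner_ell2_def
    by (subst infsum_cmult_right'[symmetric]) (auto intro!: infsum_cong simp: algebra_simps)
  have sq: "Re (cnj z * z) = (cmod z)\<^sup>2" for z
    by (simp add: cmod_power2) (simp add: power2_eq_square)
  show "0 \<le> inner \<phi> \<phi>" unfolding inner_ell2_def sq by (intro infsum_nonneg) auto
  show "inner \<phi> \<phi> = 0 \<longleftrightarrow> \<phi> = 0"
  proof
    assume "inner \<phi> \<phi> = 0"
    then have s0: "(\<Sum>\<^sub>\<infinity>x. (cmod (coord \<phi> x))\<^sup>2) \<le> 0" unfolding inner_ell2_def sq by simp
    have "(cmod (coord \<phi> x))\<^sup>2 = 0" for x
      by (rule nonneg_infsum_le_0D[OF s0 summable_cmod_sq]) auto
    then show "\<phi> = 0" by (intro ell2_eqI) auto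
  qed (simp add: inner_ell2_def)
qed (rule norm_ell2_def sgn_ell2_def dist_ell2_def uniformity_ell2_def open_ell2_def)+
end

lemma norm_sq_ell2: "(norm \<phi>)\<^sup>2 = (\<Sum>\<^sub>\<infinity>x. (cmod (coord \<phi> x))\<^sup>2)"
proof -
  have "Re (cnj z * z) = (cmod z)\<^sup>2" for z by (simp add: cmod_power2) (simp add: power2_eq_square)
  then show ?thesis unfolding power2_norm_eq_inner inner_ell2_def by simp
qed

lemma sum_le_norm_sq: "finite F \<Longrightarrow> (\<Sum>x\<in>F. (cmod (coord \<phi> x))\<^sup>2) \<le> (norm \<phi>)\<^sup>2"
  unfolding norm_sq_ell2 by (rule finite_sum_le_infsum[OF summable_cmod_sq]) auto

lemma cmod_coord_le: "cmod (coord \<phi> x) \<le> norm \<phi>"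
  using sum_le_norm_sq[of "{x}" \<phi>] by (intro power2_le_imp_le[of "cmod (coord \<phi> x)"]) auto

text \<open>
  The way in which all elements other than linear combinations are constructed.
\<close>

lemma ell2_of_bounded_sums:
  assumes "\<And>F. finite F \<Longrightarrow> (\<Sum>x\<in>F. (cmod (f x))\<^sup>2) \<le> B"
  obtains \<phi> where "coord \<phi> = f" "(norm \<phi>)\<^sup>2 \<le> B"
proof -
  have s: "(\<lambda>x. (cmod (f x))\<^sup>2) summable_on UNIV"
    using assms by (intro nonneg_bdd_above_summable_on) (auto intro!: bdd_aboveI[of _ B])
  then have c: "coord (Abs_ell2 f) = f" by (simp add: Abs_ell2_inverse)
  moreover have "(norm (Abs_ell2 f))\<^sup>2 \<le> B"
    unfolding norm_sq_ell2 c using assms by (intro infsum_le_finite_sums s) auto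
  ultimately show ?thesis using that by blast
qed

instance ell2 :: (type) complete_space
proof
  fix X :: "nat \<Rightarrow> 'a ell2" assume X: "Cauchy X"
  have "Cauchy (\<lambda>n. coord (X n) x)" for x
  proof (rule CauchyI)
    fix e :: real assume "e > 0"
    then obtain N where "\<forall>m\<ge>N. \<forall>n\<ge>N. norm (X m - X n) < e" using CauchyD[OF X] by blast
    then show "\<exists>N. \<forall>m\<ge>N. \<forall>n\<ge>N. norm (coord (X m) x - coord (X n) x) < e"
      using cmod_coord_le[of "X _ - X _" x] by (metis coord_simps(4) order.strict_trans1)
  qed
  then have "\<forall>x. \<exists>l. (\<lambda>n. coord (X n) x) \<longlonglongrightarrow> l" by (metis Cauchy_convergent_iff convergent_def)
  then obtain L where L: "\<And>x. (\<lambda>n. coord (X n) x) \<longlonglongrightarrow> L x" by metis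
  have est: "(\<Sum>x\<in>F. (cmod (coord (X n) x - L x))\<^sup>2) \<le> e\<^sup>2"
    if "finite F" and N: "\<And>m. m \<ge> N \<Longrightarrow> norm (X n - X m) < e" for F n N e
  proof (rule tendsto_upperbound)
    show "(\<lambda>m. \<Sum>x\<in>F. (cmod (coord (X n) x - coord (X m) x))\<^sup>2) \<longlonglongrightarrow> (\<Sum>x\<in>F. (cmod (coord (X n) x - L x))\<^sup>2)"
      by (intro tendsto_intros L)
    have "(\<Sum>x\<in>F. (cmod (coord (X n) x - coord (X m) x))\<^sup>2) \<le> e\<^sup>2" if "m \<ge> N" for m
      using order.trans[OF sum_le_norm_sq[OF \<open>finite F\<close>, of "X n - X m"] power_mono[OF less_imp_le[OF N[OF that]]]]
      by simp
    then show "\<forall>\<^sub>F m in sequentially. (\<Sum>x\<in>F. (cmod (coord (X n) x - coord (X m) x))\<^sup>2) \<le> e\<^sup>2"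
      by (auto simp: eventually_sequentially)
  qed simp
  obtain N1 where N1: "\<And>m n. m \<ge> N1 \<Longrightarrow> n \<ge> N1 \<Longrightarrow> norm (X m - X n) < 1" using CauchyD[OF X, of 1] by auto
  have "(\<Sum>x\<in>F. (cmod (coord (X N1) x - L x))\<^sup>2) \<le> 1\<^sup>2" if "finite F" for F
    using that N1 by (intro est[of _ N1]) auto
  from ell2_of_bounded_sums[OF this] obtain \<psi> where \<psi>: "coord \<psi> = (\<lambda>x. coord (X N1) x - L x)" by blast
  define l where "l = X N1 - \<psi>"
  have l: "coord l x = L x" for x by (simp add: l_def \<psi>)
  have "X \<longlonglongrightarrow> l"
  proof (rule LIMSEQ_I)
    fix e :: real assume "e > 0"
    then obtain N where N: "\<And>m n. m \<ge> N \<Longrightarrow> n \<ge> N \<Longrightarrow> norm (X m - X n) < e / 2"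
      using CauchyD[OF X, of "e / 2"] by auto
    have "norm (X n - l) < e" if "n \<ge> N" for n
    proof -
      have "(\<Sum>x\<in>F. (cmod (coord (X n) x - L x))\<^sup>2) \<le> (e / 2)\<^sup>2" if "finite F" for F
        using that N \<open>n \<ge> N\<close> by (intro est[of _ N]) auto
      from ell2_of_bounded_sums[OF this] obtain \<xi> where
        "coord \<xi> = (\<lambda>x. coord (X n) x - L x)" "(norm \<xi>)\<^sup>2 \<le> (e / 2)\<^sup>2" by blast
      moreover from this have "\<xi> = X n - l" by (intro ell2_eqI) (simp add: l)
      ultimately have "norm (X n - l) \<le> e / 2" using \<open>e > 0\<close> by (auto intro: power2_le_imp_le)
      then show ?thesis using \<open>e > 0\<close> by simp
    qed
    then show "\<exists>no. \<forall>n\<ge>no. norm (X n - l) < e" by blast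
  qed
  then show "convergent X" by (auto simp: convergent_def)
qed

lemma norm_scaleC: "norm (scaleC c \<phi>) = cmod c * norm \<phi>"
proof (rule power2_eq_imp_eq)
  show "(norm (scaleC c \<phi>))\<^sup>2 = (cmod c * norm \<phi>)\<^sup>2"
    by (simp add: norm_sq_ell2 norm_mult power_mult_distrib infsum_cmult_right')
qed auto

lemma scaleC_simps:
  "scaleC c (\<phi> + \<psi>) = scaleC c \<phi> + scaleC c \<psi>" "scaleC (c + d) \<phi> = scaleC c \<phi> + scaleC d \<phi>"
  "scaleC c (scaleC d \<phi>) = scaleC (c * d) \<phi>" "scaleC 1 \<phi> = \<phi>" "scaleC 0 \<phi> = 0" "scaleC c 0 = 0"
  "scaleC c (\<phi> - \<psi>) = scaleC c \<phi> - scaleC c \<psi>" "scaleC (of_real x) \<phi> = x *\<^sub>R \<phi>"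
  by (auto intro!: ell2_eqI simp: algebra_simps)

lemma bounded_linear_scaleC: "bounded_linear (scaleC c)"
  by (rule bounded_linear_intro[of _ "cmod c"])
     (auto intro!: ell2_eqI simp: algebra_simps norm_scaleC)

lemma inner_scaleC: "inner (scaleC c \<phi>) \<psi> = inner \<phi> (scaleC (cnj c) \<psi>)"
  unfolding inner_ell2_def by (intro infsum_cong) (simp add: algebra_simps)

lift_definition unit_vec :: "'v \<Rightarrow> 'v ell2" is "\<lambda>x y. if y = x then 1 else 0"
proof -
  fix v :: 'v
  have "(\<lambda>x. (cmod (if x = v then 1 else 0))\<^sup>2) summable_on {v}" by simp
  then show "(\<lambda>x. (cmod (if x = v then 1 else 0))\<^sup>2) summable_on UNIV"
    by (rule summable_on_cong_neutral[THEN iffD1, rotated 3]) auto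
qed

lemma coord_unit_vec: "coord (unit_vec x) y = (if y = x then 1 else 0)"
  by (simp add: unit_vec.rep_eq)

lemma inner_unit_vec: "inner (scaleC c (unit_vec x)) \<phi> = Re (cnj c * coord \<phi> x)"
proof -
  have "inner (scaleC c (unit_vec x)) \<phi> = (\<Sum>\<^sub>\<infinity>y\<in>{x}. Re (cnj c * coord \<phi> x))"
    unfolding inner_ell2_def by (rule infsum_cong_neutral) (auto simp: coord_unit_vec)
  then show ?thesis by simp
qed

definition restrict_ell2 :: "'v set \<Rightarrow> 'v ell2 \<Rightarrow> 'v ell2" where
  "restrict_ell2 F \<phi> = (\<Sum>x\<in>F. scaleC (coord \<phi> x) (unit_vec x))"

lemma coord_restrict_ell2:
  "finite F \<Longrightarrow> coord (restrict_ell2 F \<phi>) y = (if y \<in> F then coord \<phi> y else 0)"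
  by (auto simp: restrict_ell2_def coord_unit_vec if_distrib[of "(*) _"] cong: if_cong)

lemma finite_support_dense:
  assumes "e > 0"
  obtains F where "finite F" "norm (\<phi> - restrict_ell2 F \<phi>) < e"
proof -
  define f where "f x = (cmod (coord \<phi> x))\<^sup>2" for x
  have s: "f summable_on UNIV" unfolding f_def by (rule summable_cmod_sq)
  then have "(f has_sum infsum f UNIV) UNIV" by (rule has_sum_infsum)
  then have "\<forall>\<^sub>F F in finite_subsets_at_top UNIV. dist (sum f F) (infsum f UNIV) < e\<^sup>2"
    unfolding has_sum_def using assms by (intro tendstoD) auto
  then obtain F where "finite F" "\<forall>Y. finite Y \<and> F \<subseteq> Y \<and> Y \<subseteq> UNIV \<longrightarrow> dist (sum f Y) (infsum f UNIV) < e\<^sup>2"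
    unfolding eventually_finite_subsets_at_top by blast
  then have F: "finite F" "dist (sum f F) (infsum f UNIV) < e\<^sup>2" by auto
  have "(norm (\<phi> - restrict_ell2 F \<phi>))\<^sup>2 = (\<Sum>\<^sub>\<infinity>x\<in>UNIV - F. f x)"
    unfolding norm_sq_ell2 using F(1) by (intro infsum_cong_neutral) (auto simp: coord_restrict_ell2 f_def)
  also have "\<dots> = infsum f UNIV - sum f F"
    using F(1) s by (subst infsum_Diff) auto
  also have "\<dots> < e\<^sup>2" using F(2) by (simp add: dist_real_def)
  finally show ?thesis using that F(1) assms by (meson less_imp_le power2_less_imp_less)
qed

text \<open>
  The approximation can be made as fast as desired.
\<close>

lemma finite_support_approximation:
  assumes e: "\<And>n. e n > 0" "e \<longlonglongrightarrow> 0"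
  obtains F where "\<And>n. finite (F n)" "\<And>n. norm (\<phi> - restrict_ell2 (F n) \<phi>) < e n"
    "(\<lambda>n. restrict_ell2 (F n) \<phi>) \<longlonglongrightarrow> \<phi>"
proof -
  have "\<exists>F. finite F \<and> norm (\<phi> - restrict_ell2 F \<phi>) < e n" for n
    using finite_support_dense[OF e(1)[of n], of \<phi>] by blast
  then obtain F where F: "\<And>n. finite (F n)" "\<And>n. norm (\<phi> - restrict_ell2 (F n) \<phi>) < e n" by metis
  have "(\<lambda>n. restrict_ell2 (F n) \<phi> - \<phi>) \<longlonglongrightarrow> 0"
    by (rule Lim_null_comparison[OF _ e(2)])
       (intro always_eventually allI, simp add: norm_minus_commute less_imp_le F)
  then have "(\<lambda>n. restrict_ell2 (F n) \<phi>) \<longlonglongrightarrow> \<phi>" by (rule Lim_null[THEN iffD2])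
  with F show ?thesis using that by blast
qed

text \<open>
  Matrices with at most \<open>m\<close> nonzero entries in each row and column. The entries at the neighbours \<open>N x\<close> of
  \<open>x\<close> define a bounded symmetric operator \<open>kop\<close> by the Schur test.
\<close>

locale hermitian_kernel =
  fixes N :: "'v \<Rightarrow> 'v set" and K :: "'v \<Rightarrow> 'v \<Rightarrow> complex" and m :: nat and \<kappa> :: real
  assumes N_sym: "y \<in> N x \<Longrightarrow> x \<in> N y" and N_finite: "finite (N x)" and N_card: "card (N x) \<le> m"
    and K_bound: "cmod (K x y) \<le> \<kappa>" and K_hermitian: "K x y = cnj (K y x)"
begin

lemma kernel_bound:
  assumes "finite F"
  shows "(\<Sum>x\<in>F. (cmod (\<Sum>y\<in>N x. K x y * coord \<phi> y))\<^sup>2) \<le> (real m * \<kappa> * norm \<phi>)\<^sup>2"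
proof -
  have "(cmod (\<Sum>y\<in>N x. K x y * coord \<phi> y))\<^sup>2 \<le> real m * \<kappa>\<^sup>2 * (\<Sum>y\<in>N x. (cmod (coord \<phi> y))\<^sup>2)" for x
  proof -
    have "cmod (\<Sum>y\<in>N x. K x y * coord \<phi> y) \<le> (\<Sum>y\<in>N x. \<kappa> * cmod (coord \<phi> y))"
      by (intro sum_norm_le) (auto simp: norm_mult intro!: mult_right_mono K_bound)
    then have "(cmod (\<Sum>y\<in>N x. K x y * coord \<phi> y))\<^sup>2 \<le> (\<Sum>y\<in>N x. \<kappa> * cmod (coord \<phi> y))\<^sup>2"
      by (intro power_mono) auto
    also have "\<dots> \<le> (\<Sum>y\<in>N x. \<kappa>\<^sup>2) * (\<Sum>y\<in>N x. (cmod (coord \<phi> y))\<^sup>2)" by (rule Cauchy_Schwarz_ineq_sum)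
    also have "\<dots> \<le> (real m * \<kappa>\<^sup>2) * (\<Sum>y\<in>N x. (cmod (coord \<phi> y))\<^sup>2)"
      using N_card by (intro mult_right_mono sum_nonneg) (auto intro!: mult_right_mono)
    finally show ?thesis .
  qed
  then have "(\<Sum>x\<in>F. (cmod (\<Sum>y\<in>N x. K x y * coord \<phi> y))\<^sup>2) \<le>
      (\<Sum>x\<in>F. real m * \<kappa>\<^sup>2 * (\<Sum>y\<in>N x. (cmod (coord \<phi> y))\<^sup>2))" by (rule sum_mono)
  also have "\<dots> = real m * \<kappa>\<^sup>2 * (\<Sum>x\<in>F. \<Sum>y\<in>N x. (cmod (coord \<phi> y))\<^sup>2)" by (simp add: sum_distrib_left)
  also have "\<dots> \<le> real m * \<kappa>\<^sup>2 * (real m * (norm \<phi>)\<^sup>2)"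
  proof (intro mult_left_mono)
    define G where "G = (\<Union>x\<in>F. N x)"
    have G: "finite G" using assms N_finite by (simp add: G_def)
    have "(\<Sum>x\<in>F. \<Sum>y\<in>N x. (cmod (coord \<phi> y))\<^sup>2) = (\<Sum>x\<in>F. \<Sum>y\<in>{y\<in>G. y \<in> N x}. (cmod (coord \<phi> y))\<^sup>2)"
      by (intro sum.cong) (auto simp: G_def)
    also have "\<dots> = (\<Sum>y\<in>G. \<Sum>x\<in>{x\<in>F. y \<in> N x}. (cmod (coord \<phi> y))\<^sup>2)"
      by (rule sum.swap_restrict[OF assms G])
    also have "\<dots> \<le> (\<Sum>y\<in>G. real m * (cmod (coord \<phi> y))\<^sup>2)"
    proof (intro sum_mono)
      fix y
      have "card {x\<in>F. y \<in> N x} \<le> card (N y)" by (intro card_mono N_finite) (auto intro: N_sym)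
      then have "real (card {x\<in>F. y \<in> N x}) \<le> real m" using N_card[of y] by simp
      then show "(\<Sum>x\<in>{x\<in>F. y \<in> N x}. (cmod (coord \<phi> y))\<^sup>2) \<le> real m * (cmod (coord \<phi> y))\<^sup>2"
        by (auto intro: mult_right_mono)
    qed
    also have "\<dots> \<le> real m * (norm \<phi>)\<^sup>2"
      unfolding sum_distrib_left[symmetric] by (intro mult_left_mono sum_le_norm_sq G) auto
    finally show "(\<Sum>x\<in>F. \<Sum>y\<in>N x. (cmod (coord \<phi> y))\<^sup>2) \<le> real m * (norm \<phi>)\<^sup>2" .
  qed auto
  finally show ?thesis by (simp add: power2_eq_square mult_ac)
qed

definition kop :: "'v ell2 \<Rightarrow> 'v ell2" where
  "kop \<phi> = Abs_ell2 (\<lambda>x. \<Sum>y\<in>N x. K x y * coord \<phi> y)"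

lemma coord_kop: "coord (kop \<phi>) x = (\<Sum>y\<in>N x. K x y * coord \<phi> y)"
  and norm_kop_le: "norm (kop \<phi>) \<le> real m * \<kappa> * norm \<phi>"
proof -
  obtain \<psi> where \<psi>: "coord \<psi> = (\<lambda>x. \<Sum>y\<in>N x. K x y * coord \<phi> y)" "(norm \<psi>)\<^sup>2 \<le> (real m * \<kappa> * norm \<phi>)\<^sup>2"
    using ell2_of_bounded_sums[OF kernel_bound] by blast
  have "kop \<phi> = \<psi>" unfolding kop_def \<psi>(1)[symmetric] by (rule coord_inverse)
  then show "coord (kop \<phi>) x = (\<Sum>y\<in>N x. K x y * coord \<phi> y)" using \<psi> by simp
  have "\<kappa> \<ge> 0" using order.trans[OF norm_ge_zero K_bound] .
  then show "norm (kop \<phi>) \<le> real m * \<kappa> * norm \<phi>"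
    using \<psi>(2) \<open>kop \<phi> = \<psi>\<close> by (auto intro: power2_le_imp_le)
qed

lemma kop_scaleC: "kop (scaleC c \<phi>) = scaleC c (kop \<phi>)"
  by (rule ell2_eqI) (simp add: coord_kop sum_distrib_left mult_ac)

lemma bounded_linear_kop: "bounded_linear kop"
proof (rule bounded_linear_intro[of _ "real m * \<kappa>"])
  show "kop (\<phi> + \<psi>) = kop \<phi> + kop \<psi>" for \<phi> \<psi>
    by (rule ell2_eqI) (simp add: coord_kop distrib_left sum.distrib)
  show "kop (c *\<^sub>R \<phi>) = c *\<^sub>R kop \<phi>" for c \<phi>
    using kop_scaleC[of "of_real c" \<phi>] by (simp add: scaleC_simps)
  show "norm (kop \<phi>) \<le> norm \<phi> * (real m * \<kappa>)" for \<phi>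
    using norm_kop_le[of \<phi>] by (simp add: mult.commute)
qed

text \<open>
  Checked for multiples of unit vectors, where all sums are finite, and extended by continuity.
\<close>

lemma kop_symmetric: "inner (kop \<phi>) \<psi> = inner \<phi> (kop \<psi>)"
proof -
  interpret kop: bounded_linear kop by (rule bounded_linear_kop)
  have unit: "inner (kop (scaleC c (unit_vec x))) \<psi> = inner (scaleC c (unit_vec x)) (kop \<psi>)" for c x
  proof -
    have "kop (scaleC c (unit_vec x)) = (\<Sum>y\<in>N x. scaleC (c * K y x) (unit_vec y))"
    proof (rule ell2_eqI)
      fix y
      have "coord (kop (scaleC c (unit_vec x))) y = (if x \<in> N y then K y x * c else 0)"
        by (simp add: coord_kop coord_unit_vec if_distrib sum.delta N_finite cong: if_cong)
      also have "\<dots> = (\<Sum>y'\<in>N x. if y = y' then c * K y' x else 0)"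
        using N_sym[of x y] N_sym[of y x] by (auto simp: N_finite)
      finally show "coord (kop (scaleC c (unit_vec x))) y = coord (\<Sum>y\<in>N x. scaleC (c * K y x) (unit_vec y)) y"
        by (simp add: coord_unit_vec if_distrib cong: if_cong)
    qed
    then have "inner (kop (scaleC c (unit_vec x))) \<psi> = (\<Sum>y\<in>N x. Re (cnj (c * K y x) * coord \<psi> y))"
      by (simp add: inner_sum_left inner_unit_vec)
    also have "\<dots> = Re (cnj c * coord (kop \<psi>) x)"
      unfolding coord_kop sum_distrib_left Re_sum
      by (intro sum.cong refl) (subst (2) K_hermitian, simp add: mult.assoc)
    finally show ?thesis by (simp add: inner_unit_vec)
  qed
  have fin: "inner (kop (restrict_ell2 F \<phi>)) \<psi> = inner (restrict_ell2 F \<phi>) (kop \<psi>)" for F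
    unfolding restrict_ell2_def kop.sum inner_sum_left by (simp add: unit)
  have pos: "inverse (real (Suc n)) > 0" for n by simp
  obtain F where lim: "(\<lambda>n. restrict_ell2 (F n) \<phi>) \<longlonglongrightarrow> \<phi>"
    by (rule finite_support_approximation[OF pos LIMSEQ_inverse_real_of_nat, of \<phi>]) (rule that)
  have "(\<lambda>n. inner (kop (restrict_ell2 (F n) \<phi>)) \<psi>) \<longlonglongrightarrow> inner (kop \<phi>) \<psi>"
    by (intro tendsto_intros kop.tendsto lim)
  moreover have "(\<lambda>n. inner (kop (restrict_ell2 (F n) \<phi>)) \<psi>) \<longlonglongrightarrow> inner \<phi> (kop \<psi>)"
    unfolding fin by (intro tendsto_intros lim)
  ultimately show ?thesis by (rule LIMSEQ_unique)
qed

end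

section \<open>Resolvents of bounded self-adjoint operators\<close>

text \<open>
  The complex inner product, conjugate linear in the first argument, recovered from its real part.
\<close>

definition cip :: "'v ell2 \<Rightarrow> 'v ell2 \<Rightarrow> complex" where
  "cip \<phi> \<psi> = Complex (inner \<phi> \<psi>) (inner (scaleC \<i> \<phi>) \<psi>)"

lemma Re_cip [simp]: "Re (cip \<phi> \<psi>) = inner \<phi> \<psi>" and Im_cip: "Im (cip \<phi> \<psi>) = inner (scaleC \<i> \<phi>) \<psi>"
  by (simp_all add: cip_def)

lemma inner_scaleC_right: "inner \<phi> (scaleC c \<psi>) = Re c * inner \<phi> \<psi> - Im c * inner (scaleC \<i> \<phi>) \<psi>"
proof -
  have "scaleC c \<psi> = Re c *\<^sub>R \<psi> + Im c *\<^sub>R scaleC \<i> \<psi>"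
    by (rule ell2_eqI) (simp add: complex_eq_iff)
  moreover have "inner \<phi> (scaleC \<i> \<psi>) = - inner (scaleC \<i> \<phi>) \<psi>"
  proof -
    have "inner (scaleC \<i> \<phi>) \<psi> = inner \<phi> (scaleC (- \<i>) \<psi>)" by (simp add: inner_scaleC)
    also have "scaleC (- \<i>) \<psi> = - scaleC \<i> \<psi>" by (rule ell2_eqI) simp
    finally show ?thesis by simp
  qed
  ultimately show ?thesis by (simp add: inner_add_right)
qed

lemma cip_add_right: "cip \<phi> (\<psi> + \<xi>) = cip \<phi> \<psi> + cip \<phi> \<xi>"
  by (simp add: complex_eq_iff Im_cip inner_add_right)

lemma cip_scaleC_right: "cip \<phi> (scaleC c \<psi>) = c * cip \<phi> \<psi>"
proof -
  have "scaleC \<i> (scaleC \<i> \<phi>) = - \<phi>" by (rule ell2_eqI) simp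
  then show ?thesis
    by (simp add: complex_eq_iff Im_cip inner_scaleC_right)
qed

lemma cip_0_right [simp]: "cip \<phi> 0 = 0"
  by (simp add: complex_eq_iff Im_cip)

lemma cip_sum_right: "cip \<phi> (\<Sum>i\<in>S. f i) = (\<Sum>i\<in>S. cip \<phi> (f i))"
  by (induction S rule: infinite_finite_induct) (auto simp: cip_add_right)

lemma cmod_cip_le: "cmod (cip \<phi> \<psi>) \<le> 2 * norm \<phi> * norm \<psi>"
proof -
  have "cmod (cip \<phi> \<psi>) \<le> \<bar>inner \<phi> \<psi>\<bar> + \<bar>inner (scaleC \<i> \<phi>) \<psi>\<bar>"
    using cmod_le[of "cip \<phi> \<psi>"] by (simp add: Im_cip)
  also have "\<dots> \<le> norm \<phi> * norm \<psi> + norm (scaleC \<i> \<phi>) * norm \<psi>"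
    by (intro add_mono Cauchy_Schwarz_ineq2)
  finally show ?thesis by (simp add: norm_scaleC)
qed

text \<open>
  An operator that is linear over the reals and commutes with all \<open>scaleC c\<close> is complex linear, and symmetry for the
  real part of the inner product then implies symmetry for the complex one.
\<close>

locale selfadjoint =
  fixes T :: "'v ell2 \<Rightarrow> 'v ell2"
  assumes bounded_linear_T: "bounded_linear T"
    and T_symmetric: "inner (T \<phi>) \<psi> = inner \<phi> (T \<psi>)"
    and T_scaleC: "T (scaleC c \<phi>) = scaleC c (T \<phi>)"
begin

sublocale T: bounded_linear T by (rule bounded_linear_T)

definition shift :: "complex \<Rightarrow> 'v ell2 \<Rightarrow> 'v ell2" where
  "shift z \<phi> = T \<phi> - scaleC z \<phi>"

lemma bounded_linear_shift: "bounded_linear (shift z)"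
  unfolding shift_def by (intro bounded_linear_sub bounded_linear_T bounded_linear_scaleC)

sublocale shift: bounded_linear "shift z" by (rule bounded_linear_shift)

lemma shift_scaleC: "shift z (scaleC c \<phi>) = scaleC c (shift z \<phi>)"
  by (rule ell2_eqI) (simp add: shift_def T_scaleC algebra_simps)

lemma inner_i_T: "inner (scaleC \<i> \<phi>) (T \<phi>) = 0"
proof -
  have "inner (scaleC \<i> \<phi>) (T \<phi>) = inner (scaleC \<i> (T \<phi>)) \<phi>"
    using T_symmetric[of "scaleC \<i> \<phi>" \<phi>] by (simp add: T_scaleC)
  also have "\<dots> = - inner (T \<phi>) (scaleC \<i> \<phi>)"
    using inner_scaleC_right[of "T \<phi>" \<i> \<phi>] by simp
  finally show ?thesis by (simp add: inner_commute)
qed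

lemma Im_shift_form: "inner (scaleC \<i> \<phi>) (shift z \<phi>) = - Im z * (norm \<phi>)\<^sup>2"
proof -
  have "scaleC \<i> (scaleC \<i> \<phi>) = - \<phi>" by (rule ell2_eqI) simp
  moreover have "inner (scaleC \<i> \<phi>) \<phi> = 0"
    using inner_scaleC_right[of \<phi> \<i> \<phi>] by (simp add: inner_commute)
  ultimately show ?thesis
    unfolding shift_def inner_diff_right inner_i_T inner_scaleC_right
    by (simp add: power2_norm_eq_inner)
qed

lemma norm_shift_ge: "\<bar>Im z\<bar> * norm \<phi> \<le> norm (shift z \<phi>)"
proof (cases "\<phi> = 0")
  case False
  have "\<bar>Im z\<bar> * (norm \<phi>)\<^sup>2 = \<bar>inner (scaleC \<i> \<phi>) (shift z \<phi>)\<bar>"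
    by (simp add: Im_shift_form abs_mult)
  also have "\<dots> \<le> norm (scaleC \<i> \<phi>) * norm (shift z \<phi>)" by (rule Cauchy_Schwarz_ineq2)
  finally have "norm \<phi> * (\<bar>Im z\<bar> * norm \<phi>) \<le> norm \<phi> * norm (shift z \<phi>)"
    by (simp add: norm_scaleC power2_eq_square algebra_simps)
  then show ?thesis using False by simp
qed simp

text \<open>
  After multiplication by \<open>\<plusminus>\<i>\<close> the operator \<open>T - z\<close> is coercive, because \<open>\<langle>\<phi>, T \<phi>\<rangle>\<close> is real.
\<close>

lemma shift_surj:
  assumes "Im z \<noteq> 0"
  shows "\<exists>\<phi>. shift z \<phi> = \<psi>"
proof -
  \<comment> \<open>the sign makes \<open>Re \<langle>\<phi>, c (T - z) \<phi>\<rangle>\<close> positive\<close>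
  define c where "c = (if Im z > 0 then \<i> else - \<i>)"
  define B where "B \<phi> = scaleC c (shift z \<phi>)" for \<phi>
  have "bounded_linear B" unfolding B_def
    by (rule bounded_linear_compose[OF bounded_linear_scaleC bounded_linear_shift])
  moreover have "inner \<phi> (B \<phi>) \<ge> \<bar>Im z\<bar> * (norm \<phi>)\<^sup>2" for \<phi>
    unfolding B_def inner_scaleC_right Im_shift_form using assms by (auto simp: c_def)
  ultimately obtain \<phi> where "B \<phi> = scaleC c \<psi>"
    using coercive_surjective[of B "\<bar>Im z\<bar>"] assms by auto
  then have "scaleC (inverse c) (scaleC c (shift z \<phi>)) = scaleC (inverse c) (scaleC c \<psi>)"
    by (simp add: B_def)
  moreover have "c \<noteq> 0" by (auto simp: c_def)
  ultimately have "shift z \<phi> = \<psi>" by (simp add: scaleC_simps)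
  then show ?thesis by blast
qed

text \<open>
  The square of \<open>T - E\<close> is coercive.
\<close>

lemma shift_surj_real:
  assumes "d > 0" and d: "\<And>\<phi>. d * norm \<phi> \<le> norm (shift (of_real E) \<phi>)"
  shows "\<exists>\<phi>. shift (of_real E) \<phi> = \<psi>"
proof -
  have sym: "inner (shift (of_real E) \<phi>) \<psi> = inner \<phi> (shift (of_real E) \<psi>)" for \<phi> \<psi>
    by (simp add: shift_def scaleC_simps inner_diff_left inner_diff_right T_symmetric)
  have "bounded_linear (\<lambda>\<phi>. shift (of_real E) (shift (of_real E) \<phi>))"
    by (rule bounded_linear_compose[OF bounded_linear_shift bounded_linear_shift])
  moreover have "inner \<phi> (shift (of_real E) (shift (of_real E) \<phi>)) \<ge> d\<^sup>2 * (norm \<phi>)\<^sup>2" for \<phi>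
    using power_mono[OF d[of \<phi>], of 2] \<open>d > 0\<close>
    by (simp add: sym[symmetric] power_mult_distrib power2_norm_eq_inner)
  ultimately obtain \<phi> where "shift (of_real E) (shift (of_real E) \<phi>) = \<psi>"
    using coercive_surjective[of "\<lambda>\<phi>. shift (of_real E) (shift (of_real E) \<phi>)" "d\<^sup>2"] \<open>d > 0\<close> by auto
  then show ?thesis by blast
qed

definition R :: "complex \<Rightarrow> 'v ell2 \<Rightarrow> 'v ell2" where
  "R z \<psi> = (SOME \<phi>. shift z \<phi> = \<psi>)"

lemma shift_R: "Im z \<noteq> 0 \<Longrightarrow> shift z (R z \<psi>) = \<psi>"
  unfolding R_def by (rule someI_ex) (rule shift_surj)

lemma shift_inj:
  assumes "Im z \<noteq> 0" "shift z \<phi> = shift z \<psi>"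
  shows "\<phi> = \<psi>"
proof -
  have "\<bar>Im z\<bar> * norm (\<phi> - \<psi>) \<le> 0" using norm_shift_ge[of z "\<phi> - \<psi>"] assms by (simp add: shift.diff)
  then show ?thesis using assms by (simp add: mult_le_0_iff)
qed

lemma R_eqI: "Im z \<noteq> 0 \<Longrightarrow> shift z \<phi> = \<psi> \<Longrightarrow> R z \<psi> = \<phi>"
  using shift_inj shift_R by metis

lemma R_add: "Im z \<noteq> 0 \<Longrightarrow> R z (\<phi> + \<psi>) = R z \<phi> + R z \<psi>"
  by (rule R_eqI) (simp_all add: shift.add shift_R)

lemma R_diff: "Im z \<noteq> 0 \<Longrightarrow> R z (\<phi> - \<psi>) = R z \<phi> - R z \<psi>"
  by (rule R_eqI) (simp_all add: shift.diff shift_R)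

lemma R_zero: "Im z \<noteq> 0 \<Longrightarrow> R z 0 = 0"
  by (rule R_eqI) (simp_all add: shift.zero)

lemma R_scaleC: "Im z \<noteq> 0 \<Longrightarrow> R z (scaleC c \<phi>) = scaleC c (R z \<phi>)"
  by (rule R_eqI) (simp_all add: shift_scaleC shift_R)

lemma R_sum: "Im z \<noteq> 0 \<Longrightarrow> R z (\<Sum>i\<in>S. f i) = (\<Sum>i\<in>S. R z (f i))"
  by (induction S rule: infinite_finite_induct) (auto simp: R_add R_zero)

lemma Im_cip_R:
  assumes "Im z \<noteq> 0"
  shows "Im (cip \<psi> (R z \<psi>)) = Im z * (norm (R z \<psi>))\<^sup>2"
proof -
  have "Im (cip \<psi> (R z \<psi>)) = inner (scaleC \<i> \<psi>) (R z \<psi>)" by (rule Im_cip)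
  also have "\<dots> = - inner \<psi> (scaleC \<i> (R z \<psi>))"
    using inner_scaleC_right[of \<psi> \<i> "R z \<psi>"] by simp
  also have "\<dots> = - inner (scaleC \<i> (R z \<psi>)) (shift z (R z \<psi>))"
    using shift_R[OF assms, of \<psi>] by (simp add: inner_commute)
  also have "\<dots> = Im z * (norm (R z \<psi>))\<^sup>2" unfolding Im_shift_form by simp
  finally show ?thesis .
qed

text \<open>
  The operator norm bounds the spectrum.
\<close>

definition \<tau> :: real where "\<tau> = onorm T"

lemma norm_T_le: "norm (T \<phi>) \<le> \<tau> * norm \<phi>"
  unfolding \<tau>_def by (rule onorm[OF bounded_linear_T])

lemma \<tau>_nonneg: "\<tau> \<ge> 0"
  unfolding \<tau>_def by (rule onorm_pos_le[OF bounded_linear_T])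

lemma norm_T_power_le: "norm ((T ^^ n) \<phi>) \<le> \<tau> ^ n * norm \<phi>"
proof (induction n)
  case (Suc n)
  have "norm ((T ^^ Suc n) \<phi>) \<le> \<tau> * norm ((T ^^ n) \<phi>)" using norm_T_le by simp
  also have "\<dots> \<le> \<tau> * (\<tau> ^ n * norm \<phi>)" by (intro mult_left_mono Suc \<tau>_nonneg)
  finally show ?case by (simp add: mult_ac)
qed simp

lemma norm_R_far:
  assumes "Im z > 0" "cmod z > \<tau>"
  shows "(cmod z - \<tau>) * norm (R z \<psi>) \<le> norm \<psi>"
proof -
  have "cmod z * norm (R z \<psi>) = norm (T (R z \<psi>) - \<psi>)"
  proof -
    have "T (R z \<psi>) - \<psi> = scaleC z (R z \<psi>)"
      using shift_R[of z \<psi>] assms by (simp add: shift_def algebra_simps)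
    then show ?thesis by (simp add: norm_scaleC)
  qed
  also have "\<dots> \<le> \<tau> * norm (R z \<psi>) + norm \<psi>"
    using norm_triangle_ineq4[of "T (R z \<psi>)" \<psi>] norm_T_le[of "R z \<psi>"] by linarith
  finally show ?thesis by (simp add: algebra_simps)
qed

lemma T_power_symmetric: "inner ((T ^^ n) \<phi>) \<psi> = inner \<phi> ((T ^^ n) \<psi>)"
  by (induction n arbitrary: \<phi> \<psi>) (auto simp: T_symmetric funpow_swap1)

lemma T_power_scaleC: "(T ^^ n) (scaleC c \<phi>) = scaleC c ((T ^^ n) \<phi>)"
  by (induction n) (auto simp: T_scaleC)

lemma T_power_bounded_linear: "bounded_linear (T ^^ n)"
proof (induction n)
  case 0 then show ?case by (simp add: id_def)
next
  case (Suc n) then show ?case using bounded_linear_compose[OF bounded_linear_T Suc] by (simp add: o_def)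
qed

lemma inner_i_T_power: "inner (scaleC \<i> \<phi>) ((T ^^ n) \<phi>) = 0"
proof -
  have "inner (scaleC \<i> \<phi>) ((T ^^ n) \<phi>) = inner (scaleC \<i> ((T ^^ n) \<phi>)) \<phi>"
    using T_power_symmetric[of n "scaleC \<i> \<phi>" \<phi>] by (simp add: T_power_scaleC)
  also have "\<dots> = - inner ((T ^^ n) \<phi>) (scaleC \<i> \<phi>)"
    using inner_scaleC_right[of "(T ^^ n) \<phi>" \<i> \<phi>] by simp
  finally show ?thesis by (simp add: inner_commute)
qed

lemma cip_T_power_real: "cip \<phi> ((T ^^ n) \<phi>) = of_real (inner \<phi> ((T ^^ n) \<phi>))"
  by (simp add: complex_eq_iff Im_cip inner_i_T_power)

text \<open>
  Moving \<open>n\<close> factors \<open>T\<close> into the resolvent changes its matrix elements only by a polynomial in \<open>z\<close> with real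
  coefficients, which is invisible in the imaginary part at real \<open>z\<close>.
\<close>

lemma T_power_R:
  assumes "Im z \<noteq> 0"
  shows "cip \<phi> ((T ^^ n) (R z \<phi>)) =
    z ^ n * cip \<phi> (R z \<phi>) + (\<Sum>i<n. z ^ (n - 1 - i) * of_real (inner \<phi> ((T ^^ i) \<phi>)))"
proof (induction n)
  case (Suc n)
  interpret Tn: bounded_linear "T ^^ n" by (rule T_power_bounded_linear)
  have "T (R z \<phi>) = scaleC z (R z \<phi>) + \<phi>" using shift_R[OF assms, of \<phi>] by (simp add: shift_def algebra_simps)
  then have "(T ^^ Suc n) (R z \<phi>) = scaleC z ((T ^^ n) (R z \<phi>)) + (T ^^ n) \<phi>"
    by (simp only: funpow_Suc_right o_apply Tn.add T_power_scaleC)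
  then have "cip \<phi> ((T ^^ Suc n) (R z \<phi>)) = z * cip \<phi> ((T ^^ n) (R z \<phi>)) + of_real (inner \<phi> ((T ^^ n) \<phi>))"
    by (simp only: cip_add_right cip_scaleC_right cip_T_power_real)
  also have "z * cip \<phi> ((T ^^ n) (R z \<phi>)) =
      z ^ Suc n * cip \<phi> (R z \<phi>) + (\<Sum>i<n. z ^ (Suc n - 1 - i) * of_real (inner \<phi> ((T ^^ i) \<phi>)))"
    unfolding Suc distrib_left sum_distrib_left
    by (intro arg_cong2[where f = "(+)"] sum.cong) (auto simp: mult.assoc Suc_diff_Suc simp flip: power_Suc)
  finally show ?case by simp
qed simp

end

context selfadjoint
begin

text \<open>
  For a self-adjoint operator these are the real points of the resolvent set.
\<close>

definition bounded_below :: "real \<Rightarrow> bool" where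
  "bounded_below E \<longleftrightarrow> (\<exists>c>0. \<forall>\<phi>. c * norm \<phi> \<le> norm (shift (of_real E) \<phi>))"

lemma bounded_below_open: "open {E. bounded_below E}"
  unfolding open_dist
proof (intro ballI)
  fix E assume "E \<in> {E. bounded_below E}"
  then obtain c where c: "c > 0" "\<And>\<phi>. c * norm \<phi> \<le> norm (shift (of_real E) \<phi>)" by (auto simp: bounded_below_def)
  have "bounded_below E'" if E': "dist E' E < c / 2" for E'
    unfolding bounded_below_def
  proof (intro exI[of _ "c / 2"] conjI allI)
    fix \<phi>
    have "shift (of_real E) \<phi> = shift (of_real E') \<phi> + (E' - E) *\<^sub>R \<phi>"
      by (simp add: shift_def scaleC_simps algebra_simps)
    then have "c * norm \<phi> \<le> norm (shift (of_real E') \<phi>) + \<bar>E' - E\<bar> * norm \<phi>"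
      using c(2)[of \<phi>] norm_triangle_ineq[of "shift (of_real E') \<phi>" "(E' - E) *\<^sub>R \<phi>"] by simp
    moreover have "\<bar>E' - E\<bar> * norm \<phi> \<le> c / 2 * norm \<phi>"
      using E' by (intro mult_right_mono) (auto simp: dist_real_def)
    ultimately show "c / 2 * norm \<phi> \<le> norm (shift (of_real E') \<phi>)" by simp
  qed (use c in simp)
  then show "\<exists>e>0. \<forall>y. dist y E < e \<longrightarrow> y \<in> {E. bounded_below E}"
    using c(1) by (intro exI[of _ "c / 2"]) auto
qed

lemma bounded_below_outside: "\<bar>E\<bar> > \<tau> \<Longrightarrow> bounded_below E"
  unfolding bounded_below_def
proof (intro exI[of _ "\<bar>E\<bar> - \<tau>"] conjI allI)
  show "(\<bar>E\<bar> - \<tau>) * norm \<psi> \<le> norm (shift (of_real E) \<psi>)" for \<psi>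
    using norm_triangle_ineq2[of "scaleC (of_real E) \<psi>" "T \<psi>"] norm_T_le[of \<psi>]
    by (simp add: shift_def norm_scaleC norm_minus_commute algebra_simps)
qed simp

end

section \<open>The Green function of a label invariant operator\<close>

text \<open>
  Expressions in the vector of Green functions, for which limits, holomorphy and bounds are inherited from
  that vector.
\<close>

inductive polynomial_expr :: "(('a \<Rightarrow> complex) \<Rightarrow> complex) \<Rightarrow> bool" where
  const: "polynomial_expr (\<lambda>g. c)"
| var: "polynomial_expr (\<lambda>g. g k)"
| add: "polynomial_expr p \<Longrightarrow> polynomial_expr q \<Longrightarrow> polynomial_expr (\<lambda>g. p g + q g)"
| mult: "polynomial_expr p \<Longrightarrow> polynomial_expr q \<Longrightarrow> polynomial_expr (\<lambda>g. p g * q g)"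

lemma polynomial_expr_diff:
  assumes "polynomial_expr p" "polynomial_expr q"
  shows "polynomial_expr (\<lambda>g. p g - q g)"
proof -
  have "polynomial_expr (\<lambda>g. p g + (\<lambda>_. - 1) g * q g)"
    by (intro polynomial_expr.add polynomial_expr.mult polynomial_expr.const assms)
  then show ?thesis by simp
qed

lemma polynomial_expr_tendsto:
  assumes "polynomial_expr p" "\<And>k. ((\<lambda>z. G z k) \<longlongrightarrow> g k) F"
  shows "((\<lambda>z. p (G z)) \<longlongrightarrow> p g) F"
  using assms by (induction p rule: polynomial_expr.induct) (auto intro!: tendsto_intros)

lemma polynomial_expr_holomorphic:
  assumes "polynomial_expr p" "\<And>k. (\<lambda>z. G z k) holomorphic_on S"
  shows "(\<lambda>z. p (G z)) holomorphic_on S"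
  using assms by (induction p rule: polynomial_expr.induct) (auto intro!: holomorphic_intros)

lemma polynomial_expr_bounded:
  assumes "polynomial_expr p"
  shows "\<exists>B. \<forall>g. (\<forall>k. cmod (g k) \<le> C) \<longrightarrow> cmod (p g) \<le> B"
  using assms
proof (induction p rule: polynomial_expr.induct)
  case (add p q)
  then obtain B B' where "\<forall>g. (\<forall>k. cmod (g k) \<le> C) \<longrightarrow> cmod (p g) \<le> B"
    "\<forall>g. (\<forall>k. cmod (g k) \<le> C) \<longrightarrow> cmod (q g) \<le> B'" by blast
  then show ?case by (intro exI[of _ "B + B'"]) (auto intro: norm_triangle_le add_mono)
next
  case (mult p q)
  then obtain B B' where "\<forall>g. (\<forall>k. cmod (g k) \<le> C) \<longrightarrow> cmod (p g) \<le> B"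
    "\<forall>g. (\<forall>k. cmod (g k) \<le> C) \<longrightarrow> cmod (q g) \<le> B'" by blast
  moreover from this have "B \<ge> 0" if "\<forall>k. cmod (g k) \<le> C" for g
    using that norm_ge_zero order.trans by blast
  ultimately show ?case
    by (intro exI[of _ "B * B'"]) (auto simp: norm_mult intro!: mult_mono)
qed auto

text \<open>
  The operator after removal of the weight, with hopping terms \<open>s\<close>, potential \<open>w\<close> and \<open>\<beta> k l = |s x y|\<^sup>2\<close> for the
  edges from label \<open>k\<close> to label \<open>l\<close>. For pairs of labels without such an edge \<open>\<beta>\<close> is an arbitrary positive number;
  in this way \<open>A k k > 0\<close> holds at every label.
\<close>

locale tree_operator = tree_graph adj r
  for adj :: "'v \<Rightarrow> 'v \<Rightarrow> bool" and r :: 'v +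
  fixes a :: "'v \<Rightarrow> 'a::finite" and M :: "'a \<Rightarrow> 'a \<Rightarrow> nat" and \<beta> :: "'a \<Rightarrow> 'a \<Rightarrow> real"
    and w :: "'a \<Rightarrow> real" and s :: "'v \<Rightarrow> 'v \<Rightarrow> complex"
  assumes children_finite: "finite (children x)"
    and children_card: "card {y \<in> children x. a y = l} = M (a x) l"
    and s_hermitian: "s x y = cnj (s y x)"
    and s_child: "y \<in> children x \<Longrightarrow> (cmod (s x y))\<^sup>2 = \<beta> (a x) (a y)"
    and \<beta>_pos: "\<beta> k l > 0" and M_diag: "M k k \<ge> 1"
begin

definition A :: "'a \<Rightarrow> 'a \<Rightarrow> real" where "A k l = real (M k l) * \<beta> k l"

sublocale recursion A w
proof
  show "A k l \<ge> 0" for k l using \<beta>_pos[of k l] by (simp add: A_def)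
  show "A k k > 0" for k using \<beta>_pos[of k k] M_diag[of k] by (simp add: A_def)
qed

lemma A_pos_iff: "A k l > 0 \<longleftrightarrow> M k l > 0"
  using \<beta>_pos[of k l] by (simp add: A_def zero_less_mult_iff)

lemma sum_children_labels:
  fixes h :: "'a \<Rightarrow> 'b::comm_ring_1"
  shows "(\<Sum>y\<in>children x. h (a y)) = (\<Sum>l\<in>UNIV. of_nat (M (a x) l) * h l)"
proof -
  have "(\<Sum>y\<in>children x. h (a y)) = (\<Sum>l\<in>UNIV. \<Sum>y\<in>{y \<in> children x. a y = l}. h (a y))"
    by (rule sum.group[symmetric]) (auto simp: children_finite)
  also have "\<dots> = (\<Sum>l\<in>UNIV. of_nat (M (a x) l) * h l)"
    by (intro sum.cong refl) (simp add: children_card)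
  finally show ?thesis .
qed

lemma card_children_le: "card (children x) \<le> (\<Sum>k\<in>UNIV. \<Sum>l\<in>UNIV. M k l)"
proof -
  have "int (card (children x)) = int (\<Sum>l\<in>UNIV. M (a x) l)"
    using sum_children_labels[of "\<lambda>_. 1 :: int" x] by simp
  then have "card (children x) = (\<Sum>l\<in>UNIV. M (a x) l)" by linarith
  then show ?thesis using member_le_sum[of "a x" UNIV "\<lambda>k. \<Sum>l\<in>UNIV. M k l"] by simp
qed

lemma cmod_s_le:
  assumes "adj x y"
  shows "cmod (s x y) \<le> (\<Sum>k\<in>UNIV. \<Sum>l\<in>UNIV. sqrt (\<beta> k l))"
proof -
  have le: "sqrt (\<beta> k l) \<le> (\<Sum>k\<in>UNIV. \<Sum>l\<in>UNIV. sqrt (\<beta> k l))" for k l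
  proof -
    have nn: "0 \<le> \<beta> k l" for k l using \<beta>_pos[of k l] by simp
    have "sqrt (\<beta> k l) \<le> (\<Sum>l\<in>UNIV. sqrt (\<beta> k l))" by (rule member_le_sum) (auto simp: nn)
    also have "\<dots> \<le> (\<Sum>k\<in>UNIV. \<Sum>l\<in>UNIV. sqrt (\<beta> k l))"
      by (rule member_le_sum[of k UNIV "\<lambda>k. \<Sum>l\<in>UNIV. sqrt (\<beta> k l)"]) (auto intro!: sum_nonneg simp: nn)
    finally show ?thesis .
  qed
  have child: "cmod (s x y) = sqrt (\<beta> (a x) (a y))" if "y \<in> children x" for x y
    using s_child[OF that] by (metis norm_ge_zero real_sqrt_unique)
  have "y \<in> children x \<union> (if x = r then {} else {parent x})"
    using assms unfolding neighbours[symmetric] by simp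
  then consider "y \<in> children x" | "x \<in> children y"
    using children_iff[of x y] by (auto split: if_splits)
  then show ?thesis
  proof cases
    case 2
    have "cmod (s x y) = cmod (s y x)" by (subst s_hermitian) simp
    then show ?thesis using child[OF 2] le by simp
  qed (use child le in simp)
qed

definition kernel :: "'v \<Rightarrow> 'v \<Rightarrow> complex" where
  "kernel x y = (if x = y then of_real (w (a x)) else if adj x y then s x y else 0)"

lemma finite_neighbours: "finite {y. adj x y}"
  unfolding neighbours by (simp add: children_finite)

sublocale hermitian_kernel "\<lambda>x. insert x {y. adj x y}" kernel
  "2 + (\<Sum>k\<in>UNIV. \<Sum>l\<in>UNIV. M k l)" "(\<Sum>k\<in>UNIV. \<bar>w k\<bar>) + (\<Sum>k\<in>UNIV. \<Sum>l\<in>UNIV. sqrt (\<beta> k l))"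
proof
  fix x y
  show "y \<in> insert x {y. adj x y} \<Longrightarrow> x \<in> insert y {x. adj y x}" by (auto dest: adj_sym)
  show "finite (insert x {y. adj x y})" using finite_neighbours by simp
  have "card {y. adj x y} \<le> card (children x) + 1"
    unfolding neighbours using card_insert_le_m1 by (auto simp: card_insert_if children_finite)
  moreover have "card (insert x {y. adj x y}) \<le> Suc (card {y. adj x y})" by (rule card_insert_le_m1) simp_all
  ultimately show "card (insert x {y. adj x y}) \<le> 2 + (\<Sum>k\<in>UNIV. \<Sum>l\<in>UNIV. M k l)"
    using card_children_le[of x] by simp
  have nn: "0 \<le> (\<Sum>k\<in>UNIV. \<Sum>l\<in>UNIV. sqrt (\<beta> k l))"
    by (intro sum_nonneg) (use \<beta>_pos in \<open>auto intro: less_imp_le\<close>)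
  have "\<bar>w (a x)\<bar> \<le> (\<Sum>k\<in>UNIV. \<bar>w k\<bar>)" by (rule member_le_sum) auto
  then show "cmod (kernel x y) \<le> (\<Sum>k\<in>UNIV. \<bar>w k\<bar>) + (\<Sum>k\<in>UNIV. \<Sum>l\<in>UNIV. sqrt (\<beta> k l))"
    using nn cmod_s_le[of x y] by (auto simp: kernel_def)
  show "kernel x y = cnj (kernel y x)"
    using s_hermitian[of x y] by (auto simp: kernel_def dest: adj_sym)
qed

lemma coord_kop_tree:
  "coord (kop \<phi>) x = (\<Sum>c\<in>children x. s x c * coord \<phi> c)
     + (if x = r then 0 else s x (parent x) * coord \<phi> (parent x)) + of_real (w (a x)) * coord \<phi> x"
proof -
  have "coord (kop \<phi>) x = (\<Sum>y\<in>{y. adj x y}. s x y * coord \<phi> y) + of_real (w (a x)) * coord \<phi> x"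
    unfolding coord_kop using finite_neighbours adj_irrefl
    by (subst sum.insert) (auto simp: kernel_def intro!: sum.cong)
  also have "(\<Sum>y\<in>{y. adj x y}. s x y * coord \<phi> y) = (\<Sum>c\<in>children x. s x c * coord \<phi> c)
     + (if x = r then 0 else s x (parent x) * coord \<phi> (parent x))"
  proof (cases "x = r")
    case False
    have "parent x \<notin> children x" using parent[OF False] by (auto simp: children_def)
    then show ?thesis unfolding neighbours using False by (simp add: children_finite)
  qed (simp add: neighbours)
  finally show ?thesis .
qed

text \<open>
  The column at \<open>v\<close> of the Green function of the cone with root \<open>v\<close>, extended by zero, as a function of
  the vector \<open>g\<close> of diagonal Green functions of cones. Each step away from \<open>v\<close> contributes one factor.
\<close>

function branch :: "('a \<Rightarrow> complex) \<Rightarrow> 'v \<Rightarrow> 'v \<Rightarrow> complex" where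
  "branch g v x = (if x = v then g (a v) else if depth x \<le> depth v then 0
     else - g (a x) * s x (parent x) * branch g v (parent x))"
  by auto
termination
proof (relation "Wellfounded.measure (\<lambda>(g, v, x). depth x)")
  fix v x assume "x \<noteq> v" "\<not> depth x \<le> depth v"
  then have "x \<noteq> r" by auto
  then show "((g, v, parent x), (g, v, x)) \<in> Wellfounded.measure (\<lambda>(g, v, x). depth x)" for g
    using parent[of x] by simp
qed simp

declare branch.simps [simp del]

lemma branch_self: "branch g v v = g (a v)"
  by (simp add: branch.simps)

lemma branch_above: "x \<noteq> v \<Longrightarrow> depth x \<le> depth v \<Longrightarrow> branch g v x = 0"
  by (simp add: branch.simps[of g v x])

lemma branch_child:
  assumes "c \<in> children x" "c \<noteq> v"
  shows "branch g v c = - g (a c) * s c x * branch g v x"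
proof (cases "depth c \<le> depth v")
  case True
  have "depth x < depth v" using assms True by (auto simp: children_def)
  then have "branch g v x = 0" by (intro branch_above) auto
  then show ?thesis using branch_above[OF assms(2) True] by simp
next
  case False
  have "parent c = x" using assms(1) by (simp add: children_iff)
  then show ?thesis using False assms(2) by (simp add: branch.simps[of g v c])
qed

text \<open>
  Phases of the hopping terms cancel along an edge that is traversed in both directions.
\<close>

lemma s_times_s: "c \<in> children x \<Longrightarrow> s x c * s c x = of_real (\<beta> (a x) (a c))"
  using s_child[of c x] s_hermitian[of c x]
  by (metis complex_norm_square)

text \<open>
  At the vertices of the cone the equation is the recursion for \<open>\<Gamma>\<close>. The parent of \<open>v\<close> does not belong to the cone
  but feels the value at \<open>v\<close>.
\<close>

lemma branch_equation:
  assumes z: "Im z > 0"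
  shows "(\<Sum>c\<in>children x. s x c * branch (\<Gamma> z) v c)
     + (if x = r then 0 else s x (parent x) * branch (\<Gamma> z) v (parent x))
     + of_real (w (a x)) * branch (\<Gamma> z) v x - z * branch (\<Gamma> z) v x =
    (if x = v then 1 else 0) + (if v \<noteq> r \<and> x = parent v then s x v * \<Gamma> z (a v) else 0)"
proof (cases "v \<in> children x")
  case True
  have v: "v \<noteq> r" "parent v = x" using True by (auto simp: children_iff)
  have d: "depth v = Suc (depth x)" "x \<noteq> v" using True by (auto simp: children_def)
  have x0: "branch (\<Gamma> z) v x = 0" using d by (intro branch_above) auto
  have p0: "branch (\<Gamma> z) v (parent x) = 0" if "x \<noteq> r"
    using parent[OF that] d by (intro branch_above) auto
  have "(\<Sum>c\<in>children x. s x c * branch (\<Gamma> z) v c) = (\<Sum>c\<in>children x. if c = v then s x v * \<Gamma> z (a v) else 0)"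
    using branch_child[of _ x v "\<Gamma> z"] x0 by (intro sum.cong) (auto simp: branch_self)
  also have "\<dots> = s x v * \<Gamma> z (a v)" using True by (simp add: children_finite)
  finally show ?thesis using v d x0 p0 by simp
next
  case False
  then have np: "\<not> (v \<noteq> r \<and> x = parent v)" by (auto simp: children_iff)
  have "(\<Sum>c\<in>children x. s x c * branch (\<Gamma> z) v c) =
      (\<Sum>c\<in>children x. - (of_real (\<beta> (a x) (a c)) * \<Gamma> z (a c)) * branch (\<Gamma> z) v x)"
  proof (intro sum.cong refl)
    fix c assume c: "c \<in> children x"
    then have "c \<noteq> v" using False by auto
    then show "s x c * branch (\<Gamma> z) v c = - (of_real (\<beta> (a x) (a c)) * \<Gamma> z (a c)) * branch (\<Gamma> z) v x"
      unfolding branch_child[OF c \<open>c \<noteq> v\<close>] s_times_s[OF c, symmetric] by simp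
  qed
  also have "\<dots> = - (\<Sum>l\<in>UNIV. of_real (A (a x) l) * \<Gamma> z l) * branch (\<Gamma> z) v x"
    unfolding sum_distrib_right[symmetric]
    using sum_children_labels[of "\<lambda>l. of_real (\<beta> (a x) l) * \<Gamma> z l" x]
    by (simp add: A_def sum_negf mult.assoc)
  finally have sum: "(\<Sum>c\<in>children x. s x c * branch (\<Gamma> z) v c) + of_real (w (a x)) * branch (\<Gamma> z) v x
      - z * branch (\<Gamma> z) v x = - denom z (\<Gamma> z) (a x) * branch (\<Gamma> z) v x"
    by (simp add: denom_def algebra_simps)
  have nz: "\<Gamma> z (a x) \<noteq> 0" using Gamma_nonzero z by blast
  have "- denom z (\<Gamma> z) (a x) = 1 / \<Gamma> z (a x)"
    using Gamma_recursion[OF z, of "a x"] nz by (simp add: field_simps)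
  then have sum': "(\<Sum>c\<in>children x. s x c * branch (\<Gamma> z) v c) + of_real (w (a x)) * branch (\<Gamma> z) v x
      - z * branch (\<Gamma> z) v x = branch (\<Gamma> z) v x / \<Gamma> z (a x)" using sum by simp
  have regroup: "b + p + c - d = (b + c - d) + p" for b c d p :: complex by simp
  have "branch (\<Gamma> z) v x / \<Gamma> z (a x) + (if x = r then 0 else s x (parent x) * branch (\<Gamma> z) v (parent x)) =
      (if x = v then 1 else 0)"
  proof (cases "x = v")
    case True
    have "branch (\<Gamma> z) v (parent x) = 0" if "x \<noteq> r"
      using parent[OF that] True by (intro branch_above) auto
    then show ?thesis using True nz by (simp add: branch_self)
  next
    case xv: False
    show ?thesis
    proof (cases "x = r")
      case True
      then show ?thesis using xv branch_above[of x v "\<Gamma> z"] by simp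
    next
      case False
      then have "x \<in> children (parent x)" by (simp add: children_iff)
      then show ?thesis using branch_child[OF _ xv, of "parent x" "\<Gamma> z"] False xv nz by simp
    qed
  qed
  then show ?thesis unfolding regroup sum' using np by auto
qed

definition level :: "nat \<Rightarrow> 'v set" where "level n = {x. depth x = n}"

lemma level_Suc: "level (Suc n) = (\<Union>x\<in>level n. children x)"
proof (intro equalityI subsetI)
  fix y assume "y \<in> level (Suc n)"
  then have "y \<noteq> r" "depth y = Suc n" by (auto simp: level_def)
  then show "y \<in> (\<Union>x\<in>level n. children x)"
    using parent[of y] children_iff[of y "parent y"] by (auto simp: level_def)
qed (auto simp: level_def children_def)

lemma finite_level: "finite (level n)"
proof (induction n)
  case 0
  have "level 0 = {r}" by (auto simp: level_def depth_eq_0_iff)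
  then show ?case by simp
qed (simp add: level_Suc children_finite)

lemma sum_level_Suc: "(\<Sum>y\<in>level (Suc n). h y) = (\<Sum>x\<in>level n. \<Sum>y\<in>children x. h y)"
  unfolding level_Suc
  by (rule sum.UNION_disjoint) (auto simp: finite_level children_finite children_iff)

text \<open>
  Summing the conservation law over the first \<open>k\<close> levels of the cone: the current \<open>Im \<Gamma>\<close> that enters at \<open>v\<close>
  is absorbed there or leaves through level \<open>depth v + k\<close>. As the outflow is nonnegative, this bounds the sum of squares.
\<close>

lemma branch_energy:
  fixes v :: 'v
  assumes z: "Im z > 0"
  defines "f \<equiv> branch (\<Gamma> z) v"
  defines "e \<equiv> \<lambda>x. (cmod (f x))\<^sup>2 * (Im (\<Gamma> z (a x)) / (cmod (\<Gamma> z (a x)))\<^sup>2)"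
  shows "Im z * (\<Sum>i<k. \<Sum>x\<in>level (depth v + i). (cmod (f x))\<^sup>2) + (\<Sum>x\<in>level (depth v + k). e x) = Im (\<Gamma> z (a v))"
proof (induction k)
  case 0
  have "(\<Sum>x\<in>level (depth v). e x) = (\<Sum>x\<in>level (depth v). if x = v then e v else 0)"
    by (intro sum.cong) (auto simp: e_def f_def level_def branch_above)
  also have "\<dots> = e v" by (simp add: finite_level) (simp add: level_def)
  also have "\<dots> = Im (\<Gamma> z (a v))"
    using Gamma_nonzero[OF z, of "a v"] by (simp add: e_def f_def branch_self)
  finally show ?case by simp
next
  case (Suc k)
  have split: "e x = Im z * (cmod (f x))\<^sup>2 + (\<Sum>c\<in>children x. e c)" if x: "x \<in> level (depth v + k)" for x
  proof -
    have "(\<Sum>c\<in>children x. e c) = (\<Sum>c\<in>children x. (cmod (f x))\<^sup>2 * (\<beta> (a x) (a c) * Im (\<Gamma> z (a c))))"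
    proof (intro sum.cong refl)
      fix c assume c: "c \<in> children x"
      have "c \<noteq> v" using c x by (auto simp: children_def level_def)
      have "cmod (s c x) = cmod (s x c)" by (subst s_hermitian) simp
      then have "(cmod (f c))\<^sup>2 = (cmod (\<Gamma> z (a c)))\<^sup>2 * \<beta> (a x) (a c) * (cmod (f x))\<^sup>2"
        unfolding f_def branch_child[OF c \<open>c \<noteq> v\<close>] by (simp add: norm_mult power_mult_distrib s_child[OF c])
      then show "e c = (cmod (f x))\<^sup>2 * (\<beta> (a x) (a c) * Im (\<Gamma> z (a c)))"
        using Gamma_nonzero[OF z, of "a c"] by (simp add: e_def)
    qed
    also have "\<dots> = (cmod (f x))\<^sup>2 * (\<Sum>l\<in>UNIV. A (a x) l * Im (\<Gamma> z l))"
      using sum_children_labels[of "\<lambda>l. \<beta> (a x) l * Im (\<Gamma> z l)" x]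
      by (simp add: sum_distrib_left[symmetric] A_def mult.assoc)
    moreover have "e x = (cmod (f x))\<^sup>2 * (Im z + (\<Sum>l\<in>UNIV. A (a x) l * Im (\<Gamma> z l)))"
      by (simp only: e_def Im_Gamma_conservation[OF z])
    ultimately show ?thesis by (simp add: algebra_simps)
  qed
  have "(\<Sum>x\<in>level (depth v + k). e x) =
      Im z * (\<Sum>x\<in>level (depth v + k). (cmod (f x))\<^sup>2) + (\<Sum>x\<in>level (depth v + Suc k). e x)"
    by (simp add: split sum.distrib sum_distrib_left sum_level_Suc)
  then show ?case using Suc by (simp add: algebra_simps)
qed

lemma branch_in_ell2:
  assumes z: "Im z > 0"
  obtains \<phi> where "coord \<phi> = branch (\<Gamma> z) v"
proof -
  define f where "f = branch (\<Gamma> z) v"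
  have "(\<Sum>x\<in>F. (cmod (f x))\<^sup>2) \<le> Im (\<Gamma> z (a v)) / Im z" if F: "finite F" for F
  proof -
    obtain k where k: "\<And>x. x \<in> F \<Longrightarrow> depth x < k"
      using finite_nat_set_iff_bounded[of "depth ` F"] F by auto
    define L where "L = (\<Union>i\<in>{..<k}. level (depth v + i))"
    have finL: "finite L" by (simp add: L_def finite_level)
    have "(\<Sum>x\<in>F. (cmod (f x))\<^sup>2) = (\<Sum>x\<in>F \<inter> L. (cmod (f x))\<^sup>2)"
    proof (rule sum.mono_neutral_right[OF F])
      show "\<forall>x\<in>F - F \<inter> L. (cmod (f x))\<^sup>2 = 0"
      proof
        fix x assume x: "x \<in> F - F \<inter> L"
        have "\<not> depth v \<le> depth x"
        proof
          assume le: "depth v \<le> depth x"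
          have "depth x - depth v < k" using k[of x] x by auto
          then have "x \<in> L" using le unfolding L_def level_def by (intro UN_I[of "depth x - depth v"]) auto
          then show False using x by simp
        qed
        then show "(cmod (f x))\<^sup>2 = 0" unfolding f_def using branch_above[of x v "\<Gamma> z"] by (cases "x = v") auto
      qed
    qed auto
    also have "\<dots> \<le> (\<Sum>x\<in>L. (cmod (f x))\<^sup>2)" by (intro sum_mono2 finL) auto
    also have "\<dots> = (\<Sum>i<k. \<Sum>x\<in>level (depth v + i). (cmod (f x))\<^sup>2)"
      unfolding L_def by (rule sum.UNION_disjoint) (simp_all add: finite_level, auto simp: level_def)
    also have "\<dots> \<le> Im (\<Gamma> z (a v)) / Im z"
    proof -
      have "0 \<le> (\<Sum>x\<in>level (depth v + k). (cmod (f x))\<^sup>2 * (Im (\<Gamma> z (a x)) / (cmod (\<Gamma> z (a x)))\<^sup>2))"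
        by (intro sum_nonneg mult_nonneg_nonneg divide_nonneg_nonneg less_imp_le[OF Im_Gamma_pos[OF z]]) auto
      then have "Im z * (\<Sum>i<k. \<Sum>x\<in>level (depth v + i). (cmod (f x))\<^sup>2) \<le> Im (\<Gamma> z (a v))"
        using branch_energy[OF z, of v k] unfolding f_def by linarith
      then show ?thesis using z by (simp add: field_simps)
    qed
    finally show ?thesis .
  qed
  then show ?thesis using ell2_of_bounded_sums[of f] that unfolding f_def by blast
qed

text \<open>
  The column at \<open>y\<close> of the Green function of the whole tree. The second term removes the value that
  \<open>branch\<close> causes at the parent of \<open>y\<close>.
\<close>

function green :: "('a \<Rightarrow> complex) \<Rightarrow> 'v \<Rightarrow> 'v \<Rightarrow> complex" where
  "green g y x = branch g y x -
     (if y = r then 0 else s (parent y) y * g (a y) * green g (parent y) x)"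
  by auto
termination
proof (relation "Wellfounded.measure (\<lambda>(g, y, x). depth y)")
  fix y assume "y \<noteq> r"
  then show "((g, parent y, x), (g, y, x)) \<in> Wellfounded.measure (\<lambda>(g, y, x). depth y)" for g x
    using parent[of y] by simp
qed simp

declare green.simps [simp del]

lemma vertex_induct [case_names root child]:
  assumes "P r" "\<And>y. y \<noteq> r \<Longrightarrow> P (parent y) \<Longrightarrow> P y"
  shows "P y"
proof (induction "depth y" arbitrary: y rule: less_induct)
  case less
  then show ?case using assms parent[of y] by (cases "y = r") auto
qed

lemma green_in_ell2:
  assumes z: "Im z > 0"
  shows "\<exists>\<phi>. coord \<phi> = green (\<Gamma> z) y \<and> kop \<phi> - scaleC z \<phi> = unit_vec y"
proof (induction y rule: vertex_induct)
  case root
  obtain \<phi> where \<phi>: "coord \<phi> = branch (\<Gamma> z) r" using branch_in_ell2[OF z] .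
  have "kop \<phi> - scaleC z \<phi> = unit_vec r"
  proof (rule ell2_eqI)
    fix x
    show "coord (kop \<phi> - scaleC z \<phi>) x = coord (unit_vec r) x"
      using branch_equation[OF z, of x r]
      by (cases "x = r") (simp_all add: coord_kop_tree \<phi> coord_unit_vec)
  qed
  moreover have "coord \<phi> = green (\<Gamma> z) r" by (intro ext) (simp add: \<phi> green.simps)
  ultimately show ?case by blast
next
  case (child y)
  obtain \<phi> where \<phi>: "coord \<phi> = branch (\<Gamma> z) y" using branch_in_ell2[OF z] .
  obtain \<psi> where \<psi>: "coord \<psi> = green (\<Gamma> z) (parent y)" "kop \<psi> - scaleC z \<psi> = unit_vec (parent y)"
    using child by blast
  define c where "c = s (parent y) y * \<Gamma> z (a y)"
  interpret kop: bounded_linear kop by (rule bounded_linear_kop)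
  have 1: "kop \<phi> - scaleC z \<phi> = unit_vec y + scaleC c (unit_vec (parent y))"
  proof (rule ell2_eqI)
    fix x
    show "coord (kop \<phi> - scaleC z \<phi>) x = coord (unit_vec y + scaleC c (unit_vec (parent y))) x"
      using branch_equation[OF z, of x y] child(1)
      by (auto simp: coord_kop_tree \<phi> coord_unit_vec c_def)
  qed
  have "kop (\<phi> - scaleC c \<psi>) - scaleC z (\<phi> - scaleC c \<psi>) =
      (kop \<phi> - scaleC z \<phi>) - scaleC c (kop \<psi> - scaleC z \<psi>)"
    by (rule ell2_eqI) (simp add: kop.diff kop_scaleC algebra_simps)
  also have "\<dots> = unit_vec y" unfolding 1 \<psi>(2) by simp
  finally have "kop (\<phi> - scaleC c \<psi>) - scaleC z (\<phi> - scaleC c \<psi>) = unit_vec y" .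
  moreover have "coord (\<phi> - scaleC c \<psi>) = green (\<Gamma> z) y"
    using child(1) by (intro ext) (simp add: \<phi> \<psi> c_def green.simps[of _ y])
  ultimately show ?case by blast
qed

lemma polynomial_expr_branch: "polynomial_expr (\<lambda>g. branch g v x)"
proof (induction x rule: vertex_induct)
  case root
  show ?case by (cases "v = r") (auto simp: branch_self branch_above intro: polynomial_expr.intros)
next
  case (child x)
  have "polynomial_expr (\<lambda>g. (\<lambda>_. -1) g * g (a x) * (\<lambda>_. s x (parent x)) g * branch g v (parent x))"
    by (intro polynomial_expr.mult polynomial_expr.const polynomial_expr.var child)
  then have "polynomial_expr (\<lambda>g. branch g v x)" if "x \<noteq> v"
    using that polynomial_expr.const[of 0] by (cases "depth x \<le> depth v") (simp_all add: branch.simps[of _ v x])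
  moreover have "polynomial_expr (\<lambda>g. branch g v x)" if "x = v"
    unfolding that branch_self by (rule polynomial_expr.var)
  ultimately show ?case by blast
qed

lemma polynomial_expr_green: "polynomial_expr (\<lambda>g. green g y x)"
proof (induction y rule: vertex_induct)
  case root
  show ?case by (simp add: green.simps[of _ r] polynomial_expr_branch)
next
  case (child y)
  have "polynomial_expr (\<lambda>g. branch g y x - (\<lambda>_. s (parent y) y) g * g (a y) * green g (parent y) x)"
    by (intro polynomial_expr_diff polynomial_expr_branch polynomial_expr.mult polynomial_expr.const polynomial_expr.var child)
  then show ?case using child(1) by (simp add: green.simps[of _ y])
qed

text \<open>
  Below \<open>y\<close> all summands of \<open>green g y\<close> satisfy the same recursion away from the root.
\<close>

lemma green_child:
  assumes "c \<in> children x" "depth y \<le> depth x"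
  shows "green g y c = - g (a c) * s c x * green g y x"
  using assms(2)
proof (induction y rule: vertex_induct)
  case root
  have "c \<noteq> r" using assms(1) by (simp add: children_iff)
  then show ?case using branch_child[OF assms(1)] by (simp add: green.simps[of _ r])
next
  case (child y)
  have "c \<noteq> y" using assms(1) child(3) by (auto simp: children_def)
  moreover have "depth (parent y) \<le> depth x" using child(1,3) parent[of y] by simp
  ultimately show ?case using child branch_child[OF assms(1), of y g]
    by (simp add: green.simps[of _ y] algebra_simps)
qed

text \<open>
  The hopping terms enter the diagonal only through products \<open>s x y * s y x = |s x y|\<^sup>2\<close>.
\<close>

lemma green_diagonal_real:
  assumes "\<And>k. g k \<in> \<real>"
  shows "green g y y \<in> \<real>"
proof (induction y rule: vertex_induct)
  case root
  show ?case using assms by (simp add: green.simps[of _ r] branch_self)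
next
  case (child y)
  have c: "y \<in> children (parent y)" using child(1) by (simp add: children_iff)
  have "green g y y = g (a y) + g (a y) * g (a y) * (s (parent y) y * s y (parent y)) * green g (parent y) (parent y)"
    using child(1) green_child[OF c, of "parent y" g] by (simp add: green.simps[of _ y] branch_self)
  also have "\<dots> \<in> \<real>" unfolding s_times_s[OF c] by (intro Reals_add Reals_mult assms child Reals_of_real)
  finally show ?case .
qed

lemma green_root: "green g r r = g (a r)"
  by (simp add: green.simps[of _ r] branch_self)

end

section \<open>Spectral densities from boundary values of the resolvent\<close>

lemma cip_unit_vec: "cip (scaleC c (unit_vec x)) \<psi> = cnj c * coord \<psi> x"
proof -
  have "Im (cip (scaleC c (unit_vec x)) \<psi>) = Re (cnj (\<i> * c) * coord \<psi> x)"
    unfolding Im_cip scaleC_simps by (rule inner_unit_vec)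
  then show ?thesis by (simp add: complex_eq_iff inner_unit_vec)
qed

lemma cip_add_left: "cip (\<phi> + \<psi>) \<xi> = cip \<phi> \<xi> + cip \<psi> \<xi>"
  by (simp add: complex_eq_iff Im_cip inner_add_left scaleC_simps)

lemma cip_0_left [simp]: "cip 0 \<xi> = 0"
  by (simp add: complex_eq_iff Im_cip scaleC_simps)

lemma cip_sum_left: "cip (\<Sum>i\<in>S. f i) \<xi> = (\<Sum>i\<in>S. cip (f i) \<xi>)"
  by (induction S rule: infinite_finite_induct) (auto simp: cip_add_left)

lemma cip_restrict: "cip (restrict_ell2 F \<phi>) \<psi> = (\<Sum>x\<in>F. cnj (coord \<phi> x) * coord \<psi> x)"
  by (simp add: restrict_ell2_def cip_sum_left cip_unit_vec)

definition finitely_supported :: "'v ell2 \<Rightarrow> bool" where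
  "finitely_supported \<phi> \<longleftrightarrow> (\<exists>F. finite F \<and> \<phi> = restrict_ell2 F \<phi>)"

lemma finitely_supported_iff: "finitely_supported \<phi> \<longleftrightarrow> finite {x. coord \<phi> x \<noteq> 0}"
proof
  assume "finitely_supported \<phi>"
  then obtain F where F: "finite F" "\<phi> = restrict_ell2 F \<phi>" by (auto simp: finitely_supported_def)
  have "coord \<phi> x = 0" if "x \<notin> F" for x
    using coord_restrict_ell2[OF F(1), of \<phi> x] F(2) that by simp
  then show "finite {x. coord \<phi> x \<noteq> 0}" by (intro finite_subset[OF _ F(1)]) auto
next
  assume f: "finite {x. coord \<phi> x \<noteq> 0}"
  have "\<phi> = restrict_ell2 {x. coord \<phi> x \<noteq> 0} \<phi>"
    by (rule ell2_eqI) (simp add: coord_restrict_ell2[OF f])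
  then show "finitely_supported \<phi>" using f by (auto simp: finitely_supported_def)
qed

lemma finitely_supported_restrict: "finite F \<Longrightarrow> finitely_supported (restrict_ell2 F \<phi>)"
  unfolding finitely_supported_iff
  by (rule finite_subset[of _ F]) (auto simp: coord_restrict_ell2 split: if_splits)

lemma finitely_supported_add: "finitely_supported \<phi> \<Longrightarrow> finitely_supported \<psi> \<Longrightarrow> finitely_supported (\<phi> + \<psi>)"
  and finitely_supported_diff: "finitely_supported \<phi> \<Longrightarrow> finitely_supported \<psi> \<Longrightarrow> finitely_supported (\<phi> - \<psi>)"
  unfolding finitely_supported_iff
  by (rule finite_subset[of _ "{x. coord \<phi> x \<noteq> 0} \<union> {x. coord \<psi> x \<noteq> 0}"]; auto)+

lemma norm_restrict_le: "finite F \<Longrightarrow> norm (restrict_ell2 F \<phi>) \<le> norm \<phi>"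
proof (rule power2_le_imp_le)
  assume F: "finite F"
  have "(norm (restrict_ell2 F \<phi>))\<^sup>2 = (\<Sum>\<^sub>\<infinity>x\<in>F. (cmod (coord \<phi> x))\<^sup>2)"
    unfolding norm_sq_ell2 by (rule infsum_cong_neutral) (auto simp: coord_restrict_ell2 F)
  then show "(norm (restrict_ell2 F \<phi>))\<^sup>2 \<le> (norm \<phi>)\<^sup>2" using sum_le_norm_sq[OF F, of \<phi>] F by simp
qed simp

text \<open>
  What the explicit Green function of a tree provides. Spectral densities are constructed from these properties
  alone.
\<close>

locale green_boundary = selfadjoint T for T :: "'v ell2 \<Rightarrow> 'v ell2" +
  fixes D :: "real set"
  assumes finite_D: "finite D"
    and green_holomorphic: "(\<lambda>z. coord (R z (unit_vec y)) x) holomorphic_on upper_half"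
    and green_bounded: "\<exists>B. \<forall>z. Im z > 0 \<longrightarrow> cmod (coord (R z (unit_vec y)) x) \<le> B"
    and green_limit: "E \<notin> D \<Longrightarrow> \<exists>l. ((\<lambda>z. coord (R z (unit_vec y)) x) \<longlongrightarrow> l) (boundary_filter E)"
begin

definition h :: "'v ell2 \<Rightarrow> complex \<Rightarrow> complex" where "h \<phi> z = cip \<phi> (R z \<phi>)"

lemma h_expansion:
  assumes "finitely_supported \<phi>"
  obtains F where "finite F" "\<And>z. Im z > 0 \<Longrightarrow> h \<phi> z =
    (\<Sum>x\<in>F. \<Sum>y\<in>F. cnj (coord \<phi> x) * coord \<phi> y * coord (R z (unit_vec y)) x)"
proof -
  obtain F where F: "finite F" "\<phi> = restrict_ell2 F \<phi>" using assms by (auto simp: finitely_supported_def)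
  show ?thesis
  proof
    fix z assume z: "Im z > 0"
    have "R z \<phi> = (\<Sum>y\<in>F. scaleC (coord \<phi> y) (R z (unit_vec y)))"
      using arg_cong[OF F(2), of "R z"] z unfolding restrict_ell2_def
      by (simp add: R_sum R_scaleC)
    moreover have "h \<phi> z = (\<Sum>x\<in>F. cnj (coord \<phi> x) * coord (R z \<phi>) x)"
      unfolding h_def using cip_restrict[of F \<phi> "R z \<phi>"] F(2) by simp
    ultimately show "h \<phi> z = (\<Sum>x\<in>F. \<Sum>y\<in>F. cnj (coord \<phi> x) * coord \<phi> y * coord (R z (unit_vec y)) x)"
      by (simp add: sum_distrib_left mult.assoc)
  qed (rule F(1))
qed

lemma h_holomorphic:
  assumes "finitely_supported \<phi>"
  shows "h \<phi> holomorphic_on upper_half"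
proof -
  obtain F where F: "finite F" "\<And>z. Im z > 0 \<Longrightarrow> h \<phi> z =
    (\<Sum>x\<in>F. \<Sum>y\<in>F. cnj (coord \<phi> x) * coord \<phi> y * coord (R z (unit_vec y)) x)"
    by (rule h_expansion[OF assms]) (rule that)
  have "(\<lambda>z. \<Sum>x\<in>F. \<Sum>y\<in>F. cnj (coord \<phi> x) * coord \<phi> y * coord (R z (unit_vec y)) x) holomorphic_on upper_half"
    by (intro holomorphic_intros green_holomorphic)
  then show ?thesis by (rule holomorphic_transform) (simp add: F(2))
qed

lemma h_bounded:
  assumes "finitely_supported \<phi>"
  shows "\<exists>B\<ge>0. \<forall>z. Im z > 0 \<longrightarrow> cmod (h \<phi> z) \<le> B"
proof -
  obtain F where F: "finite F" "\<And>z. Im z > 0 \<Longrightarrow> h \<phi> z =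
    (\<Sum>x\<in>F. \<Sum>y\<in>F. cnj (coord \<phi> x) * coord \<phi> y * coord (R z (unit_vec y)) x)"
    by (rule h_expansion[OF assms]) (rule that)
  define B where "B x y = (SOME B. \<forall>z. Im z > 0 \<longrightarrow> cmod (coord (R z (unit_vec y)) x) \<le> B)" for x y
  have B: "cmod (coord (R z (unit_vec y)) x) \<le> B x y" if "Im z > 0" for x y z
    using someI_ex[OF green_bounded[of y x]] that unfolding B_def by blast
  define C where "C = (\<Sum>x\<in>F. \<Sum>y\<in>F. cmod (coord \<phi> x) * cmod (coord \<phi> y) * B x y)"
  have "cmod (h \<phi> z) \<le> C" if "Im z > 0" for z
    unfolding F(2)[OF that] C_def
    by (intro sum_norm_le) (auto simp: norm_mult intro!: mult_left_mono B[OF that])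
  moreover from this[of \<i>] have "C \<ge> 0" using order.trans[OF norm_ge_zero] by fastforce
  ultimately show ?thesis by blast
qed

lemma h_limit:
  assumes "finitely_supported \<phi>" "E \<notin> D"
  shows "\<exists>l. (h \<phi> \<longlongrightarrow> l) (boundary_filter E)"
proof -
  obtain F where F: "finite F" "\<And>z. Im z > 0 \<Longrightarrow> h \<phi> z =
    (\<Sum>x\<in>F. \<Sum>y\<in>F. cnj (coord \<phi> x) * coord \<phi> y * coord (R z (unit_vec y)) x)"
    by (rule h_expansion[OF assms(1)]) (rule that)
  define l where "l x y = Lim (boundary_filter E) (\<lambda>z. coord (R z (unit_vec y)) x)" for x y
  have l: "((\<lambda>z. coord (R z (unit_vec y)) x) \<longlongrightarrow> l x y) (boundary_filter E)" for x y
    unfolding l_def by (rule boundary_Lim[OF green_limit[OF assms(2)]])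
  have "((\<lambda>z. \<Sum>x\<in>F. \<Sum>y\<in>F. cnj (coord \<phi> x) * coord \<phi> y * coord (R z (unit_vec y)) x) \<longlongrightarrow>
      (\<Sum>x\<in>F. \<Sum>y\<in>F. cnj (coord \<phi> x) * coord \<phi> y * l x y)) (boundary_filter E)"
    by (intro tendsto_intros l)
  moreover have "\<forall>\<^sub>F z in boundary_filter E.
      (\<Sum>x\<in>F. \<Sum>y\<in>F. cnj (coord \<phi> x) * coord \<phi> y * coord (R z (unit_vec y)) x) = h \<phi> z"
    using eventually_upper_half by eventually_elim (simp add: F(2))
  ultimately show ?thesis using Lim_transform_eventually by blast
qed

text \<open>
  The density of the spectral measure at \<open>\<phi>\<close> (Stieltjes inversion). On the finite set \<open>D\<close> the value does not
  matter for integrals; \<open>0\<close> keeps the function measurable and nonnegative.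
\<close>

definition dens :: "'v ell2 \<Rightarrow> real \<Rightarrow> real" where
  "dens \<phi> E = (if E \<in> D then 0 else Im (Lim (boundary_filter E) (h \<phi>)) / pi)"

lemma h_tendsto:
  assumes "finitely_supported \<phi>" "E \<notin> D"
  shows "(h \<phi> \<longlongrightarrow> Lim (boundary_filter E) (h \<phi>)) (boundary_filter E)"
  by (rule boundary_Lim[OF h_limit[OF assms]])

text \<open>
  The density as a limit of squared norms. All its inequalities come from this form.
\<close>

lemma dens_tendsto:
  assumes "finitely_supported \<phi>" "E \<notin> D"
  shows "((\<lambda>z. Im z * (norm (R z \<phi>))\<^sup>2) \<longlongrightarrow> pi * dens \<phi> E) (boundary_filter E)"
proof -
  have "((\<lambda>z. Im (h \<phi> z)) \<longlongrightarrow> pi * dens \<phi> E) (boundary_filter E)"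
    using tendsto_Im[OF h_tendsto[OF assms]] assms(2) by (simp add: dens_def)
  moreover have "\<forall>\<^sub>F z in boundary_filter E. Im (h \<phi> z) = Im z * (norm (R z \<phi>))\<^sup>2"
    using eventually_upper_half by eventually_elim (simp add: h_def Im_cip_R)
  ultimately show ?thesis by (rule Lim_transform_eventually)
qed

text \<open>
  Inequalities between squared norms of resolvents survive in the limit.
\<close>

lemma dens_le_linear:
  assumes "finite S" "\<And>i. i \<in> S \<Longrightarrow> finitely_supported (\<psi> i)" "finitely_supported \<phi>"
    and "\<And>z. Im z > 0 \<Longrightarrow> (norm (R z \<phi>))\<^sup>2 \<le> (\<Sum>i\<in>S. c i * (norm (R z (\<psi> i)))\<^sup>2)"
  shows "dens \<phi> E \<le> (\<Sum>i\<in>S. c i * dens (\<psi> i) E)"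
proof (cases "E \<in> D")
  case False
  have "pi * dens \<phi> E \<le> (\<Sum>i\<in>S. c i * (pi * dens (\<psi> i) E))"
  proof (rule tendsto_le[OF boundary_filter_nontrivial _ dens_tendsto[OF assms(3) False]])
    show "((\<lambda>z. \<Sum>i\<in>S. c i * (Im z * (norm (R z (\<psi> i)))\<^sup>2)) \<longlongrightarrow> (\<Sum>i\<in>S. c i * (pi * dens (\<psi> i) E))) (boundary_filter E)"
      using assms(2) False by (intro tendsto_intros dens_tendsto) auto
    show "\<forall>\<^sub>F z in boundary_filter E. Im z * (norm (R z \<phi>))\<^sup>2 \<le> (\<Sum>i\<in>S. c i * (Im z * (norm (R z (\<psi> i)))\<^sup>2))"
      using eventually_upper_half
    proof eventually_elim
      case (elim z)
      have "Im z * (norm (R z \<phi>))\<^sup>2 \<le> Im z * (\<Sum>i\<in>S. c i * (norm (R z (\<psi> i)))\<^sup>2)"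
        using elim assms(4) by (intro mult_left_mono) auto
      then show ?case by (simp add: sum_distrib_left mult_ac)
    qed
  qed
  also have "\<dots> = pi * (\<Sum>i\<in>S. c i * dens (\<psi> i) E)" by (simp add: sum_distrib_left mult_ac)
  finally show ?thesis by simp
qed (simp add: dens_def)

lemma dens_nonneg:
  assumes "finitely_supported \<phi>"
  shows "dens \<phi> E \<ge> 0"
proof (cases "E \<in> D")
  case False
  have "0 \<le> pi * dens \<phi> E"
  proof (rule tendsto_lowerbound[OF dens_tendsto[OF assms False] _ boundary_filter_nontrivial])
    show "\<forall>\<^sub>F z in boundary_filter E. 0 \<le> Im z * (norm (R z \<phi>))\<^sup>2"
      using eventually_upper_half by eventually_elim simp
  qed
  then show ?thesis using pi_gt_zero by (auto simp: zero_le_mult_iff)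
qed (simp add: dens_def)

lemma dens_add_le:
  assumes "finitely_supported \<phi>" "finitely_supported \<psi>"
  shows "dens (\<phi> + \<psi>) E \<le> 2 * dens \<phi> E + 2 * dens \<psi> E"
proof -
  have "dens (\<phi> + \<psi>) E \<le> (\<Sum>b\<in>{True, False}. 2 * dens (if b then \<phi> else \<psi>) E)"
  proof (rule dens_le_linear)
    fix z :: complex assume z: "Im z > 0"
    have "(norm (R z (\<phi> + \<psi>)))\<^sup>2 \<le> (norm (R z \<phi>) + norm (R z \<psi>))\<^sup>2"
      using z by (intro power_mono) (auto simp: R_add norm_triangle_ineq)
    also have "\<dots> \<le> 2 * (norm (R z \<phi>))\<^sup>2 + 2 * (norm (R z \<psi>))\<^sup>2"
      using sum_squares_bound[of "norm (R z \<phi>)" "norm (R z \<psi>)"] by (simp add: power2_sum)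
    finally show "(norm (R z (\<phi> + \<psi>)))\<^sup>2 \<le> (\<Sum>b\<in>{True, False}. 2 * (norm (R z (if b then \<phi> else \<psi>)))\<^sup>2)"
      by simp
  qed (use assms in \<open>auto intro: finitely_supported_add\<close>)
  then show ?thesis by simp
qed

text \<open>
  From \<open>|p\<^sup>2 - q\<^sup>2| \<le> d * (p + q)\<close> for norms \<open>p\<close>, \<open>q\<close> and the norm \<open>d\<close> of the difference. The free parameter \<open>t\<close>
  makes the bound linear in the densities, so that it can be integrated without a Cauchy--Schwarz inequality.
\<close>

lemma dens_diff_le:
  assumes "finitely_supported \<phi>" "finitely_supported \<psi>" "t > 0"
  shows "\<bar>dens \<phi> E - dens \<psi> E\<bar> \<le> t * dens (\<phi> - \<psi>) E + (dens \<phi> E + dens \<psi> E) / t"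
proof -
  have one: "dens \<phi> E \<le> t * dens (\<phi> - \<psi>) E + (1 / t) * dens \<phi> E + (1 + 1 / t) * dens \<psi> E"
    if fs: "finitely_supported \<phi>" "finitely_supported \<psi>" for \<phi> \<psi>
  proof -
    \<comment> \<open>three vectors with coefficients, in the form required by \<open>dens_le_linear\<close>\<close>
    define v where "v i = (if i = 0 then \<phi> - \<psi> else if i = 1 then \<phi> else \<psi>)" for i :: nat
    define c where "c i = (if i = 0 then t else if i = 1 then 1 / t else 1 + 1 / t)" for i :: nat
    have "dens \<phi> E \<le> (\<Sum>i<3. c i * dens (v i) E)"
    proof (rule dens_le_linear)
      fix z :: complex assume z: "Im z > 0"
      define p where "p = norm (R z \<phi>)"
      define q where "q = norm (R z \<psi>)"
      define d where "d = norm (R z (\<phi> - \<psi>))"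
      have pos: "p \<ge> 0" "q \<ge> 0" "d \<ge> 0" by (simp_all add: p_def q_def d_def)
      have "p - q \<le> d" using norm_triangle_ineq2[of "R z \<phi>" "R z \<psi>"] z by (simp add: p_def q_def d_def R_diff)
      then have "(p - q) * (p + q) \<le> d * (p + q)" using pos by (intro mult_right_mono) auto
      also have "d * (p + q) \<le> t * d\<^sup>2 + (1 / t) * (p\<^sup>2 + q\<^sup>2)"
      proof -
        have "0 \<le> (t * d - (p + q) / 2)\<^sup>2" by simp
        then have "t * (d * (p + q)) \<le> t\<^sup>2 * d\<^sup>2 + (p + q)\<^sup>2 / 4" by (simp add: power2_eq_square algebra_simps)
        also have "(p + q)\<^sup>2 / 4 \<le> p\<^sup>2 + q\<^sup>2"
        proof -
          have "(p + q)\<^sup>2 + (p - q)\<^sup>2 = 2 * (p\<^sup>2 + q\<^sup>2)" by (simp add: power2_eq_square algebra_simps)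
          moreover have "b / 4 \<le> a" if "b + c = 2 * a" "0 \<le> c" "0 \<le> a" for a b c :: real
            using that by linarith
          ultimately show ?thesis by fastforce
        qed
        finally have "(t * (d * (p + q))) / t \<le> (t\<^sup>2 * d\<^sup>2 + (p\<^sup>2 + q\<^sup>2)) / t"
          using \<open>t > 0\<close> by (intro divide_right_mono) auto
        then show ?thesis using \<open>t > 0\<close> by (simp add: add_divide_distrib power2_eq_square)
      qed
      finally have "p\<^sup>2 \<le> t * d\<^sup>2 + (1 / t) * p\<^sup>2 + (1 + 1 / t) * q\<^sup>2"
        by (simp add: algebra_simps power2_eq_square)
      then show "(norm (R z \<phi>))\<^sup>2 \<le> (\<Sum>i<3. c i * (norm (R z (v i)))\<^sup>2)"
        by (simp add: p_def q_def d_def v_def c_def numeral_3_eq_3)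
    qed (use fs in \<open>auto simp: v_def intro: finitely_supported_diff\<close>)
    then show ?thesis by (simp add: v_def c_def numeral_3_eq_3)
  qed
  have "dens (\<psi> - \<phi>) E \<le> dens (\<phi> - \<psi>) E"
    using dens_le_linear[of "{()}" "\<lambda>_. \<phi> - \<psi>" "\<psi> - \<phi>" "\<lambda>_. 1" E] assms
    by (simp add: finitely_supported_diff R_diff norm_minus_commute)
  then have "t * dens (\<psi> - \<phi>) E \<le> t * dens (\<phi> - \<psi>) E" using \<open>t > 0\<close> by simp
  then show ?thesis
    using one[OF assms(1,2)] one[OF assms(2,1)] by (auto simp: abs_le_iff algebra_simps add_divide_distrib)
qed

text \<open>
  On the resolvent set the norm of the resolvent stays bounded, and the factor \<open>Im z\<close> tends to zero.
\<close>

lemma dens_eq_0_if_bounded_below: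
  assumes "finitely_supported \<phi>" "C > 0" "\<And>\<psi>. C * norm \<psi> \<le> norm (shift (of_real E) \<psi>)"
  shows "dens \<phi> E = 0"
proof (cases "E \<in> D")
  case False
  have "((\<lambda>z. Im z * (2 * norm \<phi> / C)\<^sup>2) \<longlongrightarrow> 0 * (2 * norm \<phi> / C)\<^sup>2) (boundary_filter E)"
    by (intro tendsto_mult tendsto_Im_boundary tendsto_const)
  then have lim: "((\<lambda>z. Im z * (2 * norm \<phi> / C)\<^sup>2) \<longlongrightarrow> 0) (boundary_filter E)" by simp
  have near: "\<forall>\<^sub>F z in boundary_filter E. cmod (z - of_real E) < C / 2"
    using \<open>C > 0\<close> unfolding eventually_at
    by (intro exI[of _ "C / 2"]) (auto simp: dist_norm)
  have "pi * dens \<phi> E \<le> 0"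
  proof (rule tendsto_le[OF boundary_filter_nontrivial lim dens_tendsto[OF assms(1) False]])
    show "\<forall>\<^sub>F z in boundary_filter E. Im z * (norm (R z \<phi>))\<^sup>2 \<le> Im z * (2 * norm \<phi> / C)\<^sup>2"
      using eventually_upper_half near
    proof eventually_elim
      case (elim z)
      have "shift (of_real E) (R z \<phi>) = \<phi> + scaleC (z - of_real E) (R z \<phi>)"
        using shift_R[of z \<phi>] elim(1) by (intro ell2_eqI) (auto simp: shift_def algebra_simps)
      then have "C * norm (R z \<phi>) \<le> norm (\<phi> + scaleC (z - of_real E) (R z \<phi>))"
        using assms(3)[of "R z \<phi>"] by simp
      also have "\<dots> \<le> norm \<phi> + cmod (z - of_real E) * norm (R z \<phi>)"
        by (rule order.trans[OF norm_triangle_ineq]) (simp add: norm_scaleC)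
      also have "\<dots> \<le> norm \<phi> + C / 2 * norm (R z \<phi>)" using elim by (intro add_left_mono mult_right_mono) auto
      finally have "norm (R z \<phi>) \<le> 2 * norm \<phi> / C" using \<open>C > 0\<close> by (simp add: field_simps)
      then show ?case using elim by (intro mult_left_mono power_mono) auto
    qed
  qed
  then have "dens \<phi> E \<le> 0" using pi_gt_zero by (simp add: mult_le_0_iff)
  then show ?thesis using dens_nonneg[OF assms(1), of E] by simp
qed (simp add: dens_def)

lemma dens_outside:
  assumes "finitely_supported \<phi>" "\<bar>E\<bar> > \<tau>"
  shows "dens \<phi> E = 0"
proof (rule dens_eq_0_if_bounded_below[OF assms(1)])
  show "\<bar>E\<bar> - \<tau> > 0" using assms by simp
  show "(\<bar>E\<bar> - \<tau>) * norm \<psi> \<le> norm (shift (of_real E) \<psi>)" for \<psi>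
    using norm_triangle_ineq2[of "scaleC (of_real E) \<psi>" "T \<psi>"] norm_T_le[of \<psi>]
    by (simp add: shift_def norm_scaleC norm_minus_commute algebra_simps)
qed

lemma dens_vertical_limit:
  assumes "finitely_supported \<phi>" "E \<notin> D"
  shows "(\<lambda>m. h \<phi> (Complex E (inverse (real (Suc m))))) \<longlonglongrightarrow> Lim (boundary_filter E) (h \<phi>)"
  by (rule filterlim_compose[OF h_tendsto[OF assms] vertical_approach])

lemma continuous_on_h_horizontal:
  assumes "finitely_supported \<phi>" "\<eta> > 0"
  shows "continuous_on S (\<lambda>E. h \<phi> (Complex E \<eta>))"
proof (rule continuous_on_compose2[OF holomorphic_on_imp_continuous_on[OF h_holomorphic[OF assms(1)]]])
  have "(\<lambda>E. Complex E \<eta>) = (\<lambda>E. of_real E + \<i> * of_real \<eta>)" by (intro ext) (simp add: complex_eq_iff)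
  then show "continuous_on S (\<lambda>E. Complex E \<eta>)" by (auto intro!: continuous_intros)
qed (use assms in auto)

lemma dens_measurable:
  assumes "finitely_supported \<phi>"
  shows "dens \<phi> \<in> borel_measurable lborel"
proof -
  have "dens \<phi> \<in> borel_measurable borel"
  proof (rule borel_measurable_LIMSEQ_real)
    show "(\<lambda>m. indicator (- D) E * (Im (h \<phi> (Complex E (inverse (real (Suc m))))) / pi)) \<longlonglongrightarrow> dens \<phi> E" for E
    proof (cases "E \<in> D")
      case False
      then show ?thesis using tendsto_Im[OF dens_vertical_limit[OF assms False]]
        by (auto simp: dens_def intro!: tendsto_intros)
    qed (simp add: dens_def)
    have "- D \<in> sets borel" using finite_D by (intro borel_open) (simp add: finite_imp_closed open_Compl)
    moreover have "(\<lambda>E. Im (h \<phi> (Complex E (inverse (real (Suc m))))) / pi) \<in> borel_measurable borel" for m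
      by (intro borel_measurable_continuous_onI continuous_intros continuous_on_h_horizontal assms) auto
    ultimately show "(\<lambda>E. indicator (- D) E * (Im (h \<phi> (Complex E (inverse (real (Suc m))))) / pi)) \<in> borel_measurable borel" for m
      by (intro borel_measurable_times borel_measurable_indicator)
  qed
  then show ?thesis by simp
qed

lemma dens_bounded:
  assumes "finitely_supported \<phi>"
  shows "\<exists>B. \<forall>E. dens \<phi> E \<le> B"
proof -
  obtain B where B: "B \<ge> 0" "\<And>z. Im z > 0 \<Longrightarrow> cmod (h \<phi> z) \<le> B" using h_bounded[OF assms] by blast
  have "dens \<phi> E \<le> B / pi" for E
  proof (cases "E \<in> D")
    case False
    have "cmod (Lim (boundary_filter E) (h \<phi>)) \<le> B"
    proof (rule tendsto_upperbound[OF tendsto_norm[OF h_tendsto[OF assms False]] _ boundary_filter_nontrivial])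
      show "\<forall>\<^sub>F z in boundary_filter E. cmod (h \<phi> z) \<le> B"
        using eventually_upper_half by eventually_elim (rule B)
    qed
    then show ?thesis using abs_Im_le_cmod[of "Lim (boundary_filter E) (h \<phi>)"] False
      by (auto simp: dens_def intro!: divide_right_mono)
  qed (use B in \<open>simp add: dens_def\<close>)
  then show ?thesis by blast
qed

lemma dens_moment_integrable:
  assumes "finitely_supported \<phi>"
  shows "integrable lborel (\<lambda>E. E ^ n * dens \<phi> E)"
proof -
  obtain B where B: "\<And>E. dens \<phi> E \<le> B" using dens_bounded[OF assms] by blast
  have B0: "B \<ge> 0" using order.trans[OF dens_nonneg[OF assms] B] .
  show ?thesis
  proof (rule integrableI_bounded_set[where A = "{-\<tau>..\<tau>}" and B = "\<tau> ^ n * B"])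
    show "(\<lambda>E. E ^ n * dens \<phi> E) \<in> borel_measurable lborel"
      by (intro borel_measurable_times dens_measurable[OF assms]) simp
    show "AE E in lborel. E \<in> {- \<tau>..\<tau>} \<longrightarrow> norm (E ^ n * dens \<phi> E) \<le> \<tau> ^ n * B"
    proof (intro AE_I2 impI)
      fix E assume "E \<in> {- \<tau>..\<tau>}"
      then have "\<bar>E\<bar> ^ n \<le> \<tau> ^ n" by (intro power_mono) auto
      then show "norm (E ^ n * dens \<phi> E) \<le> \<tau> ^ n * B"
        using B[of E] dens_nonneg[OF assms, of E] B0 \<tau>_nonneg
        by (auto simp: abs_mult power_abs intro!: mult_mono)
    qed
    show "AE E in lborel. E \<notin> {- \<tau>..\<tau>} \<longrightarrow> E ^ n * dens \<phi> E = 0"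
      by (intro AE_I2 impI) (use dens_outside[OF assms] in force)
  qed (auto simp: emeasure_lborel_Icc_eq)
qed

end

section \<open>Moments of the spectral densities\<close>

lemma lborel_integral_Icc_eq_diff:
  fixes f F :: "real \<Rightarrow> real"
  assumes "a \<le> b" "\<And>x. a \<le> x \<Longrightarrow> x \<le> b \<Longrightarrow> (F has_real_derivative f x) (at x)" "continuous_on {a..b} f"
  shows "(LINT x|lborel. indicator {a..b} x * f x) = F b - F a"
  using integral_FTC_Icc[OF assms(1), of F f] assms(2,3)
  by (simp add: has_real_derivative_iff_has_vector_derivative has_vector_derivative_at_within)

context green_boundary
begin

text \<open>
  The matrix element \<open>\<langle>\<phi>, T ^ n (T - z)\<^sup>-\<^sup>1 \<phi>\<rangle>\<close>, written so that its
  boundary values can be read off.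
\<close>

definition moment_fun :: "'v ell2 \<Rightarrow> nat \<Rightarrow> complex \<Rightarrow> complex" where
  "moment_fun \<phi> n z = z ^ n * h \<phi> z + (\<Sum>i<n. z ^ (n - 1 - i) * of_real (inner \<phi> ((T ^^ i) \<phi>)))"

lemma moment_fun_eq: "Im z > 0 \<Longrightarrow> moment_fun \<phi> n z = cip \<phi> ((T ^^ n) (R z \<phi>))"
  using T_power_R[of z \<phi> n] by (simp add: moment_fun_def h_def)

lemma moment_fun_holomorphic:
  assumes "finitely_supported \<phi>"
  shows "moment_fun \<phi> n holomorphic_on upper_half"
  unfolding moment_fun_def[abs_def] by (intro holomorphic_intros h_holomorphic assms)

text \<open>
  The leading term at infinity of the resolvent expansion.
\<close>

lemma moment_fun_decay:
  assumes z: "Im z > 0" "cmod z \<ge> 2 * \<tau>" "cmod z > 0"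
  shows "cmod (moment_fun \<phi> n z + of_real (inner \<phi> ((T ^^ n) \<phi>)) / z) \<le> 4 * \<tau> ^ Suc n * (norm \<phi>)\<^sup>2 / (cmod z)\<^sup>2"
proof -
  have z0: "z \<noteq> 0" using z by auto
  have "moment_fun \<phi> (Suc n) z = z * moment_fun \<phi> n z + of_real (inner \<phi> ((T ^^ n) \<phi>))"
  proof -
    interpret Tn: bounded_linear "T ^^ n" by (rule T_power_bounded_linear)
    have "T (R z \<phi>) = scaleC z (R z \<phi>) + \<phi>"
      using shift_R[of z \<phi>] z by (simp add: shift_def algebra_simps)
    then have "(T ^^ Suc n) (R z \<phi>) = scaleC z ((T ^^ n) (R z \<phi>)) + (T ^^ n) \<phi>"
      by (simp only: funpow_Suc_right o_apply Tn.add T_power_scaleC)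
    then show ?thesis unfolding moment_fun_eq[OF z(1)]
      by (simp only: cip_add_right cip_scaleC_right cip_T_power_real)
  qed
  then have eq: "moment_fun \<phi> n z + of_real (inner \<phi> ((T ^^ n) \<phi>)) / z = moment_fun \<phi> (Suc n) z / z"
    using z0 by (simp add: field_simps)
  have far: "cmod z / 2 * norm (R z \<phi>) \<le> norm \<phi>"
  proof (cases "\<tau> = 0")
    case True
    have "cmod z / 2 * norm (R z \<phi>) \<le> (cmod z - \<tau>) * norm (R z \<phi>)" using True by (intro mult_right_mono) auto
    also have "\<dots> \<le> norm \<phi>" using z True by (intro norm_R_far) auto
    finally show ?thesis .
  next
    case False
    then have "cmod z > \<tau>" using z(2) \<tau>_nonneg by linarith
    have "cmod z / 2 * norm (R z \<phi>) \<le> (cmod z - \<tau>) * norm (R z \<phi>)" using z(2) by (intro mult_right_mono) auto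
    also have "\<dots> \<le> norm \<phi>" using z(1) \<open>cmod z > \<tau>\<close> by (rule norm_R_far)
    finally show ?thesis .
  qed
  have "cmod (moment_fun \<phi> (Suc n) z) \<le> 2 * norm \<phi> * (\<tau> ^ Suc n * norm (R z \<phi>))"
    unfolding moment_fun_eq[OF z(1)]
    by (rule order.trans[OF cmod_cip_le]) (intro mult_left_mono norm_T_power_le; simp)
  also have "\<dots> = (4 * \<tau> ^ Suc n * norm \<phi> * (cmod z / 2 * norm (R z \<phi>))) / cmod z"
    using z(3) by simp
  also have "\<dots> \<le> (4 * \<tau> ^ Suc n * norm \<phi> * norm \<phi>) / cmod z"
    using \<tau>_nonneg by (intro divide_right_mono mult_left_mono far) auto
  finally have "cmod (moment_fun \<phi> (Suc n) z) / cmod z \<le> (4 * \<tau> ^ Suc n * norm \<phi> * norm \<phi>) / cmod z / cmod z"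
    by (intro divide_right_mono) auto
  then show ?thesis unfolding eq by (simp add: norm_divide power2_eq_square)
qed

text \<open>
  Let \<open>q\<close> be \<open>moment_fun\<close> without its leading term \<open>- c / z\<close>, and \<open>Q\<close> a primitive of \<open>q\<close>. The difference of \<open>Q\<close> between
  the ends of the segment is small, since the ends are also joined by the other three sides of a rectangle, where \<open>|z| \<ge> \<rho>\<close>
  and \<open>q\<close> is of order \<open>1 / |z|\<^sup>2\<close>. The leading term integrates to an arctangent.
\<close>

lemma moment_fun_horizontal_integral:
  fixes \<rho> :: real and n :: nat
  assumes fs: "finitely_supported \<phi>" and \<rho>: "\<rho> \<ge> 2 * \<tau>" "\<rho> > 0" and \<eta>: "0 < \<eta>" "\<eta> \<le> \<rho>"
  defines "c \<equiv> inner \<phi> ((T ^^ n) \<phi>)"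
  shows "\<bar>(LINT E|lborel. indicator {-\<rho>..\<rho>} E * Im (moment_fun \<phi> n (Complex E \<eta>))) - 2 * c * arctan (\<rho> / \<eta>)\<bar>
    \<le> 16 * \<tau> ^ Suc n * (norm \<phi>)\<^sup>2 / \<rho>"
proof -
  define q where "q z = moment_fun \<phi> n z + of_real c / z" for z
  define K where "K = 4 * \<tau> ^ Suc n * (norm \<phi>)\<^sup>2 / \<rho>\<^sup>2"
  have K0: "K \<ge> 0" using \<tau>_nonneg by (simp add: K_def)
  have qhol: "q holomorphic_on upper_half"
    unfolding q_def[abs_def] by (intro holomorphic_intros moment_fun_holomorphic fs) auto
  obtain Q where Q: "\<And>z. z \<in> upper_half \<Longrightarrow> (Q has_field_derivative q z) (at z)"
  proof (rule holomorphic_convex_primitive'[OF convex_halfspace_Im_gt open_halfspace_Im_gt qhol])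
    fix g assume g: "\<And>z. z \<in> upper_half \<Longrightarrow> (g has_field_derivative q z) (at z within upper_half)"
    have "(g has_field_derivative q z) (at z)" if "z \<in> upper_half" for z
      using g[OF that] at_within_open[OF that open_halfspace_Im_gt] by simp
    then show thesis by (rule that)
  qed
  have qbound: "cmod (q z) \<le> K" if "Im z > 0" "cmod z \<ge> \<rho>" for z
  proof -
    have "cmod (q z) \<le> 4 * \<tau> ^ Suc n * (norm \<phi>)\<^sup>2 / (cmod z)\<^sup>2"
      unfolding q_def c_def using that \<rho> by (intro moment_fun_decay) auto
    also have "\<dots> \<le> K" unfolding K_def
      using that \<rho> \<tau>_nonneg by (intro frac_le power_mono) auto
    finally show ?thesis .
  qed
  have seg: "cmod (Q u - Q v) \<le> K * cmod (u - v)"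
    if "convex S" "\<And>z. z \<in> S \<Longrightarrow> Im z > 0 \<and> cmod z \<ge> \<rho>" "u \<in> S" "v \<in> S" for S u v
    by (rule field_differentiable_bound[OF that(1), of Q q])
       (use that Q qbound in \<open>auto intro: has_field_derivative_at_within\<close>)
  have convs: "convex {z. Re z \<ge> \<rho> \<and> Im z > 0}" "convex {z. Re z \<le> -\<rho> \<and> Im z > 0}"
    unfolding Collect_conj_eq
    by (intro convex_Int convex_halfspace_Re_ge convex_halfspace_Re_le convex_halfspace_Im_gt)+
  have re: "cmod z \<ge> \<rho>" if "Re z \<ge> \<rho> \<or> Re z \<le> -\<rho> \<or> Im z \<ge> \<rho>" for z
    using that abs_Re_le_cmod[of z] abs_Im_le_cmod[of z] by linarith
  have "cmod (Q (Complex \<rho> \<eta>) - Q (Complex \<rho> \<rho>)) \<le> K * cmod (Complex \<rho> \<eta> - Complex \<rho> \<rho>)"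
    by (rule seg[OF convs(1)]) (use re \<eta> \<rho> in auto)
  also have "\<dots> \<le> K * \<rho>"
  proof -
    have "Complex \<rho> \<eta> - Complex \<rho> \<rho> = \<i> * of_real (\<eta> - \<rho>)" by (simp add: complex_eq_iff)
    then have "cmod (Complex \<rho> \<eta> - Complex \<rho> \<rho>) \<le> \<rho>" using \<eta> by (simp add: norm_mult del: of_real_diff)
    then show ?thesis using K0 by (intro mult_left_mono) auto
  qed
  finally have 1: "cmod (Q (Complex \<rho> \<eta>) - Q (Complex \<rho> \<rho>)) \<le> K * \<rho>" .
  have "cmod (Q (Complex \<rho> \<rho>) - Q (Complex (-\<rho>) \<rho>)) \<le> K * cmod (Complex \<rho> \<rho> - Complex (-\<rho>) \<rho>)"
    by (rule seg[OF convex_halfspace_Im_ge[of \<rho>]]) (use re \<eta> \<rho> in auto)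
  also have "\<dots> \<le> K * (2 * \<rho>)"
  proof -
    have "Complex \<rho> \<rho> - Complex (-\<rho>) \<rho> = of_real (2 * \<rho>)" by (simp add: complex_eq_iff)
    then show ?thesis using \<rho> by simp
  qed
  finally have 2: "cmod (Q (Complex \<rho> \<rho>) - Q (Complex (-\<rho>) \<rho>)) \<le> K * (2 * \<rho>)" .
  have "cmod (Q (Complex (-\<rho>) \<rho>) - Q (Complex (-\<rho>) \<eta>)) \<le> K * cmod (Complex (-\<rho>) \<rho> - Complex (-\<rho>) \<eta>)"
    by (rule seg[OF convs(2)]) (use re \<eta> \<rho> in auto)
  also have "\<dots> \<le> K * \<rho>"
  proof -
    have "Complex (-\<rho>) \<rho> - Complex (-\<rho>) \<eta> = \<i> * of_real (\<rho> - \<eta>)" by (simp add: complex_eq_iff)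
    then have "cmod (Complex (-\<rho>) \<rho> - Complex (-\<rho>) \<eta>) \<le> \<rho>" using \<eta> by (simp add: norm_mult del: of_real_diff)
    then show ?thesis using K0 by (intro mult_left_mono) auto
  qed
  finally have 3: "cmod (Q (Complex (-\<rho>) \<rho>) - Q (Complex (-\<rho>) \<eta>)) \<le> K * \<rho>" .
  have "Q (Complex \<rho> \<eta>) - Q (Complex (-\<rho>) \<eta>) = (Q (Complex \<rho> \<eta>) - Q (Complex \<rho> \<rho>)) +
     (Q (Complex \<rho> \<rho>) - Q (Complex (-\<rho>) \<rho>)) + (Q (Complex (-\<rho>) \<rho>) - Q (Complex (-\<rho>) \<eta>))" by simp
  then have "cmod (Q (Complex \<rho> \<eta>) - Q (Complex (-\<rho>) \<eta>)) \<le> K * \<rho> + K * (2 * \<rho>) + K * \<rho>"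
    using norm_triangle_mono[OF norm_triangle_mono[OF 1 2] 3] by simp
  also have "\<dots> = 16 * \<tau> ^ Suc n * (norm \<phi>)\<^sup>2 / \<rho>"
    using \<rho> by (simp add: K_def power2_eq_square field_simps)
  finally have total: "cmod (Q (Complex \<rho> \<eta>) - Q (Complex (-\<rho>) \<eta>)) \<le> 16 * \<tau> ^ Suc n * (norm \<phi>)\<^sup>2 / \<rho>" .
  \<comment> \<open>a primitive of \<open>Im (moment_fun \<phi> n)\<close> along the segment: \<open>Im (c / z) = - c * \<eta> / (E\<^sup>2 + \<eta>\<^sup>2)\<close>\<close>
  define F where "F E = Im (Q (Complex E \<eta>)) + c * arctan (E / \<eta>)" for E
  have line: "(\<lambda>E. Complex E \<eta>) = (\<lambda>E. of_real E + \<i> * of_real \<eta>)" by (intro ext) (simp add: complex_eq_iff)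
  have Fderiv: "(F has_real_derivative Im (moment_fun \<phi> n (Complex E \<eta>))) (at E)" for E
  proof -
    have "((\<lambda>E. Complex E \<eta>) has_vector_derivative 1) (at E)"
      unfolding line by (auto intro!: derivative_eq_intros)
    from field_vector_diff_chain_at[OF this, of Q "q (Complex E \<eta>)"]
    have "((\<lambda>E. Q (Complex E \<eta>)) has_vector_derivative q (Complex E \<eta>)) (at E)"
      using Q[of "Complex E \<eta>"] \<eta> by (simp add: o_def)
    then have "((\<lambda>E. Im (Q (Complex E \<eta>))) has_real_derivative Im (q (Complex E \<eta>))) (at E)"
      unfolding has_real_derivative_iff_has_vector_derivative
      by (rule bounded_linear.has_vector_derivative[OF bounded_linear_Im])
    moreover have "((\<lambda>E. c * arctan (E / \<eta>)) has_real_derivative c * (inverse (1 + (E / \<eta>)\<^sup>2) * (1 / \<eta>))) (at E)"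
      using \<eta> by (auto intro!: derivative_eq_intros)
    ultimately have "(F has_real_derivative Im (q (Complex E \<eta>)) + c * (inverse (1 + (E / \<eta>)\<^sup>2) * (1 / \<eta>))) (at E)"
      unfolding F_def[abs_def] by (rule DERIV_add)
    moreover have "Im (q (Complex E \<eta>)) + c * (inverse (1 + (E / \<eta>)\<^sup>2) * (1 / \<eta>)) = Im (moment_fun \<phi> n (Complex E \<eta>))"
    proof -
      have "E\<^sup>2 + \<eta>\<^sup>2 > 0" using \<eta> by (simp add: sum_power2_gt_zero_iff)
      then have "inverse (1 + (E / \<eta>)\<^sup>2) * (1 / \<eta>) = \<eta> / (E\<^sup>2 + \<eta>\<^sup>2)"
        using \<eta> by (simp add: field_simps power2_eq_square)
      then show ?thesis by (simp add: q_def Im_divide)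
    qed
    ultimately show ?thesis by simp
  qed
  have "continuous_on {-\<rho>..\<rho>} (\<lambda>E. Im (moment_fun \<phi> n (Complex E \<eta>)))"
  proof (intro continuous_on_Im continuous_on_compose2[OF holomorphic_on_imp_continuous_on[OF moment_fun_holomorphic[OF fs]]])
    show "continuous_on {-\<rho>..\<rho>} (\<lambda>E. Complex E \<eta>)" unfolding line by (intro continuous_intros)
  qed (use \<eta> in auto)
  then have "(LINT E|lborel. indicator {-\<rho>..\<rho>} E * Im (moment_fun \<phi> n (Complex E \<eta>))) = F \<rho> - F (-\<rho>)"
    using \<rho> by (intro lborel_integral_Icc_eq_diff Fderiv) auto
  also have "\<dots> = Im (Q (Complex \<rho> \<eta>) - Q (Complex (-\<rho>) \<eta>)) + 2 * c * arctan (\<rho> / \<eta>)"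
    by (simp add: F_def arctan_minus)
  finally show ?thesis using abs_Im_le_cmod[of "Q (Complex \<rho> \<eta>) - Q (Complex (-\<rho>) \<eta>)"] total by simp
qed

text \<open>
  The limit \<open>\<eta> \<rightarrow> 0\<close> of \<open>moment_fun_horizontal_integral\<close>, by dominated convergence: \<open>h\<close> is bounded, it converges off
  the null set \<open>D\<close>, and the arctangent tends to \<open>pi / 2\<close>.
\<close>

lemma dens_moment_truncated:
  assumes fs: "finitely_supported \<phi>" and \<rho>: "\<rho> \<ge> 2 * \<tau>" "\<rho> \<ge> 1"
  shows "\<bar>pi * (LINT E|lborel. indicator {-\<rho>..\<rho>} E * (E ^ n * dens \<phi> E)) - pi * inner \<phi> ((T ^^ n) \<phi>)\<bar>
    \<le> 16 * \<tau> ^ Suc n * (norm \<phi>)\<^sup>2 / \<rho>"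
proof -
  define c where "c = inner \<phi> ((T ^^ n) \<phi>)"
  define \<eta> where "\<eta> m = inverse (real (Suc m))" for m
  define f where "f m E = indicator {-\<rho>..\<rho>} E * Im (moment_fun \<phi> n (Complex E (\<eta> m)))" for m E
  have \<eta>: "0 < \<eta> m" "\<eta> m \<le> 1" for m by (auto simp: \<eta>_def field_simps)
  obtain B where B: "B \<ge> 0" "\<And>z. Im z > 0 \<Longrightarrow> cmod (h \<phi> z) \<le> B" using h_bounded[OF fs] by blast
  define C where "C = (\<rho> + 1) ^ n * B + (\<Sum>i<n. (\<rho> + 1) ^ (n - 1 - i) * \<bar>inner \<phi> ((T ^^ i) \<phi>)\<bar>)"
  have ae: "AE E in lborel. E \<notin> D"
    using AE_not_in[OF finite_imp_null_set_lborel[OF finite_D]] .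
  have conv: "(\<lambda>m. LINT E|lborel. f m E) \<longlonglongrightarrow> (LINT E|lborel. indicator {-\<rho>..\<rho>} E * (E ^ n * (pi * dens \<phi> E)))"
  proof (rule integral_dominated_convergence[where w = "\<lambda>E. indicator {-\<rho>..\<rho>} E * C"])
    show "(\<lambda>E. indicator {-\<rho>..\<rho>} E * (E ^ n * (pi * dens \<phi> E))) \<in> borel_measurable lborel"
      by (intro borel_measurable_times borel_measurable_indicator dens_measurable fs borel_measurable_const borel_measurable_power) auto
    show "f m \<in> borel_measurable lborel" for m
    proof -
      have line: "(\<lambda>E. Complex E (\<eta> m)) = (\<lambda>E. of_real E + \<i> * of_real (\<eta> m))" by (intro ext) (simp add: complex_eq_iff)
      have "continuous_on UNIV (\<lambda>E. Im (moment_fun \<phi> n (Complex E (\<eta> m))))"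
      proof (intro continuous_on_Im continuous_on_compose2[OF holomorphic_on_imp_continuous_on[OF moment_fun_holomorphic[OF fs]]])
        show "continuous_on UNIV (\<lambda>E. Complex E (\<eta> m))" unfolding line by (intro continuous_intros)
      qed (use \<eta> in auto)
      then have "(\<lambda>E. Im (moment_fun \<phi> n (Complex E (\<eta> m)))) \<in> borel_measurable borel"
        by (rule borel_measurable_continuous_onI)
      then show ?thesis unfolding f_def
        by (intro borel_measurable_times borel_measurable_indicator) auto
    qed
    show "integrable lborel (\<lambda>E. indicator {-\<rho>..\<rho>} E * C)"
      by (intro integrable_mult_left impI integrable_real_indicator) (auto simp: emeasure_lborel_Icc_eq)
    show "AE E in lborel. (\<lambda>m. f m E) \<longlonglongrightarrow> indicator {-\<rho>..\<rho>} E * (E ^ n * (pi * dens \<phi> E))"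
      using ae
    proof eventually_elim
      case (elim E)
      define l where "l = Lim (boundary_filter E) (h \<phi>)"
      have zl: "(\<lambda>m. Complex E (\<eta> m)) \<longlonglongrightarrow> of_real E"
      proof -
        have "(\<lambda>m. Complex E (\<eta> m)) \<longlonglongrightarrow> Complex E 0"
          unfolding \<eta>_def by (intro tendsto_Complex tendsto_const LIMSEQ_inverse_real_of_nat)
        then show ?thesis by (simp add: complex_of_real_def)
      qed
      have "(\<lambda>m. moment_fun \<phi> n (Complex E (\<eta> m))) \<longlonglongrightarrow>
          of_real E ^ n * l + (\<Sum>i<n. of_real E ^ (n - 1 - i) * of_real (inner \<phi> ((T ^^ i) \<phi>)))"
        unfolding moment_fun_def l_def using dens_vertical_limit[OF fs elim]
        by (intro tendsto_intros zl) (simp add: \<eta>_def)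
      from tendsto_Im[OF this]
      have "(\<lambda>m. Im (moment_fun \<phi> n (Complex E (\<eta> m)))) \<longlonglongrightarrow> E ^ n * Im l"
        by (simp flip: of_real_power)
      moreover have "E ^ n * Im l = E ^ n * (pi * dens \<phi> E)" using elim by (simp add: dens_def l_def)
      ultimately show ?case unfolding f_def by (intro tendsto_mult tendsto_const) simp
    qed
    show "AE E in lborel. norm (f m E) \<le> indicator {-\<rho>..\<rho>} E * C" for m
    proof (intro AE_I2)
      fix E
      show "norm (f m E) \<le> indicator {-\<rho>..\<rho>} E * C"
      proof (cases "E \<in> {-\<rho>..\<rho>}")
        case True
        define z where "z = Complex E (\<eta> m)"
        have "cmod z \<le> \<bar>E\<bar> + \<bar>\<eta> m\<bar>" unfolding z_def using cmod_le[of "Complex E (\<eta> m)"] by simp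
        then have z: "cmod z \<le> \<rho> + 1" "Im z > 0" using True \<eta>[of m] by (auto simp: z_def)
        have pw: "cmod (z ^ k) \<le> (\<rho> + 1) ^ k" for k unfolding norm_power using z by (intro power_mono) auto
        have "cmod (moment_fun \<phi> n z) \<le> C"
          unfolding moment_fun_def C_def
          using pw B z \<rho> by (intro norm_triangle_le add_mono sum_norm_le) (auto simp: norm_mult intro!: mult_mono)
        then show ?thesis using True abs_Im_le_cmod[of "moment_fun \<phi> n z"] by (simp add: f_def z_def)
      qed (simp add: f_def)
    qed
  qed
  have arct: "(\<lambda>m. 2 * c * arctan (\<rho> / \<eta> m)) \<longlonglongrightarrow> 2 * c * (pi / 2)"
  proof (intro tendsto_mult tendsto_const filterlim_compose[OF tendsto_arctan_at_top])
    have "(\<lambda>m. \<rho> / \<eta> m) = (\<lambda>m. \<rho> * real (Suc m))" by (simp add: \<eta>_def field_simps fun_eq_iff)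
    moreover have "filterlim (\<lambda>m. \<rho> * real (Suc m)) at_top sequentially"
      using \<rho> by (intro filterlim_tendsto_pos_mult_at_top[OF tendsto_const]
        filterlim_compose[OF filterlim_real_sequentially filterlim_Suc]) auto
    ultimately show "filterlim (\<lambda>m. \<rho> / \<eta> m) at_top sequentially" by simp
  qed
  have "\<bar>(LINT E|lborel. indicator {-\<rho>..\<rho>} E * (E ^ n * (pi * dens \<phi> E))) - 2 * c * (pi / 2)\<bar>
      \<le> 16 * \<tau> ^ Suc n * (norm \<phi>)\<^sup>2 / \<rho>"
  proof (rule tendsto_upperbound)
    show "(\<lambda>m. \<bar>(LINT E|lborel. f m E) - 2 * c * arctan (\<rho> / \<eta> m)\<bar>) \<longlonglongrightarrow>
      \<bar>(LINT E|lborel. indicator {-\<rho>..\<rho>} E * (E ^ n * (pi * dens \<phi> E))) - 2 * c * (pi / 2)\<bar>"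
      by (intro tendsto_intros conv arct)
    show "\<forall>\<^sub>F m in sequentially. \<bar>(LINT E|lborel. f m E) - 2 * c * arctan (\<rho> / \<eta> m)\<bar> \<le> 16 * \<tau> ^ Suc n * (norm \<phi>)\<^sup>2 / \<rho>"
      unfolding f_def c_def
      using moment_fun_horizontal_integral[OF fs \<rho>(1) _ \<eta>(1)] \<rho>(2) \<eta>(2)
      by (intro always_eventually allI) (meson less_le_trans order_trans zero_less_one)
  qed simp
  moreover have "(LINT E|lborel. indicator {-\<rho>..\<rho>} E * (E ^ n * (pi * dens \<phi> E))) =
      pi * (LINT E|lborel. indicator {-\<rho>..\<rho>} E * (E ^ n * dens \<phi> E))"
    by (subst integral_mult_right_zero[symmetric]) (simp add: mult_ac)
  ultimately show ?thesis by (simp add: c_def mult.commute)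
qed

text \<open>
  Outside \<open>{-\<tau>..\<tau>}\<close> the density vanishes, so the truncated integral does not depend on \<open>\<rho>\<close>, while the error in
  \<open>dens_moment_truncated\<close> tends to zero.
\<close>

theorem dens_moment:
  assumes fs: "finitely_supported \<phi>"
  shows "(LINT E|lborel. E ^ n * dens \<phi> E) = inner \<phi> ((T ^^ n) \<phi>)"
proof -
  define K where "K = 16 * \<tau> ^ Suc n * (norm \<phi>)\<^sup>2"
  define d where "d = \<bar>pi * (LINT E|lborel. E ^ n * dens \<phi> E) - pi * inner \<phi> ((T ^^ n) \<phi>)\<bar>"
  have K0: "K \<ge> 0" using \<tau>_nonneg by (simp add: K_def)
  have bound: "d \<le> K / \<rho>" if "\<rho> \<ge> 2 * \<tau>" "\<rho> \<ge> 1" for \<rho>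
  proof -
    have eq: "indicator {-\<rho>..\<rho>} E * (E ^ n * dens \<phi> E) = E ^ n * dens \<phi> E" for E
    proof (cases "E \<in> {-\<rho>..\<rho>}")
      case False
      then have "\<bar>E\<bar> > \<tau>" using that \<tau>_nonneg by auto
      then show ?thesis using dens_outside[OF fs] by simp
    qed simp
    show ?thesis using dens_moment_truncated[OF fs that, of n] unfolding eq d_def K_def .
  qed
  have "d \<le> 0"
  proof (rule tendsto_lowerbound[of "\<lambda>m. K * inverse (real (Suc m))" 0 sequentially])
    show "(\<lambda>m. K * inverse (real (Suc m))) \<longlonglongrightarrow> 0"
      using tendsto_mult[OF tendsto_const LIMSEQ_inverse_real_of_nat, of K] by simp
    have "\<forall>\<^sub>F m in sequentially. real m \<ge> 2 * \<tau>"
      using filterlim_real_sequentially by (simp add: filterlim_at_top)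
    then show "\<forall>\<^sub>F m in sequentially. d \<le> K * inverse (real (Suc m))"
    proof eventually_elim
      case (elim m)
      then show ?case using bound[of "real (Suc m)"] by (simp add: divide_inverse)
    qed
  qed simp
  then have "pi * (LINT E|lborel. E ^ n * dens \<phi> E) = pi * inner \<phi> ((T ^^ n) \<phi>)" by (simp add: d_def)
  then show ?thesis by simp
qed

end

section \<open>Spectral densities of arbitrary vectors and spectral gaps\<close>

text \<open>
  Completeness of \<open>L\<^sup>1\<close> in the form of absolutely convergent series.
\<close>

lemma absolutely_summable_integrals:
  fixes f :: "nat \<Rightarrow> real \<Rightarrow> real"
  assumes int: "\<And>i. integrable lborel (f i)" and b: "\<And>i. (LINT x|lborel. \<bar>f i x\<bar>) \<le> b i" "summable b"
  shows "AE x in lborel. summable (\<lambda>i. \<bar>f i x\<bar>)"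
    and "integrable lborel (\<lambda>x. \<Sum>i. f i x)"
    and "(\<lambda>i. LINT x|lborel. f i x) sums (LINT x|lborel. (\<Sum>i. f i x))"
proof -
  have b0: "0 \<le> b i" for i
  proof -
    have "0 \<le> (LINT x|lborel. \<bar>f i x\<bar>)" by (intro integral_nonneg_AE) auto
    then show ?thesis using b(1)[of i] by linarith
  qed
  have m [measurable]: "f i \<in> borel_measurable lborel" for i using int by auto
  have "(\<integral>\<^sup>+x. (\<Sum>i. ennreal \<bar>f i x\<bar>) \<partial>lborel) = (\<Sum>i. \<integral>\<^sup>+x. ennreal \<bar>f i x\<bar> \<partial>lborel)"
    by (intro nn_integral_suminf) measurable
  also have "\<dots> = (\<Sum>i. ennreal (LINT x|lborel. \<bar>f i x\<bar>))"
    by (intro suminf_cong nn_integral_eq_integral integrable_abs int) auto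
  also have "\<dots> \<le> (\<Sum>i. ennreal (b i))" by (intro suminf_le ennreal_leI b) auto
  also have "\<dots> < top" using b(2) b0 by (simp add: ennreal_suminf_neq_top less_top[symmetric])
  finally have "(\<integral>\<^sup>+x. (\<Sum>i. ennreal \<bar>f i x\<bar>) \<partial>lborel) \<noteq> \<infinity>" by simp
  then have "AE x in lborel. (\<Sum>i. ennreal \<bar>f i x\<bar>) \<noteq> \<infinity>"
    by (intro nn_integral_PInf_AE) auto
  then show ae: "AE x in lborel. summable (\<lambda>i. \<bar>f i x\<bar>)"
    by eventually_elim (auto intro: summable_suminf_not_top)
  have s: "summable (\<lambda>i. LINT x|lborel. norm (f i x))"
    by (rule summable_comparison_test'[OF b(2), of 0]) (use b(1) in \<open>auto simp: integral_nonneg_AE\<close>)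
  show "integrable lborel (\<lambda>x. \<Sum>i. f i x)"
    by (rule integrable_suminf[OF int _ s]) (use ae in simp)
  show "(\<lambda>i. LINT x|lborel. f i x) sums (LINT x|lborel. (\<Sum>i. f i x))"
    by (rule sums_integral[OF int _ s]) (use ae in simp)
qed

context green_boundary
begin

lemma dens_integrable: "finitely_supported \<phi> \<Longrightarrow> integrable lborel (dens \<phi>)"
  using dens_moment_integrable[of \<phi> 0] by simp

lemma dens_integral: "finitely_supported \<phi> \<Longrightarrow> (LINT E|lborel. dens \<phi> E) = (norm \<phi>)\<^sup>2"
  using dens_moment[of \<phi> 0] by (simp add: power2_norm_eq_inner)

text \<open>
  The vector \<open>\<phi>\<close> is approximated by its restrictions \<open>v n\<close> to finite sets. If these converge fast enough, the
  differences of successive densities are summable in \<open>L\<^sup>1\<close>.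
\<close>

theorem spectral_density_exists:
  obtains \<rho> where "\<rho> \<in> borel_measurable lborel" "\<And>E. \<rho> E \<ge> 0"
    "\<And>n. integrable lborel (\<lambda>E. E ^ n * \<rho> E)"
    "\<And>n. (LINT E|lborel. E ^ n * \<rho> E) = inner \<phi> ((T ^^ n) \<phi>)"
    "\<And>E. \<forall>\<psi>. finitely_supported \<psi> \<longrightarrow> dens \<psi> E = 0 \<Longrightarrow> \<rho> E = 0"
proof -
  \<comment> \<open>the rate \<open>4\<^sup>-\<^sup>n\<close> leaves a geometric series after \<open>dens_diff_le\<close> has been applied with \<open>t = 2 ^ n\<close>\<close>
  obtain F where F: "\<And>n. finite (F n)" "\<And>n. norm (\<phi> - restrict_ell2 (F n) \<phi>) < (1 / 4) ^ n"
    and lim: "(\<lambda>n. restrict_ell2 (F n) \<phi>) \<longlonglongrightarrow> \<phi>"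
  proof (rule finite_support_approximation[of "\<lambda>n. (1 / 4) ^ n" \<phi>])
    show "(\<lambda>n. (1 / 4 :: real) ^ n) \<longlonglongrightarrow> 0" by (intro LIMSEQ_power_zero) simp
  qed (simp, rule that)
  define v where "v n = restrict_ell2 (F n) \<phi>" for n
  have fs: "finitely_supported (v n)" for n unfolding v_def by (rule finitely_supported_restrict[OF F(1)])
  define d where "d n = dens (v n)" for n
  define g where "g n E = d (Suc n) E - d n E" for n E
  define C where "C = 4 + 2 * (norm \<phi>)\<^sup>2"
  define b where "b n = C * (1 / 2) ^ n" for n
  have norm_v: "(norm (v n))\<^sup>2 \<le> (norm \<phi>)\<^sup>2" for n
    unfolding v_def by (intro power_mono norm_restrict_le F) auto
  have norm_step: "(norm (v (Suc n) - v n))\<^sup>2 \<le> 4 * (1 / 16) ^ n" for n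
  proof -
    have "norm (v (Suc n) - v n) \<le> norm (\<phi> - v n) + norm (\<phi> - v (Suc n))"
      using norm_triangle_ineq4[of "\<phi> - v n" "\<phi> - v (Suc n)"] by simp
    also have "\<dots> \<le> (1 / 4) ^ n + (1 / 4) ^ Suc n"
      using F(2)[of n] F(2)[of "Suc n"] by (auto simp: v_def intro: add_mono less_imp_le)
    also have "\<dots> \<le> 2 * (1 / 4) ^ n" by simp
    finally have "(norm (v (Suc n) - v n))\<^sup>2 \<le> (2 * (1 / 4) ^ n)\<^sup>2" by (intro power_mono) auto
    also have "\<dots> = 4 * (1 / 16) ^ n"
      by (simp add: power_mult_distrib power2_eq_square flip: power_mult_distrib)
    finally show ?thesis .
  qed
  have gi: "integrable lborel (\<lambda>E. E ^ k * g n E)" for k n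
    unfolding g_def d_def right_diff_distrib
    by (intro Bochner_Integration.integrable_diff dens_moment_integrable fs)
  have gb: "(LINT E|lborel. \<bar>g n E\<bar>) \<le> b n" for n
  proof -
    have "(LINT E|lborel. \<bar>g n E\<bar>) \<le>
        (LINT E|lborel. 2 ^ n * dens (v (Suc n) - v n) E + (d (Suc n) E + d n E) / 2 ^ n)"
    proof (rule integral_mono)
      show "integrable lborel (\<lambda>E. \<bar>g n E\<bar>)" using gi[of 0 n] by simp
      show "integrable lborel (\<lambda>E. 2 ^ n * dens (v (Suc n) - v n) E + (d (Suc n) E + d n E) / 2 ^ n)"
        unfolding d_def
        by (intro Bochner_Integration.integrable_add integrable_mult_right integrable_divide
            dens_integrable finitely_supported_diff fs)
    qed (use dens_diff_le[OF fs fs] in \<open>simp add: g_def d_def\<close>)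
    also have "\<dots> = 2 ^ n * (norm (v (Suc n) - v n))\<^sup>2 + ((norm (v (Suc n)))\<^sup>2 + (norm (v n))\<^sup>2) / 2 ^ n"
      unfolding d_def
      by (simp add: dens_integrable dens_integral finitely_supported_diff fs)
    also have "\<dots> \<le> 2 ^ n * (4 * (1 / 16) ^ n) + ((norm \<phi>)\<^sup>2 + (norm \<phi>)\<^sup>2) / 2 ^ n"
      by (intro add_mono mult_left_mono divide_right_mono norm_step norm_v) auto
    also have "2 ^ n * (4 * (1 / 16) ^ n) = (4 * (1 / 8) ^ n :: real)"
      by (simp add: power_mult_distrib[symmetric])
    also have "\<dots> \<le> 4 * (1 / 2) ^ n" by (intro mult_left_mono power_mono) auto
    also have "4 * (1 / 2) ^ n + ((norm \<phi>)\<^sup>2 + (norm \<phi>)\<^sup>2) / 2 ^ n = b n"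
      by (simp add: b_def C_def power_one_over field_simps)
    finally show ?thesis by simp
  qed
  have gbk: "(LINT E|lborel. \<bar>E ^ k * g n E\<bar>) \<le> \<tau> ^ k * b n" for k n
  proof -
    have "(LINT E|lborel. \<bar>E ^ k * g n E\<bar>) \<le> (LINT E|lborel. \<tau> ^ k * \<bar>g n E\<bar>)"
    proof (rule integral_mono)
      show "integrable lborel (\<lambda>E. \<bar>E ^ k * g n E\<bar>)" using gi[of k n] by simp
      show "integrable lborel (\<lambda>E. \<tau> ^ k * \<bar>g n E\<bar>)" using gi[of 0 n] by simp
      show "\<bar>E ^ k * g n E\<bar> \<le> \<tau> ^ k * \<bar>g n E\<bar>" for E
      proof (cases "\<bar>E\<bar> > \<tau>")
        case True
        then show ?thesis using dens_outside[OF fs True] by (simp add: g_def d_def)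
      next
        case False
        then show ?thesis unfolding abs_mult power_abs by (intro mult_right_mono power_mono) auto
      qed
    qed
    also have "\<dots> = \<tau> ^ k * (LINT E|lborel. \<bar>g n E\<bar>)" by simp
    also have "\<dots> \<le> \<tau> ^ k * b n" using \<tau>_nonneg by (intro mult_left_mono gb) auto
    finally show ?thesis .
  qed
  have sb: "summable (\<lambda>n. \<tau> ^ k * b n)" for k
    unfolding b_def by (intro summable_mult summable_geometric) auto
  note series = absolutely_summable_integrals[of "\<lambda>n E. E ^ k * g n E" "\<lambda>n. \<tau> ^ k * b n" for k, OF gi gbk sb]
  define \<rho>0 where "\<rho>0 E = d 0 E + (\<Sum>n. g n E)" for E
  have d_meas: "d n \<in> borel_measurable lborel" for n unfolding d_def by (rule dens_measurable[OF fs])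
  have g_meas: "g n \<in> borel_measurable lborel" for n
    unfolding g_def[abs_def] by (intro borel_measurable_diff d_meas)
  have \<rho>0_meas: "\<rho>0 \<in> borel_measurable lborel"
    unfolding \<rho>0_def[abs_def] by (intro borel_measurable_add d_meas borel_measurable_suminf g_meas)
  have ae_sum: "AE E in lborel. summable (\<lambda>n. g n E)"
    using series(1)[of 0] by eventually_elim (auto intro: summable_rabs_cancel)
  have ae_nonneg: "AE E in lborel. \<rho>0 E \<ge> 0"
    using ae_sum
  proof eventually_elim
    case (elim E)
    have "(\<Sum>i<n. g i E) = d n E - d 0 E" for n
      unfolding g_def by (rule sum_lessThan_telescope)
    then have "(\<lambda>n. d n E - d 0 E) \<longlonglongrightarrow> (\<Sum>n. g n E)" using summable_LIMSEQ[OF elim] by simp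
    then have "(\<lambda>n. d 0 E + (d n E - d 0 E)) \<longlonglongrightarrow> \<rho>0 E" unfolding \<rho>0_def by (intro tendsto_intros)
    then have "(\<lambda>n. d n E) \<longlonglongrightarrow> \<rho>0 E" by simp
    then show ?case by (rule tendsto_lowerbound) (auto simp: d_def dens_nonneg[OF fs])
  qed
  have eq: "AE E in lborel. E ^ k * \<rho>0 E = E ^ k * d 0 E + (\<Sum>n. E ^ k * g n E)" for k
    using ae_sum by eventually_elim (simp add: \<rho>0_def distrib_left suminf_mult)
  \<comment> \<open>the sum of the series is nonnegative almost everywhere; the maximum makes it so everywhere\<close>
  define \<rho> where "\<rho> E = max 0 (\<rho>0 E)" for E
  have \<rho>_meas: "\<rho> \<in> borel_measurable lborel"
    unfolding \<rho>_def[abs_def] by (intro borel_measurable_max borel_measurable_const \<rho>0_meas)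
  have eq': "AE E in lborel. E ^ k * d 0 E + (\<Sum>n. E ^ k * g n E) = E ^ k * \<rho> E" for k
    using eq[of k] ae_nonneg by eventually_elim (simp add: \<rho>_def)
  have int0: "integrable lborel (\<lambda>E. E ^ k * d 0 E)" for k
    unfolding d_def by (rule dens_moment_integrable[OF fs])
  have int: "integrable lborel (\<lambda>E. E ^ k * d 0 E + (\<Sum>n. E ^ k * g n E))" for k
    by (intro Bochner_Integration.integrable_add int0 series(2))
  show ?thesis
  proof
    show "\<rho> \<in> borel_measurable lborel" by (rule \<rho>_meas)
    show "\<rho> E \<ge> 0" for E by (simp add: \<rho>_def)
    show "\<rho> E = 0" if "\<forall>\<psi>. finitely_supported \<psi> \<longrightarrow> dens \<psi> E = 0" for E
      using that fs by (simp add: \<rho>_def \<rho>0_def g_def d_def)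
    fix k
    have meas: "(\<lambda>E. E ^ k * \<rho> E) \<in> borel_measurable lborel"
      by (intro borel_measurable_times \<rho>_meas borel_measurable_power) simp
    show "integrable lborel (\<lambda>E. E ^ k * \<rho> E)"
      by (rule integrable_cong_AE_imp[OF int[of k] meas]) (use eq'[of k] in \<open>auto simp: eq_commute\<close>)
    have "(LINT E|lborel. E ^ k * \<rho> E) = (LINT E|lborel. E ^ k * d 0 E + (\<Sum>n. E ^ k * g n E))"
      by (rule integral_cong_AE[OF meas borel_measurable_integrable[OF int[of k]]])
         (use eq'[of k] in \<open>auto simp: eq_commute\<close>)
    also have "\<dots> = (LINT E|lborel. E ^ k * d 0 E) + (LINT E|lborel. (\<Sum>n. E ^ k * g n E))"
      by (rule Bochner_Integration.integral_add[OF int0 series(2)])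
    also have "(LINT E|lborel. (\<Sum>n. E ^ k * g n E)) = inner \<phi> ((T ^^ k) \<phi>) - inner (v 0) ((T ^^ k) (v 0))"
    proof (rule LIMSEQ_unique)
      show "(\<lambda>N. \<Sum>n<N. LINT E|lborel. E ^ k * g n E) \<longlonglongrightarrow> (LINT E|lborel. (\<Sum>n. E ^ k * g n E))"
        using series(3)[of k] by (simp add: sums_def)
      have mom: "(LINT E|lborel. E ^ k * d n E) = inner (v n) ((T ^^ k) (v n))" for n
        unfolding d_def by (rule dens_moment[OF fs])
      have "(LINT E|lborel. E ^ k * g n E) = inner (v (Suc n)) ((T ^^ k) (v (Suc n))) - inner (v n) ((T ^^ k) (v n))" for n
        unfolding g_def right_diff_distrib mom[symmetric] d_def
        by (rule Bochner_Integration.integral_diff) (rule dens_moment_integrable[OF fs])+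
      then have "(\<Sum>n<N. LINT E|lborel. E ^ k * g n E) = inner (v N) ((T ^^ k) (v N)) - inner (v 0) ((T ^^ k) (v 0))" for N
        by (simp only: sum_lessThan_telescope[of "\<lambda>n. inner (v n) ((T ^^ k) (v n))"])
      moreover have "v \<longlonglongrightarrow> \<phi>" unfolding v_def[abs_def] by (rule lim)
      ultimately show "(\<lambda>N. \<Sum>n<N. LINT E|lborel. E ^ k * g n E) \<longlonglongrightarrow> inner \<phi> ((T ^^ k) \<phi>) - inner (v 0) ((T ^^ k) (v 0))"
        by (simp only:) (intro tendsto_intros bounded_linear.tendsto[OF T_power_bounded_linear])
    qed
    also have "(LINT E|lborel. E ^ k * d 0 E) = inner (v 0) ((T ^^ k) (v 0))"
      unfolding d_def by (rule dens_moment[OF fs])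
    finally show "(LINT E|lborel. E ^ k * \<rho> E) = inner \<phi> ((T ^^ k) \<phi>)" by simp
  qed
qed

text \<open>
  \<open>\<parallel>(T - E) \<phi>\<parallel>\<^sup>2\<close> is the integral of \<open>(x - E)\<^sup>2\<close> against the spectral density of \<open>\<phi>\<close>, which vanishes where
  \<open>|x - E| < e\<close>.
\<close>

lemma bounded_below_in_gap:
  assumes e: "e > 0" and gap: "\<And>E' \<psi>. \<bar>E' - E\<bar> < e \<Longrightarrow> finitely_supported \<psi> \<Longrightarrow> dens \<psi> E' = 0"
  shows "e * norm \<phi> \<le> norm (shift (of_real E) \<phi>)"
proof -
  obtain \<rho> where \<rho>: "\<rho> \<in> borel_measurable lborel" "\<And>E. \<rho> E \<ge> 0"
    "\<And>n. integrable lborel (\<lambda>E. E ^ n * \<rho> E)"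
    "\<And>n. (LINT E|lborel. E ^ n * \<rho> E) = inner \<phi> ((T ^^ n) \<phi>)"
    "\<And>E. \<forall>\<psi>. finitely_supported \<psi> \<longrightarrow> dens \<psi> E = 0 \<Longrightarrow> \<rho> E = 0"
    by (rule spectral_density_exists[of \<phi>]) (rule that)
  have i: "integrable lborel (\<lambda>x. x\<^sup>2 * \<rho> x)" "integrable lborel (\<lambda>x. x * \<rho> x)" "integrable lborel \<rho>"
    using \<rho>(3)[of 2] \<rho>(3)[of 1] \<rho>(3)[of 0] by simp_all
  have m: "(LINT x|lborel. x\<^sup>2 * \<rho> x) = inner (T \<phi>) (T \<phi>)" "(LINT x|lborel. x * \<rho> x) = inner \<phi> (T \<phi>)"
    "(LINT x|lborel. \<rho> x) = inner \<phi> \<phi>"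
    using \<rho>(4)[of 2] \<rho>(4)[of 1] \<rho>(4)[of 0] by (simp_all add: numeral_2_eq_2 T_symmetric)
  have expand: "(x - E)\<^sup>2 * \<rho> x = x\<^sup>2 * \<rho> x - 2 * E * (x * \<rho> x) + E\<^sup>2 * \<rho> x" for x
    by (simp add: power2_eq_square algebra_simps)
  have int: "integrable lborel (\<lambda>x. (x - E)\<^sup>2 * \<rho> x)"
    unfolding expand using i by (intro Bochner_Integration.integrable_add Bochner_Integration.integrable_diff integrable_mult_right)
  have "e\<^sup>2 * inner \<phi> \<phi> = (LINT x|lborel. e\<^sup>2 * \<rho> x)" by (simp add: m)
  also have "\<dots> \<le> (LINT x|lborel. (x - E)\<^sup>2 * \<rho> x)"
  proof (rule integral_mono)
    show "integrable lborel (\<lambda>x. e\<^sup>2 * \<rho> x)" using i by simp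
    show "e\<^sup>2 * \<rho> x \<le> (x - E)\<^sup>2 * \<rho> x" for x
    proof (cases "\<bar>x - E\<bar> < e")
      case True
      then show ?thesis using \<rho>(5)[of x] gap by simp
    next
      case False
      then have "e\<^sup>2 \<le> \<bar>x - E\<bar>\<^sup>2" using e by (intro power_mono) auto
      then show ?thesis using \<rho>(2)[of x] by (intro mult_right_mono) auto
    qed
  qed (rule int)
  also have "\<dots> = inner (T \<phi>) (T \<phi>) - 2 * E * inner \<phi> (T \<phi>) + E\<^sup>2 * inner \<phi> \<phi>"
    unfolding expand using i by (simp add: m)
  also have "\<dots> = inner (shift (of_real E) \<phi>) (shift (of_real E) \<phi>)"
    by (simp add: shift_def scaleC_simps inner_diff_left inner_diff_right inner_commute power2_eq_square algebra_simps)
  finally have "(e * norm \<phi>)\<^sup>2 \<le> (norm (shift (of_real E) \<phi>))\<^sup>2"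
    by (simp add: power2_norm_eq_inner power_mult_distrib)
  then show ?thesis by (rule power2_le_imp_le) simp
qed

text \<open>
  By \<open>dens_add_le\<close> the vectors of density zero form a subspace.
\<close>

lemma dens_eq_0_if_diagonal_real:
  assumes "E \<notin> D" and diag: "\<And>x. ((\<lambda>z. Im (coord (R z (unit_vec x)) x)) \<longlongrightarrow> 0) (boundary_filter E)"
    and fs: "finitely_supported \<phi>"
  shows "dens \<phi> E = 0"
proof -
  obtain F where F: "finite F" "\<phi> = restrict_ell2 F \<phi>" using fs by (auto simp: finitely_supported_def)
  have zero_fs: "finitely_supported (0 :: 'v ell2)" by (simp add: finitely_supported_iff)
  have unit_fs: "finitely_supported (scaleC c (unit_vec x))" for c and x :: 'v
    unfolding finitely_supported_iff by (rule finite_subset[of _ "{x}"]) (auto simp: coord_unit_vec)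
  have unit: "dens (scaleC c (unit_vec x)) E = 0" for c x
  proof -
    have "((\<lambda>z. Im (h (scaleC c (unit_vec x)) z)) \<longlongrightarrow> (cmod c)\<^sup>2 * 0) (boundary_filter E)"
    proof (rule Lim_transform_eventually)
      show "((\<lambda>z. (cmod c)\<^sup>2 * Im (coord (R z (unit_vec x)) x)) \<longlongrightarrow> (cmod c)\<^sup>2 * 0) (boundary_filter E)"
        by (intro tendsto_mult tendsto_const diag)
      have e: "cnj c * (c * u) = of_real ((cmod c)\<^sup>2) * u" for u
        by (simp only: complex_norm_square) (simp add: mult_ac)
      have im: "Im (cnj c * (c * u)) = (cmod c)\<^sup>2 * Im u" for u unfolding e by (simp del: of_real_power)
      show "\<forall>\<^sub>F z in boundary_filter E. (cmod c)\<^sup>2 * Im (coord (R z (unit_vec x)) x) = Im (h (scaleC c (unit_vec x)) z)"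
        using eventually_upper_half by eventually_elim (simp only: h_def cip_unit_vec R_scaleC coord_simps im less_irrefl less_imp_neq[symmetric] not_False_eq_True)
    qed
    moreover have "((\<lambda>z. Im (h (scaleC c (unit_vec x)) z)) \<longlongrightarrow> Im (Lim (boundary_filter E) (h (scaleC c (unit_vec x))))) (boundary_filter E)"
      by (intro tendsto_Im h_tendsto unit_fs assms)
    ultimately have "Im (Lim (boundary_filter E) (h (scaleC c (unit_vec x)))) = 0"
      using tendsto_unique[OF boundary_filter_nontrivial] by fastforce
    then show ?thesis by (simp add: dens_def)
  qed
  have "finitely_supported (\<Sum>x\<in>F. scaleC (coord \<phi> x) (unit_vec x)) \<and> dens (\<Sum>x\<in>F. scaleC (coord \<phi> x) (unit_vec x)) E = 0"
    using F(1)
  proof (induction F rule: finite_induct)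
    case empty
    show ?case using zero_fs unit[of 0] by (simp add: scaleC_simps)
  next
    case (insert x F)
    let ?s = "\<Sum>x\<in>F. scaleC (coord \<phi> x) (unit_vec x)"
    have sum_fs: "finitely_supported (scaleC (coord \<phi> x) (unit_vec x) + ?s)"
      using insert by (intro finitely_supported_add unit_fs) auto
    have "dens (scaleC (coord \<phi> x) (unit_vec x) + ?s) E \<le> 2 * 0 + 2 * 0"
      using dens_add_le[OF unit_fs, of ?s "coord \<phi> x" x E] insert unit by simp
    then show ?case using insert sum_fs dens_nonneg[OF sum_fs, of E] by simp
  qed
  then show ?thesis using F(2) by (simp add: restrict_ell2_def)
qed

end

section \<open>Bands and gaps of a label invariant operator\<close>

text \<open>
  An interval without points of \<open>D\<close> lies in \<open>C\<close> or in its complement. So each point of \<open>C\<close> belongs to an interval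
  between neighbouring points of \<open>D\<close> that is contained in \<open>C\<close>.
\<close>

lemma closure_eq_finite_union_Icc:
  fixes C D :: "real set"
  assumes D: "finite D" and CD: "C \<inter> D = {}" and C: "open C" "bounded C" and rest: "open (- D - C)"
  shows "\<exists>F. finite F \<and> (\<forall>I\<in>F. \<exists>\<alpha> \<beta>. \<alpha> < \<beta> \<and> I = {\<alpha>..\<beta>}) \<and> closure C = \<Union>F"
proof -
  define P where "P = {(\<alpha>, \<beta>). \<alpha> \<in> D \<and> \<beta> \<in> D \<and> \<alpha> < \<beta> \<and> {\<alpha><..<\<beta>} \<subseteq> C}"
  define F where "F = (\<lambda>(\<alpha>, \<beta>). {\<alpha>..\<beta>}) ` P"
  have "finite P" by (rule finite_subset[of _ "D \<times> D"]) (auto simp: P_def D)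
  then have finF: "finite F" by (simp add: F_def)
  have conn: "I \<subseteq> C" if "connected I" "I \<inter> D = {}" "I \<inter> C \<noteq> {}" for I
  proof -
    have "C \<inter> I = {} \<or> (- D - C) \<inter> I = {}"
      by (rule connectedD[OF that(1) C(1) rest]) (use that in auto)
    then show ?thesis using that by auto
  qed
  have "C \<subseteq> \<Union>F"
  proof
    fix E assume E: "E \<in> C"
    obtain B where B: "\<And>x. x \<in> C \<Longrightarrow> \<bar>x\<bar> \<le> B" using C(2) by (auto simp: bounded_iff)
    \<comment> \<open>otherwise \<open>C\<close> would contain a half-line, although it is bounded\<close>
    have low: "{d \<in> D. d < E} \<noteq> {}"
    proof
      assume none: "{d \<in> D. d < E} = {}"
      have "{..E} \<subseteq> C"
      proof (rule conn)
        have "d \<notin> D" if "d \<le> E" for d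
          using none E CD that by (cases "d = E") auto
        then show "{..E} \<inter> D = {}" by auto
      qed (use E in \<open>auto simp: is_interval_connected_1[symmetric] is_interval_ic\<close>)
      then have "min E (- B - 1) \<in> C" by auto
      from B[OF this] show False by linarith
    qed
    have up: "{d \<in> D. d > E} \<noteq> {}"
    proof
      assume none: "{d \<in> D. d > E} = {}"
      have "{E..} \<subseteq> C"
      proof (rule conn)
        have "d \<notin> D" if "d \<ge> E" for d
          using none E CD that by (cases "d = E") auto
        then show "{E..} \<inter> D = {}" by auto
      qed (use E in \<open>auto simp: is_interval_connected_1[symmetric] is_interval_ci\<close>)
      then have "max E (B + 1) \<in> C" by auto
      from B[OF this] show False by linarith
    qed
    define \<alpha> where "\<alpha> = Max {d \<in> D. d < E}"
    define \<beta> where "\<beta> = Min {d \<in> D. d > E}"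
    have \<alpha>: "\<alpha> \<in> {d \<in> D. d < E}" unfolding \<alpha>_def using low D by (intro Max_in) auto
    have \<beta>: "\<beta> \<in> {d \<in> D. d > E}" unfolding \<beta>_def using up D by (intro Min_in) auto
    have "{\<alpha><..<\<beta>} \<subseteq> C"
    proof (rule conn)
      have "d \<notin> D" if d: "\<alpha> < d" "d < \<beta>" for d
      proof
        assume "d \<in> D"
        then have "d \<noteq> E" using E CD by auto
        moreover have "d \<le> \<alpha>" if "d < E" unfolding \<alpha>_def using D \<open>d \<in> D\<close> that by (intro Max_ge) auto
        moreover have "\<beta> \<le> d" if "E < d" unfolding \<beta>_def using D \<open>d \<in> D\<close> that by (intro Min_le) auto
        ultimately show False using d by linarith
      qed
      then show "{\<alpha><..<\<beta>} \<inter> D = {}" by auto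
    qed (use E \<alpha> \<beta> in \<open>auto intro: convex_connected\<close>)
    then have "(\<alpha>, \<beta>) \<in> P" using \<alpha> \<beta> by (auto simp: P_def)
    then have "{\<alpha>..\<beta>} \<in> F" by (force simp: F_def)
    then show "E \<in> \<Union>F" using \<alpha> \<beta> by (intro UnionI[of "{\<alpha>..\<beta>}"]) auto
  qed
  moreover have "closed (\<Union>F)" using finF by (intro closed_Union) (auto simp: F_def)
  ultimately have "closure C \<subseteq> \<Union>F" by (rule closure_minimal)
  moreover have "\<Union>F \<subseteq> closure C"
  proof (rule Union_least)
    fix I assume "I \<in> F"
    then obtain \<alpha> \<beta> where I: "I = {\<alpha>..\<beta>}" "\<alpha> < \<beta>" "{\<alpha><..<\<beta>} \<subseteq> C" by (auto simp: F_def P_def)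
    have "I = closure {\<alpha><..<\<beta>}" using I by simp
    also have "\<dots> \<subseteq> closure C" by (rule closure_mono[OF I(3)])
    finally show "I \<subseteq> closure C" .
  qed
  ultimately have "closure C = \<Union>F" by blast
  moreover have "\<forall>I\<in>F. \<exists>\<alpha> \<beta>. \<alpha> < \<beta> \<and> I = {\<alpha>..\<beta>}" by (auto simp: F_def P_def)
  ultimately show ?thesis using finF by blast
qed

context tree_operator
begin

sublocale selfadjoint kop
  by (intro selfadjoint.intro bounded_linear_kop kop_symmetric kop_scaleC)

lemma coord_R_unit_vec:
  assumes "Im z > 0"
  shows "coord (R z (unit_vec y)) = green (\<Gamma> z) y"
proof -
  obtain \<phi> where "coord \<phi> = green (\<Gamma> z) y" "shift z \<phi> = unit_vec y"
    using green_in_ell2[OF assms, of y] by (auto simp: shift_def)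
  moreover from this have "R z (unit_vec y) = \<phi>" using assms by (intro R_eqI) auto
  ultimately show ?thesis by simp
qed

text \<open>
  Energies at which the Green function of the root has nonreal boundary value belong to the spectrum. Where the
  boundary value is real, it is real at all labels and all densities vanish. So the spectrum is the closure of the first
  set of energies.
\<close>

theorem spectral_structure:
  assumes irred: "\<And>k l. (\<lambda>k l. M k l > 0)\<^sup>*\<^sup>* k l"
  shows "\<exists>F. finite F \<and> (\<forall>I\<in>F. \<exists>\<alpha> \<beta>. \<alpha> < \<beta> \<and> I = {\<alpha>..\<beta>}) \<and> {E. \<not> bounded_below E} = \<Union>F"
    and "\<exists>\<rho>. \<rho> \<in> borel_measurable lborel \<and> (\<forall>E. \<rho> E \<ge> 0) \<and> (\<forall>E. bounded_below E \<longrightarrow> \<rho> E = 0) \<and>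
      (\<forall>n. integrable lborel (\<lambda>E. E ^ n * \<rho> E) \<and> (LINT E|lborel. E ^ n * \<rho> E) = inner \<phi> ((kop ^^ n) \<phi>))"
proof -
  obtain D :: "real set" and g :: "real \<Rightarrow> 'a \<Rightarrow> complex" where D: "finite D"
    and g: "\<And>E k. E \<notin> D \<Longrightarrow> ((\<lambda>z. \<Gamma> z k) \<longlongrightarrow> g E k) (boundary_filter E)"
    and realopen: "\<And>k. open {E. E \<notin> D \<and> g E k \<in> \<real>}" and nonrealopen: "\<And>k. open {E. E \<notin> D \<and> g E k \<notin> \<real>}"
    by (rule Gamma_boundary_values) (rule that)
  have lim: "((\<lambda>z. coord (R z (unit_vec y)) x) \<longlongrightarrow> green (g E) y x) (boundary_filter E)" if "E \<notin> D" for E x y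
  proof (rule Lim_transform_eventually)
    show "((\<lambda>z. green (\<Gamma> z) y x) \<longlongrightarrow> green (g E) y x) (boundary_filter E)"
      by (rule polynomial_expr_tendsto[OF polynomial_expr_green g[OF that]])
    show "\<forall>\<^sub>F z in boundary_filter E. green (\<Gamma> z) y x = coord (R z (unit_vec y)) x"
      using eventually_upper_half by eventually_elim (simp add: coord_R_unit_vec)
  qed
  interpret green_boundary kop D
  proof
    show "finite D" by (rule D)
    fix x y
    have "(\<lambda>z. green (\<Gamma> z) y x) holomorphic_on upper_half"
      by (rule polynomial_expr_holomorphic[OF polynomial_expr_green Gamma_holomorphic])
    then show "(\<lambda>z. coord (R z (unit_vec y)) x) holomorphic_on upper_half"
      by (rule holomorphic_transform) (simp add: coord_R_unit_vec)
    define C where "C = (\<Sum>k\<in>UNIV. 1 / sqrt (A k k))"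
    have "1 / sqrt (A k k) \<le> C" for k
      unfolding C_def by (rule member_le_sum) (use A_diag in \<open>auto intro: less_imp_le\<close>)
    then have GC: "cmod (\<Gamma> z k) \<le> C" if "Im z > 0" for z k using cmod_Gamma_le[OF that, of k] order.trans by blast
    obtain B where "\<And>g. \<forall>k. cmod (g k) \<le> C \<Longrightarrow> cmod (green g y x) \<le> B"
      using polynomial_expr_bounded[OF polynomial_expr_green[of y x], of C] by blast
    then show "\<exists>B. \<forall>z. Im z > 0 \<longrightarrow> cmod (coord (R z (unit_vec y)) x) \<le> B"
      using GC by (intro exI[of _ B]) (simp add: coord_R_unit_vec)
    show "\<exists>l. ((\<lambda>z. coord (R z (unit_vec y)) x) \<longlongrightarrow> l) (boundary_filter E)" if "E \<notin> D" for E
      using lim[OF that] by blast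
  qed
  have dens_bb: "dens \<psi> E = 0" if "bounded_below E" "finitely_supported \<psi>" for E \<psi>
    using that dens_eq_0_if_bounded_below by (auto simp: bounded_below_def)
  have dens_real: "dens \<psi> E = 0" if "E \<notin> D" "g E (a r) \<in> \<real>" "finitely_supported \<psi>" for E \<psi>
  proof (rule dens_eq_0_if_diagonal_real[OF that(1) _ that(3)])
    have "g E k \<in> \<real>" for k
      using irred[of "a r" k]
    proof (induction rule: rtranclp_induct)
      case (step k l)
      then show ?case using boundary_value_real_propagates[OF g[OF that(1)], of k l] A_pos_iff by blast
    qed (rule that(2))
    then have "green (g E) x x \<in> \<real>" for x by (rule green_diagonal_real)
    then have "Im (green (g E) x x) = 0" for x by (simp add: complex_is_Real_iff)
    then show "((\<lambda>z. Im (coord (R z (unit_vec x)) x)) \<longlongrightarrow> 0) (boundary_filter E)" for x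
      using tendsto_Im[OF lim[OF that(1), of x x]] by simp
  qed
  define C where "C = {E. E \<notin> D \<and> g E (a r) \<notin> \<real>}"
  have C_not: "\<not> bounded_below E" if "E \<in> C" for E
  proof
    assume bb: "bounded_below E"
    have E: "E \<notin> D" "g E (a r) \<notin> \<real>" using that by (auto simp: C_def)
    have fs: "finitely_supported (unit_vec r)"
      unfolding finitely_supported_iff by (rule finite_subset[of _ "{r}"]) (auto simp: coord_unit_vec)
    have "h (unit_vec r) = (\<lambda>z. coord (R z (unit_vec r)) r)"
      using cip_unit_vec[of 1 r "R _ (unit_vec r)"] by (intro ext) (simp add: h_def scaleC_simps)
    then have "(h (unit_vec r) \<longlongrightarrow> g E (a r)) (boundary_filter E)"
      using lim[OF E(1), of r r] by (simp add: green_root)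
    then have "Lim (boundary_filter E) (h (unit_vec r)) = g E (a r)"
      by (rule tendsto_Lim[OF boundary_filter_nontrivial])
    then have "Im (g E (a r)) = 0" using dens_bb[OF bb fs] E(1) by (simp add: dens_def)
    then show False using E(2) by (simp add: complex_is_Real_iff)
  qed
  \<comment> \<open>points of \<open>D\<close> may lie in the ball; \<open>dens\<close> is zero there by definition\<close>
  have bb_gap: "bounded_below E" if "e > 0" "ball E e \<inter> C = {}" for E e
    unfolding bounded_below_def
  proof (intro exI[of _ e] conjI allI bounded_below_in_gap that(1))
    fix E' and \<psi> :: "'v ell2" assume E': "\<bar>E' - E\<bar> < e" "finitely_supported \<psi>"
    then have "E' \<in> ball E e" by (simp add: dist_real_def abs_minus_commute)
    then have "E' \<notin> C" using that(2) by blast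
    then show "dens \<psi> E' = 0"
      using dens_real[of E' \<psi>] E'(2) by (cases "E' \<in> D") (auto simp: C_def dens_def)
  qed
  have "{E. \<not> bounded_below E} = closure C"
  proof
    have "closed {E. \<not> bounded_below E}"
      using bounded_below_open by (simp add: closed_def Collect_neg_eq)
    then show "closure C \<subseteq> {E. \<not> bounded_below E}" using C_not by (intro closure_minimal) auto
    show "{E. \<not> bounded_below E} \<subseteq> closure C"
    proof (rule subsetI, rule ccontr)
      fix E assume E: "E \<in> {E. \<not> bounded_below E}" "E \<notin> closure C"
      then have "E \<in> - closure C" "open (- closure C)" by auto
      then obtain e where "e > 0" "ball E e \<subseteq> - closure C" by (meson openE)
      then have "ball E e \<inter> C = {}" using closure_subset[of C] by blast
      then show False using bb_gap[OF \<open>e > 0\<close>] E(1) by simp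
    qed
  qed
  moreover have "\<exists>F. finite F \<and> (\<forall>I\<in>F. \<exists>\<alpha> \<beta>. \<alpha> < \<beta> \<and> I = {\<alpha>..\<beta>}) \<and> closure C = \<Union>F"
  proof (rule closure_eq_finite_union_Icc[OF D])
    show "C \<inter> D = {}" "open C" using nonrealopen[of "a r"] by (auto simp: C_def)
    have "- D - C = {E. E \<notin> D \<and> g E (a r) \<in> \<real>}" by (auto simp: C_def)
    then show "open (- D - C)" using realopen by simp
    have "\<bar>E\<bar> \<le> \<tau>" if "E \<in> C" for E using C_not[OF that] bounded_below_outside[of E] by force
    then show "bounded C" by (auto simp: bounded_iff)
  qed
  ultimately show "\<exists>F. finite F \<and> (\<forall>I\<in>F. \<exists>\<alpha> \<beta>. \<alpha> < \<beta> \<and> I = {\<alpha>..\<beta>}) \<and> {E. \<not> bounded_below E} = \<Union>F"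
    by simp
  show "\<exists>\<rho>. \<rho> \<in> borel_measurable lborel \<and> (\<forall>E. \<rho> E \<ge> 0) \<and> (\<forall>E. bounded_below E \<longrightarrow> \<rho> E = 0) \<and>
      (\<forall>n. integrable lborel (\<lambda>E. E ^ n * \<rho> E) \<and> (LINT E|lborel. E ^ n * \<rho> E) = inner \<phi> ((kop ^^ n) \<phi>))"
  proof (rule spectral_density_exists[of \<phi>], intro exI conjI allI impI)
    fix \<rho> E assume "\<And>E. \<forall>\<psi>. finitely_supported \<psi> \<longrightarrow> dens \<psi> E = 0 \<Longrightarrow> \<rho> E = 0" "bounded_below E"
    then show "\<rho> E = 0" using dens_bb by blast
  qed
qed

end

section \<open>Operators on weighted spaces\<close>

text \<open>
  Division by \<open>sqrt \<nu>\<close> is a unitary map from the unweighted space onto \<open>l2 \<nu>\<close>.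
\<close>

locale weighted_space =
  fixes \<nu> :: "'v \<Rightarrow> real"
  assumes \<nu>_pos: "\<nu> x > 0"
begin

definition emb :: "'v ell2 \<Rightarrow> 'v \<Rightarrow> complex" where
  "emb \<psi> x = coord \<psi> x / of_real (sqrt (\<nu> x))"

lemma sqrt_\<nu>: "sqrt (\<nu> x) > 0" "sqrt (\<nu> x) * sqrt (\<nu> x) = \<nu> x" "(sqrt (\<nu> x))\<^sup>2 = \<nu> x"
  using \<nu>_pos[of x] by simp_all

lemma cmod_emb: "(cmod (emb \<psi> x))\<^sup>2 * \<nu> x = (cmod (coord \<psi> x))\<^sup>2"
  using \<nu>_pos[of x] by (simp add: emb_def norm_divide power_divide)

lemma inj_emb: "inj emb"
proof (rule injI, rule ell2_eqI)
  fix \<phi> \<psi> x assume "emb \<phi> = emb \<psi>"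
  then have "emb \<phi> x = emb \<psi> x" by simp
  then show "coord \<phi> x = coord \<psi> x" using \<nu>_pos[of x] by (simp add: emb_def)
qed

lemma l2_eq_range: "l2 \<nu> = range emb"
proof (intro equalityI subsetI)
  fix \<phi> assume \<phi>: "\<phi> \<in> l2 \<nu>"
  define f where "f x = \<phi> x * of_real (sqrt (\<nu> x))" for x
  have "(cmod (f x))\<^sup>2 = (cmod (\<phi> x))\<^sup>2 * \<nu> x" for x
    using \<nu>_pos[of x] by (simp add: f_def norm_mult power_mult_distrib)
  then have "(\<lambda>x. (cmod (f x))\<^sup>2) summable_on UNIV" using \<phi> by (simp add: l2_def)
  then have "coord (Abs_ell2 f) = f" by (simp add: Abs_ell2_inverse)
  then have "emb (Abs_ell2 f) = \<phi>" using \<nu>_pos by (intro ext) (simp add: emb_def f_def less_imp_neq[symmetric])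
  then show "\<phi> \<in> range emb" by (metis rangeI)
qed (auto simp: l2_def cmod_emb summable_cmod_sq)

lemma l2_norm_emb: "l2_norm \<nu> (emb \<psi>) = norm \<psi>"
  unfolding l2_norm_def cmod_emb norm_sq_ell2[symmetric] by simp

lemma l2_inner_emb: "l2_inner \<nu> (emb \<phi>) (emb \<psi>) = cip \<phi> \<psi>"
proof -
  have eq: "cnj (emb \<phi> x) * emb \<psi> x * of_real (\<nu> x) = cnj (coord \<phi> x) * coord \<psi> x" for x
  proof -
    have "complex_of_real (\<nu> x) = of_real (sqrt (\<nu> x)) * of_real (sqrt (\<nu> x))"
      by (simp only: of_real_mult[symmetric] sqrt_\<nu>)
    then show ?thesis using \<nu>_pos[of x] by (simp add: emb_def)
  qed
  have re: "(\<lambda>x. Re (cnj (coord \<phi> x) * coord \<psi> x)) summable_on UNIV" by (rule summable_inner)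
  have im: "(\<lambda>x. Im (cnj (coord \<phi> x) * coord \<psi> x)) summable_on UNIV"
    using summable_inner[of "scaleC \<i> \<phi>" \<psi>] by (simp add: algebra_simps)
  have s: "(\<lambda>x. cnj (coord \<phi> x) * coord \<psi> x) summable_on UNIV"
  proof -
    have "(\<lambda>x. of_real (Re (cnj (coord \<phi> x) * coord \<psi> x)) + \<i> * of_real (Im (cnj (coord \<phi> x) * coord \<psi> x))) summable_on UNIV"
      by (intro summable_on_add summable_on_cmult_right summable_on_of_real re im)
    then show ?thesis by (simp only: complex_eq[symmetric])
  qed
  have "Re (\<Sum>\<^sub>\<infinity>x. cnj (coord \<phi> x) * coord \<psi> x) = inner \<phi> \<psi>"
    using infsum_Re[OF s] unfolding inner_ell2_def by simp
  moreover have "Im (\<Sum>\<^sub>\<infinity>x. cnj (coord \<phi> x) * coord \<psi> x) = inner (scaleC \<i> \<phi>) \<psi>"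
    using infsum_Im[OF s] unfolding inner_ell2_def by (simp add: algebra_simps)
  ultimately show ?thesis unfolding l2_inner_def eq cip_def by (simp add: complex_eq_iff)
qed

lemma emb_diff: "emb (\<phi> - \<psi>) x = emb \<phi> x - emb \<psi> x"
  and emb_scaleC: "emb (scaleC c \<phi>) x = c * emb \<phi> x"
  by (simp_all add: emb_def diff_divide_distrib)

lemma emb_sum: "emb (\<Sum>i\<in>S. f i) x = (\<Sum>i\<in>S. emb (f i) x)"
  by (simp add: emb_def sum_divide_distrib)

end

locale transferred_operator = weighted_space \<nu> + selfadjoint S
  for \<nu> :: "'v \<Rightarrow> real" and S :: "'v ell2 \<Rightarrow> 'v ell2" +
  fixes T :: "('v \<Rightarrow> complex) \<Rightarrow> ('v \<Rightarrow> complex)"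
  assumes T_emb: "T (emb \<psi>) = emb (S \<psi>)"
begin

lemma resolvent_set_iff:
  "z \<in> resolvent_set \<nu> T \<longleftrightarrow> bij (shift z) \<and> (\<exists>C. \<forall>\<psi>. norm \<psi> \<le> C * norm (shift z \<psi>))"
proof -
  have eq: "(\<lambda>x. T (emb \<psi>) x - z * emb \<psi> x) = emb (shift z \<psi>)" for \<psi>
    by (intro ext) (simp add: T_emb shift_def emb_diff emb_scaleC)
  define G where "G = (\<lambda>\<phi> x. T \<phi> x - z * \<phi> x)"
  have G: "G (emb \<psi>) = emb (shift z \<psi>)" for \<psi> unfolding G_def by (rule eq)
  have emb: "bij_betw emb UNIV (range emb)" using inj_emb by (simp add: bij_betw_def)
  have "bij_betw G (l2 \<nu>) (l2 \<nu>) \<longleftrightarrow> bij (shift z)"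
  proof -
    have "bij_betw G (range emb) (range emb) \<longleftrightarrow> bij_betw (G \<circ> emb) UNIV (range emb)"
      by (rule bij_betw_comp_iff[OF emb])
    also have "G \<circ> emb = emb \<circ> shift z" by (simp add: fun_eq_iff G)
    also have "bij_betw (emb \<circ> shift z) UNIV (range emb) \<longleftrightarrow> bij (shift z)"
      using bij_betw_comp_iff2[OF emb, of "shift z" UNIV] by simp
    finally show ?thesis by (simp add: l2_eq_range)
  qed
  moreover have "(\<forall>\<phi>\<in>l2 \<nu>. l2_norm \<nu> \<phi> \<le> C * l2_norm \<nu> (\<lambda>x. T \<phi> x - z * \<phi> x)) \<longleftrightarrow>
      (\<forall>\<psi>. norm \<psi> \<le> C * norm (shift z \<psi>))" for C
    by (simp add: l2_eq_range eq l2_norm_emb)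
  ultimately show ?thesis by (simp add: resolvent_set_def G_def)
qed

text \<open>
  Off the real line the resolvent exists by \<open>shift_surj\<close>; on it a lower bound suffices by \<open>shift_surj_real\<close>.
\<close>

lemma spectrum_eq: "spectrum \<nu> T = complex_of_real ` {E. \<not> bounded_below E}"
proof -
  have nonreal: "z \<in> resolvent_set \<nu> T" if "Im z \<noteq> 0" for z
    unfolding resolvent_set_iff
  proof
    show "bij (shift z)"
      using shift_surj[OF that] shift_inj[OF that] by (auto simp: bij_def inj_def surj_def) metis
    have "norm \<psi> \<le> (1 / \<bar>Im z\<bar>) * norm (shift z \<psi>)" for \<psi>
      using norm_shift_ge[of z \<psi>] that by (simp add: field_simps)
    then show "\<exists>C. \<forall>\<psi>. norm \<psi> \<le> C * norm (shift z \<psi>)" by blast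
  qed
  have real: "of_real E \<in> resolvent_set \<nu> T \<longleftrightarrow> bounded_below E" for E
  proof
    assume "of_real E \<in> resolvent_set \<nu> T"
    then obtain C where C: "\<And>\<psi>. norm \<psi> \<le> C * norm (shift (of_real E) \<psi>)" by (auto simp: resolvent_set_iff)
    have "1 / max C 1 * norm \<psi> \<le> norm (shift (of_real E) \<psi>)" for \<psi>
    proof -
      have "norm \<psi> \<le> max C 1 * norm (shift (of_real E) \<psi>)"
        by (rule order.trans[OF C]) (intro mult_right_mono; simp)
      then show ?thesis by (simp add: field_simps)
    qed
    then show "bounded_below E" unfolding bounded_below_def by (intro exI[of _ "1 / max C 1"]) auto
  next
    assume "bounded_below E"
    then obtain c where c: "c > 0" "\<And>\<psi>. c * norm \<psi> \<le> norm (shift (of_real E) \<psi>)" by (auto simp: bounded_below_def)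
    have "inj (shift (of_real E))"
    proof (rule injI)
      fix \<phi> \<psi> assume "shift (of_real E) \<phi> = shift (of_real E) \<psi>"
      then have "c * norm (\<phi> - \<psi>) \<le> 0" using c(2)[of "\<phi> - \<psi>"] by (simp add: shift.diff)
      then show "\<phi> = \<psi>" using c(1) by (simp add: mult_le_0_iff)
    qed
    moreover have "surj (shift (of_real E))" using shift_surj_real[OF c] by (metis surjI)
    moreover have "norm \<psi> \<le> (1 / c) * norm (shift (of_real E) \<psi>)" for \<psi>
      using c by (simp add: field_simps)
    ultimately show "of_real E \<in> resolvent_set \<nu> T" unfolding resolvent_set_iff bij_def by blast
  qed
  show ?thesis
  proof (intro equalityI subsetI)
    fix z assume "z \<in> spectrum \<nu> T"
    then have z: "z \<notin> resolvent_set \<nu> T" by (simp add: spectrum_def)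
    then have "Im z = 0" using nonreal[of z] by blast
    then have "z = of_real (Re z)" by (simp add: complex_eq_iff)
    then show "z \<in> complex_of_real ` {E. \<not> bounded_below E}" using z real[of "Re z"] by (metis imageI mem_Collect_eq)
  qed (auto simp: spectrum_def real)
qed

lemma T_power_emb: "(T ^^ n) (emb \<psi>) = emb ((S ^^ n) \<psi>)"
  by (induction n) (auto simp: T_emb)

text \<open>
  The polynomial identity is linear in the coefficients, so the moments suffice.
\<close>

lemma spectral_measure_density:
  assumes \<rho>: "\<rho> \<in> borel_measurable lborel" "\<And>E. \<rho> E \<ge> 0" "\<And>E. bounded_below E \<Longrightarrow> \<rho> E = 0"
    and int: "\<And>n. integrable lborel (\<lambda>E. E ^ n * \<rho> E)"
    and mom: "\<And>n. (LINT E|lborel. E ^ n * \<rho> E) = inner \<phi> ((S ^^ n) \<phi>)"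
  shows "spectral_measure \<nu> T (emb \<phi>) (density lborel (\<lambda>E. ennreal (\<rho> E)))"
  unfolding spectral_measure_def
proof (intro conjI allI)
  let ?\<mu> = "density lborel (\<lambda>E. ennreal (\<rho> E))"
  show "finite_measure ?\<mu>"
  proof
    have "emeasure ?\<mu> (space ?\<mu>) = (\<integral>\<^sup>+E. ennreal (\<rho> E) \<partial>lborel)"
      using \<rho>(1) by (subst emeasure_density) (auto intro!: nn_integral_cong)
    also have "\<dots> = ennreal (LINT E|lborel. \<rho> E)"
      using int[of 0] \<rho>(2) by (intro nn_integral_eq_integral) auto
    finally show "emeasure ?\<mu> (space ?\<mu>) \<noteq> \<infinity>" by simp
  qed
  show "sets ?\<mu> = sets borel" by simp
  have "(\<lambda>E. ennreal (\<rho> E)) \<in> borel_measurable lborel" using \<rho>(1) by simp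
  then show "AE E in ?\<mu>. complex_of_real E \<in> spectrum \<nu> T"
    unfolding spectrum_eq by (subst AE_density) (use \<rho>(3) in \<open>auto intro!: AE_I2\<close>)
  fix p :: "complex poly"
  have "poly_op p T (emb \<phi>) = emb (\<Sum>i\<le>degree p. scaleC (coeff p i) ((S ^^ i) \<phi>))"
    by (intro ext) (simp add: poly_op_def T_power_emb emb_sum emb_scaleC)
  then have "l2_inner \<nu> (emb \<phi>) (poly_op p T (emb \<phi>)) = (\<Sum>i\<le>degree p. coeff p i * of_real (LINT E|lborel. E ^ i * \<rho> E))"
    by (simp add: l2_inner_emb cip_sum_right cip_scaleC_right cip_T_power_real mom)
  also have "\<dots> = (\<Sum>i\<le>degree p. LINT E|lborel. coeff p i * of_real (E ^ i * \<rho> E))"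
    by (simp only: integral_mult_right_zero integral_complex_of_real)
  also have "\<dots> = (LINT E|lborel. (\<Sum>i\<le>degree p. coeff p i * of_real (E ^ i * \<rho> E)))"
    by (rule Bochner_Integration.integral_sum[symmetric]) (intro integrable_mult_right integrable_of_real int)
  also have "\<dots> = (LINT E|lborel. \<rho> E *\<^sub>R poly p (complex_of_real E))"
    by (intro Bochner_Integration.integral_cong refl)
       (simp add: poly_altdef scaleR_conv_of_real sum_distrib_left mult_ac)
  also have "\<dots> = (LINT E|?\<mu>. poly p (complex_of_real E))"
  proof (rule integral_density[symmetric])
    have "continuous_on UNIV (\<lambda>E. poly p (complex_of_real E))" by (intro continuous_intros)
    then show "(\<lambda>E. poly p (complex_of_real E)) \<in> borel_measurable lborel"
      using borel_measurable_continuous_onI by simp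
  qed (use \<rho> in auto)
  finally show "l2_inner \<nu> (emb \<phi>) (poly_op p T (emb \<phi>)) = (LINT E|?\<mu>. poly p (complex_of_real E))" .
qed

end

lemma matrix_power_pos_imp_path:
  assumes "matrix_power M n $ k $ l > 0"
  shows "(\<lambda>k l. M $ k $ l > 0)\<^sup>*\<^sup>* k l"
  using assms
proof (induction n arbitrary: k)
  case 0
  then have "k = l" by (simp add: matrix_power_def mat_def split: if_splits)
  then show ?case by simp
next
  case (Suc n)
  have eq: "matrix_power M (Suc n) $ k $ l = (\<Sum>p\<in>UNIV. M $ k $ p * matrix_power M n $ p $ l)"
    by (simp add: matrix_power_def matrix_matrix_mult_def)
  have "\<exists>p. M $ k $ p * matrix_power M n $ p $ l > 0"
  proof (rule ccontr)
    assume "\<not> ?thesis"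
    then have z: "(\<Sum>p\<in>UNIV. M $ k $ p * matrix_power M n $ p $ l) = 0" by (intro sum.neutral) auto
    show False using Suc.prems unfolding eq z by simp
  qed
  then obtain p where "M $ k $ p * matrix_power M n $ p $ l > 0" by blast
  then have "M $ k $ p > 0" "matrix_power M n $ p $ l > 0" by auto
  then show ?case using Suc.IH by (blast intro: converse_rtranclp_into_rtranclp)
qed

theorem theorem1:
  fixes M :: "nat ^ 'a ^ ('a::finite)"
    and j :: 'a
    and adj :: "'v \<Rightarrow> 'v \<Rightarrow> bool"
    and r :: 'v
    and a :: "'v \<Rightarrow> 'a"
    and \<nu> :: "'v \<Rightarrow> real"
    and T :: "('v \<Rightarrow> complex) \<Rightarrow> ('v \<Rightarrow> complex)"
  assumes M0: "CARD('a) = 1 \<longrightarrow> (\<forall>k l. M $ k $ l > 1)"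
    and M1: "\<forall>k. M $ k $ k \<ge> 1"
    and M2: "\<exists>n\<ge>1. \<forall>k l. matrix_power M n $ k $ l > 0"
    and tree: "substitution_tree M j adj r a"
    and measure: "label_invariant_measure a \<nu>"
    and T: "label_invariant_operator M adj a \<nu> T"
  shows "finite_union_of_intervals (spectrum \<nu> T) \<and> purely_ac_spectrum \<nu> T"
proof -
  obtain t :: "'v \<Rightarrow> 'v \<Rightarrow> complex" and w :: "'v \<Rightarrow> real" and m :: "'a \<Rightarrow> 'a \<Rightarrow> real" and m' :: "'a \<Rightarrow> real"
    where op: "\<forall>\<phi>\<in>l2 \<nu>. \<forall>x. T \<phi> x = (\<Sum>y\<in>{y. adj x y}. t x y * \<phi> y) + complex_of_real (w x) * \<phi> x"
      "\<forall>x y. t x y \<noteq> 0 \<longleftrightarrow> adj x y"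
      "\<forall>x y. t x y * complex_of_real (\<nu> x) = cnj (t y x) * complex_of_real (\<nu> y)"
      "\<forall>x y. adj x y \<longrightarrow> m (a x) (a y) = (cmod (t x y))\<^sup>2 * real (M $ a x $ a y)"
      "\<forall>x. m' (a x) = w x"
    using T unfolding label_invariant_operator_def by (elim exE conjE) (rule that)
  have T_eq: "T \<phi> x = (\<Sum>y\<in>{y. adj x y}. t x y * \<phi> y) + complex_of_real (w x) * \<phi> x" if "\<phi> \<in> l2 \<nu>" for \<phi> x
    by (rule op(1)[rule_format, OF that])
  have t_nz_iff: "t x y \<noteq> 0 \<longleftrightarrow> adj x y" for x y by (rule op(2)[rule_format])
  have t_sym: "t x y * complex_of_real (\<nu> x) = cnj (t y x) * complex_of_real (\<nu> y)" for x y by (rule op(3)[rule_format])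
  have m: "m (a x) (a y) = (cmod (t x y))\<^sup>2 * real (M $ a x $ a y)" if "adj x y" for x y
    by (rule op(4)[rule_format, OF that])
  have m': "m' (a x) = w x" for x by (rule op(5)[rule_format])
  have \<nu>_pos: "\<nu> x > 0" for x
    using measure unfolding label_invariant_measure_def by blast
  have \<nu>_label: "\<nu> x = \<nu> y" if "a x = a y" for x y
    using measure that unfolding label_invariant_measure_def by blast
  interpret weighted_space \<nu> by standard (rule \<nu>_pos)
  note subst_tree = tree
  interpret tree_graph adj r by standard (use tree in \<open>simp add: substitution_tree_def\<close>)
  have ch: "finite {y \<in> children x. a y = l}" "card {y \<in> children x. a y = l} = M $ a x $ l" for x l
  proof -
    have eq: "{y \<in> children x. a y = l} = {y. adj x y \<and> a y = l \<and> depth y = depth x + 1}"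
      by (auto simp: children_def)
    show "finite {y \<in> children x. a y = l}" "card {y \<in> children x. a y = l} = M $ a x $ l"
      using subst_tree unfolding eq substitution_tree_def Let_def by blast+
  qed
  define s where "s x y = t x y * of_real (sqrt (\<nu> x) / sqrt (\<nu> y))" for x y
  have cmod_s: "(cmod (s x y))\<^sup>2 = (cmod (t x y))\<^sup>2 * (\<nu> x / \<nu> y)" for x y
    using \<nu>_pos[of x] \<nu>_pos[of y]
    by (simp add: s_def norm_mult norm_divide power_mult_distrib power_divide)
  have s_label: "(cmod (s x y))\<^sup>2 = (cmod (s x' y'))\<^sup>2"
    if "y \<in> children x" "y' \<in> children x'" "a x = a x'" "a y = a y'" for x y x' y'
  proof -
    have adj: "adj x y" "adj x' y'" using that by (auto simp: children_def)
    have "M $ a x $ a y \<noteq> 0"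
    proof
      assume "M $ a x $ a y = 0"
      then have "{z \<in> children x. a z = a y} = {}" using ch[of x "a y"] by simp
      then show False using that(1) by auto
    qed
    then have "(cmod (t x y))\<^sup>2 = (cmod (t x' y'))\<^sup>2"
      using m[OF adj(1)] m[OF adj(2)] that(3,4) by simp
    then show ?thesis unfolding cmod_s using \<nu>_label[OF that(3)] \<nu>_label[OF that(4)] by simp
  qed
  define edge where "edge k l p \<longleftrightarrow> snd p \<in> children (fst p) \<and> a (fst p) = k \<and> a (snd p) = l" for k l p
  \<comment> \<open>the value \<open>1\<close> for labels that are not joined by an edge is an arbitrary positive number\<close>
  define \<beta> where "\<beta> k l = (if \<exists>p. edge k l p then (cmod (s (fst (SOME p. edge k l p)) (snd (SOME p. edge k l p))))\<^sup>2 else 1)" for k l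
  have s_\<beta>: "(cmod (s x y))\<^sup>2 = \<beta> (a x) (a y)" if "y \<in> children x" for x y
  proof -
    have e: "edge (a x) (a y) (x, y)" using that by (simp add: edge_def)
    then have "edge (a x) (a y) (SOME p. edge (a x) (a y) p)" by (rule someI)
    then have "(cmod (s (fst (SOME p. edge (a x) (a y) p)) (snd (SOME p. edge (a x) (a y) p))))\<^sup>2 = (cmod (s x y))\<^sup>2"
      using that by (intro s_label) (auto simp: edge_def)
    then show ?thesis using e by (auto simp: \<beta>_def)
  qed
  have t_nz: "t x y \<noteq> 0" if "adj x y" for x y
    using that t_nz_iff by blast
  interpret tree_operator adj r a "\<lambda>k l. M $ k $ l" \<beta> m' s
  proof
    fix x y :: 'v and k l :: 'a
    have "children x = (\<Union>l. {y \<in> children x. a y = l})" by auto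
    moreover have "finite (\<Union>l. {y \<in> children x. a y = l})" by (intro finite_UN_I ch) auto
    ultimately show "finite (children x)" by simp
    show "card {y \<in> children x. a y = l} = M $ a x $ l" by (rule ch)
    show "s x y = cnj (s y x)"
    proof -
      have nz: "complex_of_real (sqrt (\<nu> x)) \<noteq> 0" "complex_of_real (sqrt (\<nu> y)) \<noteq> 0"
        using \<nu>_pos[of x] \<nu>_pos[of y] by simp_all
      have sq: "complex_of_real (\<nu> x) = of_real (sqrt (\<nu> x)) * of_real (sqrt (\<nu> x))" for x
        by (simp only: of_real_mult[symmetric] sqrt_\<nu>)
      have "t x y * of_real (sqrt (\<nu> x)) * of_real (sqrt (\<nu> x)) = cnj (t y x) * of_real (sqrt (\<nu> y)) * of_real (sqrt (\<nu> y))"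
        using t_sym[of x y] unfolding sq[of x] sq[of y] by (simp only: mult.assoc)
      then show ?thesis using nz by (simp add: s_def field_simps)
    qed
    show "y \<in> children x \<Longrightarrow> (cmod (s x y))\<^sup>2 = \<beta> (a x) (a y)" by (rule s_\<beta>)
    show "\<beta> k l > 0"
    proof (cases "\<exists>p. edge k l p")
      case True
      then obtain p where p: "edge k l p" by blast
      then have "\<beta> k l = (cmod (s (fst p) (snd p)))\<^sup>2" using s_\<beta>[of "snd p" "fst p"] by (auto simp: edge_def)
      moreover have "t (fst p) (snd p) \<noteq> 0" using p t_nz by (auto simp: edge_def children_def)
      ultimately show ?thesis using \<nu>_pos[of "fst p"] \<nu>_pos[of "snd p"] by (simp add: s_def)
    qed (simp add: \<beta>_def)
    show "M $ k $ k \<ge> 1" using M1 by blast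
  qed
  interpret transferred_operator \<nu> kop T
  proof
    fix \<psi> :: "'v ell2"
    show "T (emb \<psi>) = emb (kop \<psi>)"
    proof
      fix x
      have nz: "complex_of_real (sqrt (\<nu> x)) \<noteq> 0" for x using \<nu>_pos[of x] by simp
      have "T (emb \<psi>) x = (\<Sum>y\<in>{y. adj x y}. t x y * emb \<psi> y) + complex_of_real (w x) * emb \<psi> x"
        by (rule T_eq) (simp add: l2_eq_range)
      also have "(\<Sum>y\<in>{y. adj x y}. t x y * emb \<psi> y) = (\<Sum>y\<in>{y. adj x y}. s x y * coord \<psi> y) / of_real (sqrt (\<nu> x))"
        unfolding sum_divide_distrib by (intro sum.cong refl) (simp add: emb_def s_def less_imp_neq[OF \<nu>_pos, symmetric])
      also have "\<dots> + complex_of_real (w x) * emb \<psi> x =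
          ((\<Sum>y\<in>{y. adj x y}. s x y * coord \<psi> y) + of_real (m' (a x)) * coord \<psi> x) / of_real (sqrt (\<nu> x))"
        by (simp add: emb_def m' add_divide_distrib)
      also have "(\<Sum>y\<in>{y. adj x y}. s x y * coord \<psi> y) + of_real (m' (a x)) * coord \<psi> x = coord (kop \<psi>) x"
        unfolding coord_kop using finite_neighbours adj_irrefl
        by (subst sum.insert) (auto simp: kernel_def intro!: sum.cong)
      finally show "T (emb \<psi>) x = emb (kop \<psi>) x" unfolding emb_def[of "kop \<psi>" x] .
    qed
  qed
  have irred: "(\<lambda>k l. M $ k $ l > 0)\<^sup>*\<^sup>* k l" for k l
    using M2 matrix_power_pos_imp_path by blast
  have "finite_union_of_intervals (spectrum \<nu> T)"
    using spectral_structure(1)[OF irred] unfolding finite_union_of_intervals_def spectrum_eq by metis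
  moreover have "purely_ac_spectrum \<nu> T"
    unfolding purely_ac_spectrum_def ac_subspace_def
  proof (intro equalityI subsetI CollectI conjI)
    fix \<phi> assume \<phi>: "\<phi> \<in> l2 \<nu>"
    then obtain \<psi> where \<psi>: "\<phi> = emb \<psi>" by (auto simp: l2_eq_range)
    obtain \<rho> where \<rho>: "\<rho> \<in> borel_measurable lborel" "\<And>E. \<rho> E \<ge> 0" "\<And>E. bounded_below E \<Longrightarrow> \<rho> E = 0"
      "\<And>n. integrable lborel (\<lambda>E. E ^ n * \<rho> E)"
      "\<And>n. (LINT E|lborel. E ^ n * \<rho> E) = inner \<psi> ((kop ^^ n) \<psi>)"
      using spectral_structure(2)[OF irred, of \<psi>] by blast
    have "absolutely_continuous lborel (density lborel (\<lambda>E. ennreal (\<rho> E)))"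
      by (rule absolutely_continuousI_density) (use \<rho>(1) in simp)
    then show "\<exists>\<mu>. spectral_measure \<nu> T \<phi> \<mu> \<and> absolutely_continuous lborel \<mu>"
      using spectral_measure_density[OF \<rho>] unfolding \<psi> by blast
  qed auto
  ultimately show ?thesis by blast
qed

end
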